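(* Let $p\in\mathbb{N}$ be an even integer. Let $f\in C^{p-2}(\mathbb{R},\mathbb{R})$ be a function with absolutely continuous derivative $f^{(p-2)}$, and assume that the weak derivative $f^{(p-1)}$ of $f^{(p-2)}$ is right-continuous and of bounded variation. Then for every $S\in C([0,T],\mathbb{R})$ in the class $\mathscr{L}^c_p(\pi)$ and every $t\in[0,T]$, $$f(S(t))-f(S(0))=\int_0^t f'(S(u))\,dS(u)+\frac{1}{(p-1)!}\int_{\mathbb{R}}\mathcal{L}^{p,c}_t(x)\,df^{(p-1)}(x),$$ where the first integral on the right-hand side is the modified F\"ollmer integral of order $p$ of $f$ for the path $S$ along $\pi$.
   Context: Fix $T>0$ and a nested sequence $\pi=(\pi_n)_{n\in\mathbb{N}}$ of partitions $\pi_n=\{0=t^n_0<\cdots<t^n_{N(\pi_n)}=T\}$ of $[0,T]$. The notation $[t_j,t_{j+1}]\in\pi_n$ means that $t_j<t_{j+1}$ are consecutive elements of $\pi_n$. For $S\in C([0,T],\mathbb{R})$ put $osc(S,\pi_n):=\max_{[t_j,t_{j+1}]\in\pi_n}\max_{r,s\in[t_j,t_{j+1}]}|S(s)-S(r)|$. $V_p(\pi)$ is the set of $S\in C([0,T],\mathbb{R})$ with $\lim_n osc(S,\pi_n)=0$ such that the measures $\mu^n:=\sum_{[t_j,t_{j+1}]\in\pi_n}|S(t_{j+1})-S(t_j)|^p\,\delta_{t_j}$ converge vaguely to a $\sigma$-finite measure $\mu$ without atoms; $[S]^p(t):=\mu([0,t])$ is the $p$-th variation of $S$. Local time as occupation density: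 for an even integer $p$ and $S\in V_p(\pi)$ let $m:=\min_{[0,T]}S$, $M:=\max_{[0,T]}S$. $\mathscr{L}^c_p(\pi)$ is the set of $S\in V_p(\pi)$ for which there is a jointly continuous mapping $[0,T]\times[m,M]\ni(t,x)\mapsto\mathcal{L}^{p,c}_t(x)\in[0,\infty)$ such that $$p\int_A\mathcal{L}^{p,c}_t(x)\,dx=\int_0^t\mathbf{1}_A(S(u))\,d[S]^p(u)$$ for each $t\in[0,T]$ and each Borel set $A$. ($\mathcal{L}^{p,c}_t$ is regarded as $0$ outside $[m,M]$.) Modified F\"ollmer integral of order $p$: let $S\in\mathscr{L}^c_p(\pi)$ and let $f$ be a given function. Assume there is a sequence $f_m\in C^\infty$, $m\in\mathbb{N}$, converging pointwise to $f$ as $m\to\infty$, such that the limit $\lim_{m\to\infty}\int_{\mathbb{R}}\mathcal{L}^{p,c}_t(x)f_m^{(p)}(x)\,dx=:I$ exists. Then the double limit $$\lim_{m\to\infty}\lim_{n\to\infty}\sum_{\substack{[t_j,t_{j+1}]\in\pi_n\\t_j\le t}}\sum_{k=1}^{p-1}\frac{f_m^{(k)}(S(t_j))}{k!}\big(S(t_{j+1})-S(t_j)\big)^k$$ exists and equals $f(S(t))-f(S(0))-\frac{I}{(p-1)!}$. If the limit $I$ has the same value regardless of the choice of the sequence $(f_m)_{m\in\mathbb{N}}$ for the given $f$, this double limit is denoted $\int_0^t f'(S(u))\,dS(u)$ and called the modified F\"ollmer integral of order $p$ of the function $f$ for the path $S$ along $\pi$.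
   Formalization: I can depend on the sequence (f_m), so existence and independence are proved for sequences with f_m^{(p)} locally bounded in L^1 and fitting end limits where L_t is nonzero at m, M; if the integral exists over all sequences the formula holds too. For constant S, L is set to 0. *)

theory Defs
  imports "HOL-Analysis.Analysis"
begin

subsection \<open>Partitions, oscillation and p-th variation\<close>

definition nested_partitions :: "real \<Rightarrow> (nat \<Rightarrow> real set) \<Rightarrow> bool" where
  "nested_partitions T \<pi> \<longleftrightarrow>
     (\<forall>n. finite (\<pi> n) \<and> {0, T} \<subseteq> \<pi> n \<and> \<pi> n \<subseteq> {0..T} \<and> \<pi> n \<subseteq> \<pi> (Suc n))"

text \<open>The pairs of consecutive elements of a finite set of reals.\<close>

definition consecutive :: "real set \<Rightarrow> (real \<times> real) set" where
  "consecutive P = {(a, b). a \<in> P \<and> b \<in> P \<and> a < b \<and> P \<inter> {a<..<b} = {}}"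

definition osc :: "(real \<Rightarrow> real) \<Rightarrow> real set \<Rightarrow> real" where
  "osc S P = Max ((\<lambda>(a, b). SUP (r, s)\<in>{a..b} \<times> {a..b}. \<bar>S s - S r\<bar>) ` consecutive P)"

text \<open>
  Vague convergence on the compact space \<open>[0,T]\<close>, where every continuous function is a test
  function. The left-hand sequence is the integral of \<open>\<phi>\<close> against the discrete measure
  with mass \<open>|S b - S a|^p\<close> at the left end point \<open>a\<close> of each partition interval \<open>[a,b]\<close>.
  Integrability is required explicitly because a Bochner integral of a non-integrable function
  is \<open>0\<close>.
\<close>

definition is_variation_measure ::
    "nat \<Rightarrow> (nat \<Rightarrow> real set) \<Rightarrow> real \<Rightarrow> (real \<Rightarrow> real) \<Rightarrow> real measure \<Rightarrow> bool" where
  "is_variation_measure p \<pi> T S \<mu> \<longleftrightarrow>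
     sets \<mu> = sets (restrict_space borel {0..T}) \<and>
     sigma_finite_measure \<mu> \<and>
     (\<forall>u\<in>{0..T}. emeasure \<mu> {u} = 0) \<and>
     (\<forall>\<phi>. continuous_on {0..T} \<phi> \<longrightarrow>
        integrable \<mu> \<phi> \<and>
        (\<lambda>n. \<Sum>(a, b)\<in>consecutive (\<pi> n). \<bar>S b - S a\<bar> ^ p * \<phi> a) \<longlonglongrightarrow> (LINT u|\<mu>. \<phi> u))"

definition V_class :: "nat \<Rightarrow> (nat \<Rightarrow> real set) \<Rightarrow> real \<Rightarrow> (real \<Rightarrow> real) set" where
  "V_class p \<pi> T =
     {S. continuous_on {0..T} S \<and> (\<lambda>n. osc S (\<pi> n)) \<longlonglongrightarrow> 0 \<and>
         (\<exists>\<mu>. is_variation_measure p \<pi> T S \<mu>)}"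

text \<open>
  The vague limit is unique, so the choice is immaterial. The p-th variation of \<open>S\<close> is the
  distribution function \<open>t \<mapsto> \<mu> [0,t]\<close> of this measure, so integration with respect to
  the p-th variation is integration with respect to \<open>\<mu>\<close>.
\<close>

definition variation_measure ::
    "nat \<Rightarrow> (nat \<Rightarrow> real set) \<Rightarrow> real \<Rightarrow> (real \<Rightarrow> real) \<Rightarrow> real measure" where
  "variation_measure p \<pi> T S = (SOME \<mu>. is_variation_measure p \<pi> T S \<mu>)"


subsection \<open>Local time as occupation density\<close>

definition path_min :: "real \<Rightarrow> (real \<Rightarrow> real) \<Rightarrow> real" where
  "path_min T S = Inf (S ` {0..T})"

definition path_max :: "real \<Rightarrow> (real \<Rightarrow> real) \<Rightarrow> real" where
  "path_max T S = Sup (S ` {0..T})"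

text \<open>
  The local time is extended by \<open>0\<close> outside the range of \<open>S\<close>. If \<open>S\<close> is constant, its range is
  a single point, a Lebesgue null set on which the occupation formula determines nothing; the
  local time is then normalised to \<open>0\<close>. This does not affect which paths possess a local time.
\<close>

definition is_local_time ::
    "nat \<Rightarrow> (nat \<Rightarrow> real set) \<Rightarrow> real \<Rightarrow> (real \<Rightarrow> real) \<Rightarrow> (real \<Rightarrow> real \<Rightarrow> real) \<Rightarrow> bool" where
  "is_local_time p \<pi> T S L \<longleftrightarrow>
     continuous_on ({0..T} \<times> {path_min T S..path_max T S}) (\<lambda>(t, x). L t x) \<and>
     (\<forall>t\<in>{0..T}. \<forall>x. 0 \<le> L t x) \<and>
     (\<forall>t\<in>{0..T}. \<forall>x.
        x \<notin> {path_min T S..path_max T S} \<or> path_min T S = path_max T S \<longrightarrow> L t x = 0) \<and>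
     (\<forall>t\<in>{0..T}. \<forall>A\<in>sets borel.
        real p * (LINT x:A|lborel. L t x) =
        (LINT u:{0..t}|variation_measure p \<pi> T S. indicator A (S u)))"

definition Lc_class :: "nat \<Rightarrow> (nat \<Rightarrow> real set) \<Rightarrow> real \<Rightarrow> (real \<Rightarrow> real) set" where
  "Lc_class p \<pi> T = {S \<in> V_class p \<pi> T. \<exists>L. is_local_time p \<pi> T S L}"


subsection \<open>Regularity of functions on the real line\<close>

definition C_k :: "nat \<Rightarrow> (real \<Rightarrow> real) \<Rightarrow> bool" where
  "C_k k f \<longleftrightarrow> (\<forall>j<k. \<forall>x. (deriv ^^ j) f differentiable (at x)) \<and> continuous_on UNIV ((deriv ^^ k) f)"

definition C_infinity :: "(real \<Rightarrow> real) \<Rightarrow> bool" where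
  "C_infinity f \<longleftrightarrow> (\<forall>k. C_k k f)"

text \<open>Absolute continuity and bounded variation on the line refer to all compact intervals.\<close>

definition absolutely_continuous_real :: "(real \<Rightarrow> real) \<Rightarrow> bool" where
  "absolutely_continuous_real h \<longleftrightarrow>
     (\<forall>a b. \<forall>\<epsilon>>0. \<exists>\<delta>>0. \<forall>I.
        finite I \<and> (\<forall>(u, v)\<in>I. a \<le> u \<and> u \<le> v \<and> v \<le> b) \<and>
        disjoint_family_on (\<lambda>(u, v). {u<..<v}) I \<and> (\<Sum>(u, v)\<in>I. v - u) < \<delta> \<longrightarrow>
        (\<Sum>(u, v)\<in>I. \<bar>h v - h u\<bar>) < \<epsilon>)"

definition is_weak_derivative :: "(real \<Rightarrow> real) \<Rightarrow> (real \<Rightarrow> real) \<Rightarrow> bool" where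
  "is_weak_derivative h g \<longleftrightarrow>
     (\<forall>a b. set_integrable lborel {a..b} h \<and> set_integrable lborel {a..b} g) \<and>
     (\<forall>\<phi>. C_infinity \<phi> \<and> compact (closure {x. \<phi> x \<noteq> 0}) \<longrightarrow>
        (LINT x|lborel. h x * deriv \<phi> x) = - (LINT x|lborel. g x * \<phi> x))"

definition variation_sums :: "(real \<Rightarrow> real) \<Rightarrow> real \<Rightarrow> real \<Rightarrow> real set" where
  "variation_sums g a b =
     {(\<Sum>(u, v)\<in>consecutive P. \<bar>g v - g u\<bar>) | P. finite P \<and> P \<subseteq> {a..b}}"

definition bounded_variation :: "(real \<Rightarrow> real) \<Rightarrow> bool" where
  "bounded_variation g \<longleftrightarrow> (\<forall>a b. bdd_above (variation_sums g a b))"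

definition right_continuous :: "(real \<Rightarrow> real) \<Rightarrow> bool" where
  "right_continuous g \<longleftrightarrow> (\<forall>x. continuous (at_right x) g)"

text \<open>
  For right-continuous \<open>g\<close> of bounded variation, \<open>V\<close> and \<open>V - g\<close> are nondecreasing and
  right-continuous, where \<open>V\<close> is the signed total variation of \<open>g\<close> counted from \<open>0\<close>; the signed
  measure \<open>dg\<close> is \<open>dV - d(V - g)\<close>.
\<close>

definition signed_variation :: "(real \<Rightarrow> real) \<Rightarrow> real \<Rightarrow> real" where
  "signed_variation g x =
     (if 0 \<le> x then Sup (variation_sums g 0 x) else - Sup (variation_sums g x 0))"

definition stieltjes_integral :: "(real \<Rightarrow> real) \<Rightarrow> (real \<Rightarrow> real) \<Rightarrow> real" where
  "stieltjes_integral h g =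
     (LINT x|interval_measure (signed_variation g). h x) -
     (LINT x|interval_measure (\<lambda>x. signed_variation g x - g x). h x)"


subsection \<open>The modified Foellmer integral\<close>

definition foellmer_sum ::
    "nat \<Rightarrow> (nat \<Rightarrow> real set) \<Rightarrow> (real \<Rightarrow> real) \<Rightarrow> (real \<Rightarrow> real) \<Rightarrow> real \<Rightarrow> nat \<Rightarrow> real" where
  "foellmer_sum p \<pi> S h t n =
     (\<Sum>(a, b)\<in>{(a, b) \<in> consecutive (\<pi> n). a \<le> t}.
        \<Sum>k = 1..p - 1. (deriv ^^ k) h (S a) / fact k * (S b - S a) ^ k)"

definition has_iterated_limit :: "(nat \<Rightarrow> nat \<Rightarrow> real) \<Rightarrow> real \<Rightarrow> bool" where
  "has_iterated_limit s J \<longleftrightarrow> (\<exists>c. (\<forall>i. (\<lambda>n. s i n) \<longlonglongrightarrow> c i) \<and> c \<longlonglongrightarrow> J)"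

definition smooth_approximation :: "(real \<Rightarrow> real) \<Rightarrow> (nat \<Rightarrow> real \<Rightarrow> real) \<Rightarrow> bool" where
  "smooth_approximation f F \<longleftrightarrow> (\<forall>i. C_infinity (F i)) \<and> (\<forall>x. (\<lambda>i. F i x) \<longlonglongrightarrow> f x)"

definition admissible ::
    "nat \<Rightarrow> (real \<Rightarrow> real) \<Rightarrow> (real \<Rightarrow> real) \<Rightarrow> (nat \<Rightarrow> real \<Rightarrow> real) \<Rightarrow> real \<Rightarrow> bool" where
  "admissible p l f F I \<longleftrightarrow>
     smooth_approximation f F \<and> (\<lambda>i. LINT x|lborel. l x * (deriv ^^ p) (F i) x) \<longlonglongrightarrow> I"

text \<open>
  \<open>\<A>\<close> is the class of approximating sequences allowed to compete; \<open>\<A> = UNIV\<close> allows every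
  sequence of smooth functions that converges pointwise to \<open>f\<close> and for which the limit \<open>I\<close> exists.
  The integral has the value \<open>J\<close> if some sequence is admissible, \<open>I\<close> does not depend on the choice
  of the admissible sequence, and \<open>J\<close> is the iterated limit of the compensated sums along each of
  them. \<open>l\<close> is the local time of \<open>S\<close> at time \<open>t\<close>.
\<close>

definition has_modified_foellmer_integral ::
    "nat \<Rightarrow> (nat \<Rightarrow> real set) \<Rightarrow> (real \<Rightarrow> real) \<Rightarrow> (real \<Rightarrow> real) \<Rightarrow> (nat \<Rightarrow> real \<Rightarrow> real) set \<Rightarrow>
     (real \<Rightarrow> real) \<Rightarrow> real \<Rightarrow> real \<Rightarrow> bool" where
  "has_modified_foellmer_integral p \<pi> S l \<A> f t J \<longleftrightarrow>
     (\<exists>F\<in>\<A>. \<exists>I. admissible p l f F I) \<and>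
     (\<forall>F\<in>\<A>. \<forall>G\<in>\<A>. \<forall>I K. admissible p l f F I \<and> admissible p l f G K \<longrightarrow> I = K) \<and>
     (\<forall>F\<in>\<A>. \<forall>I. admissible p l f F I \<longrightarrow>
        has_iterated_limit (\<lambda>i n. foellmer_sum p \<pi> S (F i) t n) J)"

text \<open>
  With \<open>\<A> = UNIV\<close> the limit \<open>I\<close> is in general not independent of the sequence. Already for
  \<open>f = 0\<close>: unless the distribution \<open>D^p l\<close> has finite support, there are test functions \<open>F i\<close> with
  pairwise disjoint supports and \<open>\<integral> l * (F i)^(p) = 1\<close>; they tend to \<open>0\<close> pointwise, but \<open>F i = 0\<close>
  gives the limit \<open>0\<close>. The following sequences exclude this by a local bound on the total
  variation of the derivatives of order \<open>p - 1\<close>. Moreover, \<open>l\<close> is continuous on \<open>[m,M]\<close> but may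
  jump to \<open>0\<close> at \<open>m\<close> and \<open>M\<close> (as for a reflected Brownian path at its minimum). Where it does,
  mass of the derivative of order \<open>p\<close> accumulating at that end point must be counted as in the
  integral of \<open>l\<close> with respect to \<open>dg\<close>, which charges the closed interval \<open>[m,M]\<close> with mass
  \<open>g(M) - g(m-)\<close>. If \<open>l\<close> vanishes at \<open>m\<close> and \<open>M\<close>, the end point conditions are void.
\<close>

definition tame_sequences ::
    "nat \<Rightarrow> (real \<Rightarrow> real) \<Rightarrow> real \<Rightarrow> real \<Rightarrow> (real \<Rightarrow> real) \<Rightarrow> (nat \<Rightarrow> real \<Rightarrow> real) set" where
  "tame_sequences p l m M g =
     {F. (\<forall>a b. \<exists>C. \<forall>i. (LINT x:{a..b}|lborel. \<bar>(deriv ^^ p) (F i) x\<bar>) \<le> C) \<and>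
         (l m \<noteq> 0 \<longrightarrow> (\<lambda>i. (deriv ^^ (p - 1)) (F i) m) \<longlonglongrightarrow> Lim (at_left m) g) \<and>
         (l M \<noteq> 0 \<longrightarrow> (\<lambda>i. (deriv ^^ (p - 1)) (F i) M) \<longlonglongrightarrow> g M)}"

end

theory Submission
  imports Defs
begin

text \<open>
  For a smooth function \<open>F\<close>, Taylor's formula of order \<open>p\<close> on each partition interval \<open>[a,b]\<close> with
  \<open>a \<le> t\<close> writes the increment of \<open>F\<close> along \<open>S\<close> as a compensated term of order \<open>p - 1\<close>, the
  term \<open>F^(p)(S a) (S b - S a)^p / p!\<close>, and a remainder governed by the modulus of continuity of
  \<open>F^(p)\<close> and the oscillation of \<open>S\<close>. As \<open>p\<close> is even, the powers \<open>(S b - S a)^p\<close> are the weights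
  of the discrete measures that converge vaguely to the variation measure, which has no atom at
  \<open>t\<close>; so the sums of the second terms converge to \<open>\<integral> F^(p)(S u) d[S]^p(u) / p!\<close> over \<open>[0,t]\<close>
  (\<open>variation_sums_up_to_converge\<close>, \<open>foellmer_sum_limit\<close>), which the occupation formula turns into
  \<open>\<integral> L t x * F^(p) x dx / (p - 1)!\<close> (\<open>occupation_integral\<close>). Hence along every admissible
  sequence with limit \<open>I\<close> the iterated limit is \<open>f (S t) - f (S 0) - I / (p - 1)!\<close>
  (\<open>foellmer_iterated_limit\<close>). What remains concerns \<open>I\<close> alone: it equals the integral of
  \<open>L t\<close> with respect to \<open>dg\<close> for every tame sequence that converges pointwise to \<open>f\<close>, and there is
  such a sequence. The statement about all admissible sequences then follows by evaluating the
  common value at one tame sequence.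

  Let \<open>F i\<close> be tame (\<open>tame_integrals_converge\<close>). Pointwise convergence of \<open>F i\<close> and a local bound on
  the variation of the derivatives of order \<open>p - 1\<close> bound all derivatives up to order \<open>p - 1\<close>
  locally (\<open>derivatives_uniformly_bounded\<close>), and therefore those up to order \<open>p - 2\<close> converge
  pointwise to the derivatives of \<open>f\<close> (\<open>derivatives_converge\<close>). The derivatives \<open>G i\<close> of order
  \<open>p - 1\<close> need not converge pointwise, but their integrals over intervals converge to those of
  \<open>g\<close>, because \<open>g\<close> integrates to the increments of \<open>f^(p-2)\<close> (\<open>weak_derivative_increment\<close>). The
  local time is approximated uniformly on \<open>[m,M]\<close> by polynomials \<open>\<Lambda>\<close> with the same values at \<open>m\<close>
  and \<open>M\<close>. Integration by parts moves the derivative from \<open>G i\<close> to \<open>\<Lambda>\<close>, where weak convergence and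
  the end point conditions give the limit; the same integration by parts for the Stieltjes
  integral (\<open>integral_by_parts_Icc\<close>) identifies it as the integral of \<open>\<Lambda>\<close> with respect to \<open>dg\<close>. The
  bounds on the variation of \<open>G i\<close> and of \<open>g\<close> control the error (\<open>stieltjes_integral_limit\<close>).

  A tame sequence is found by writing \<open>g\<close> as a difference of nondecreasing right-continuous
  functions and interpolating samples of each by a nondecreasing smooth function. Samples taken
  to the left near \<open>m\<close> and to the right near \<open>M\<close> produce the limits \<open>g(m-)\<close> and \<open>g(M)\<close>; integrating
  \<open>p - 1\<close> times gives \<open>F i\<close> (\<open>exists_tame_approximation\<close>).
\<close>

section \<open>Smooth functions on the line\<close>

lemma C_k_0: "C_k 0 f \<longleftrightarrow> continuous_on UNIV f"
  by (simp add: C_k_def)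

lemma C_k_Suc: "C_k (Suc n) f \<longleftrightarrow> (\<forall>x. f differentiable (at x)) \<and> C_k n (deriv f)"
proof -
  have eq: "(deriv ^^ j) (deriv f) = (deriv ^^ Suc j) f" for j
    by (simp add: funpow_swap1)
  have "(\<forall>j<Suc n. \<forall>x. (deriv ^^ j) f differentiable (at x)) \<longleftrightarrow>
        (\<forall>x. f differentiable (at x)) \<and> (\<forall>j<n. \<forall>x. (deriv ^^ Suc j) f differentiable (at x))"
    by (metis (mono_tags, lifting) funpow_0 less_Suc_eq_0_disj)
  then show ?thesis
    unfolding C_k_def eq by auto
qed

lemma C_k_SucI:
  assumes "\<And>x. (f has_real_derivative f' x) (at x)" and "C_k n f'"
  shows "C_k (Suc n) f"
proof -
  have "deriv f = f'"
    using assms(1) by (auto intro!: ext DERIV_imp_deriv)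
  with assms show ?thesis
    unfolding C_k_Suc using real_differentiable_def by blast
qed

lemma C_k_SucD:
  assumes "C_k (Suc n) f"
  shows "(f has_real_derivative deriv f x) (at x)" "C_k n (deriv f)"
  using assms unfolding C_k_Suc by (auto simp: DERIV_deriv_iff_real_differentiable)

lemma C_k_decreasing: "C_k (Suc n) f \<Longrightarrow> C_k n f"
proof (induction n arbitrary: f)
  case 0
  then show ?case
    using C_k_SucD(1)[OF 0] by (auto simp: C_k_0 intro!: continuous_at_imp_continuous_on DERIV_isCont)
next
  case (Suc n)
  then show ?case by (auto simp: C_k_Suc[of _ f])
qed

lemma C_k_const: "C_k n (\<lambda>x. c)"
proof (induction n arbitrary: c)
  case (Suc n)
  show ?case by (rule C_k_SucI[where f' = "\<lambda>_. 0", OF _ Suc]) auto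
qed (simp add: C_k_0)

lemma C_k_add: "C_k n f \<Longrightarrow> C_k n g \<Longrightarrow> C_k n (\<lambda>x. f x + g x)"
proof (induction n arbitrary: f g)
  case 0
  then show ?case unfolding C_k_0 by (rule continuous_on_add)
next
  case (Suc n)
  show ?case
    by (rule C_k_SucI[OF DERIV_add[OF C_k_SucD(1)[OF Suc.prems(1)] C_k_SucD(1)[OF Suc.prems(2)]]])
       (intro Suc.IH C_k_SucD(2) Suc.prems)
qed

lemma C_k_mult: "C_k n f \<Longrightarrow> C_k n g \<Longrightarrow> C_k n (\<lambda>x. f x * g x)"
proof (induction n arbitrary: f g)
  case 0
  then show ?case unfolding C_k_0 by (rule continuous_on_mult)
next
  case (Suc n)
  have "C_k n (\<lambda>x. deriv f x * g x + deriv g x * f x)"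
    using Suc.prems by (intro C_k_add Suc.IH) (auto intro: C_k_SucD(2) dest: C_k_decreasing)
  with DERIV_mult[OF C_k_SucD(1)[OF Suc.prems(1)] C_k_SucD(1)[OF Suc.prems(2)]]
  show ?case by (rule C_k_SucI)
qed

lemma C_k_affine: "C_k n f \<Longrightarrow> C_k n (\<lambda>x. f (c * x + d))"
proof (induction n arbitrary: f)
  case 0
  then show ?case
    using continuous_on_compose2[of UNIV f UNIV "\<lambda>x. c * x + d"]
    by (simp add: C_k_0 continuous_intros)
next
  case (Suc n)
  have "((\<lambda>x. f (c * x + d)) has_real_derivative deriv f (c * x + d) * c) (at x)" for x
    by (rule DERIV_chain2[OF C_k_SucD(1)[OF Suc.prems]]) (auto intro!: derivative_eq_intros)
  then show ?case
    by (rule C_k_SucI) (intro C_k_mult C_k_const Suc.IH C_k_SucD(2)[OF Suc.prems])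
qed

lemma C_k_sum: "finite A \<Longrightarrow> (\<And>a. a \<in> A \<Longrightarrow> C_k n (F a)) \<Longrightarrow> C_k n (\<lambda>x. \<Sum>a\<in>A. F a x)"
  by (induction rule: finite_induct) (auto intro: C_k_const C_k_add)

lemma C_infinity_diff: "C_infinity f \<Longrightarrow> C_infinity g \<Longrightarrow> C_infinity (\<lambda>x. f x - g x)"
  using C_k_add[of _ f "\<lambda>x. (-1) * g x"] C_k_mult[of _ "\<lambda>_. -1" g] C_k_const[of _ "-1"]
  by (simp add: C_infinity_def)

lemma C_infinity_affine: "C_infinity f \<Longrightarrow> C_infinity (\<lambda>x. f (c * x + d))"
  by (simp add: C_infinity_def C_k_affine)

lemma C_infinity_antiderivative:
  assumes "\<And>x. (f has_real_derivative f' x) (at x)" and "C_infinity f'"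
  shows "C_infinity f"
  unfolding C_infinity_def
proof
  fix k
  from assms(2) have "C_k k f'" by (simp add: C_infinity_def)
  from C_k_SucI[OF assms(1) this] show "C_k k f" by (rule C_k_decreasing)
qed

lemma C_infinity_has_derivative:
  assumes "C_infinity f"
  shows "((deriv ^^ n) f has_real_derivative (deriv ^^ Suc n) f x) (at x)"
proof -
  have "(deriv ^^ n) f differentiable (at x)"
    using assms unfolding C_infinity_def C_k_def by blast
  then show ?thesis by (simp add: DERIV_deriv_iff_real_differentiable)
qed

lemma C_infinity_continuous: "C_infinity f \<Longrightarrow> continuous_on A ((deriv ^^ n) f)"
  by (meson C_infinity_def C_k_def continuous_on_subset top_greatest)

text \<open>
  Dividing \<open>exp (- 1 / x)\<close> by powers of \<open>x\<close> gives a family whose derivatives are linear combinations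
  of its members. Smoothness of the flat function at \<open>0\<close> then follows for the whole family at once,
  without a formula for the higher derivatives.
\<close>

definition flat_exp :: "nat \<Rightarrow> real \<Rightarrow> real" where
  "flat_exp k x = (if x \<le> 0 then 0 else exp (- 1 / x) / x ^ k)"

lemma flat_exp_tendsto_0: "(flat_exp k \<longlongrightarrow> 0) (at 0)"
proof (rule filterlim_split_at)
  show "(flat_exp k \<longlongrightarrow> 0) (at_left 0)"
    by (rule Lim_transform_eventually[OF tendsto_const])
       (auto simp: flat_exp_def eventually_at_filter)
  have "((\<lambda>y. y ^ k / exp y) \<longlongrightarrow> (0::real)) at_top"
    by (rule tendsto_power_div_exp_0)
  then have "((\<lambda>x::real. inverse x ^ k / exp (inverse x)) \<longlongrightarrow> 0) (at_right 0)"
    by (rule filterlim_compose[OF _ filterlim_inverse_at_top_right])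
  then show "(flat_exp k \<longlongrightarrow> 0) (at_right 0)"
    by (rule Lim_transform_eventually)
       (simp add: flat_exp_def eventually_at_filter exp_minus divide_inverse power_inverse mult.commute)
qed

lemma flat_exp_has_derivative:
  "(flat_exp k has_real_derivative flat_exp (k + 2) x - real k * flat_exp (k + 1) x) (at x)"
proof (cases "x = 0")
  case True
  have "((\<lambda>h. (flat_exp k (0 + h) - flat_exp k 0) / h) \<longlongrightarrow> 0) (at 0)"
    by (rule Lim_transform_eventually[OF flat_exp_tendsto_0[of "Suc k"]])
       (simp add: flat_exp_def eventually_at_filter)
  then show ?thesis
    using True by (simp add: DERIV_def flat_exp_def)
next
  case False
  then consider "x < 0" | "x > 0" by linarith
  then show ?thesis
  proof cases
    case 1
    have "(flat_exp k has_real_derivative 0) (at x)"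
      by (rule has_field_derivative_transform_within_open[OF DERIV_const[of 0], where S = "{..<0}"])
         (use 1 in \<open>simp_all add: flat_exp_def\<close>)
    with 1 show ?thesis by (simp add: flat_exp_def)
  next
    case 2
    have k: "real k * x ^ (k - 1) = real k * (x ^ k / x)"
      using 2 by (cases k) auto
    have "((\<lambda>x. exp (- 1 / x) / x ^ k) has_real_derivative
        (exp (- 1 / x) * (1 / x\<^sup>2) * x ^ k - exp (- 1 / x) * (real k * x ^ (k - 1))) / (x ^ k * x ^ k)) (at x)"
      using 2 by (auto intro!: derivative_eq_intros simp: power2_eq_square)
    also have "(exp (- 1 / x) * (1 / x\<^sup>2) * x ^ k - exp (- 1 / x) * (real k * x ^ (k - 1))) / (x ^ k * x ^ k)
        = exp (- 1 / x) / (x ^ k * x\<^sup>2) - real k * (exp (- 1 / x) / (x ^ k * x))"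
      unfolding k using 2 by (simp add: diff_divide_distrib power2_eq_square mult_ac)
    also have "\<dots> = flat_exp (k + 2) x - real k * flat_exp (k + 1) x"
      using 2 by (simp add: flat_exp_def power_add mult.commute power2_eq_square)
    finally have "((\<lambda>x. exp (- 1 / x) / x ^ k) has_real_derivative
        flat_exp (k + 2) x - real k * flat_exp (k + 1) x) (at x)" .
    then show ?thesis
      by (rule has_field_derivative_transform_within_open[where S = "{0<..}"])
         (use 2 in \<open>simp_all add: flat_exp_def\<close>)
  qed
qed

lemma C_k_flat_exp: "C_k n (flat_exp k)"
proof (induction n arbitrary: k)
  case 0
  then show ?case
    by (auto simp: C_k_0 intro!: continuous_at_imp_continuous_on DERIV_isCont[OF flat_exp_has_derivative])
next
  case (Suc n)
  have "C_k n (\<lambda>x. flat_exp (k + 2) x + (- real k) * flat_exp (k + 1) x)"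
    by (intro C_k_add C_k_mult C_k_const Suc)
  then show ?case
    by (intro C_k_SucI[OF flat_exp_has_derivative]) simp
qed

definition bump :: "real \<Rightarrow> real" where
  "bump x = flat_exp 0 x * flat_exp 0 (1 - x)"

lemma bump_smooth: "C_infinity bump"
proof -
  have "C_k n (\<lambda>x. flat_exp 0 x * flat_exp 0 ((-1) * x + 1))" for n
    by (intro C_k_mult C_k_affine C_k_flat_exp)
  then show ?thesis
    by (simp add: C_infinity_def bump_def[abs_def])
qed

lemma bump_nonneg: "0 \<le> bump x" and bump_zero: "x \<le> 0 \<or> 1 \<le> x \<Longrightarrow> bump x = 0"
  and bump_pos: "0 < x \<Longrightarrow> x < 1 \<Longrightarrow> 0 < bump x"
  by (auto simp: bump_def flat_exp_def)

lemma bump_continuous: "continuous_on A bump"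
  using C_infinity_continuous[OF bump_smooth, of A 0] by simp

lemma exists_antiderivative:
  fixes f :: "real \<Rightarrow> real"
  assumes "continuous_on UNIV f"
  shows "\<exists>F. (\<forall>x. (F has_real_derivative f x) (at x)) \<and> F 0 = c"
proof -
  let ?F = "\<lambda>x::real. c + (LBINT y=0..x. f y)"
  have "(?F has_real_derivative f x) (at x)" for x
  proof -
    define b where "b = \<bar>x\<bar> + 1"
    have "((\<lambda>u. LBINT y=0..u. f y) has_vector_derivative f x) (at x within {-b..b})"
      using interval_integral_FTC2[of "-b" 0 b f x] continuous_on_subset[OF assms]
      unfolding b_def by (simp flip: zero_ereal_def)
    moreover have "at x within {-b..b} = at x"
      by (rule at_within_interior) (auto simp: b_def)
    ultimately have "((\<lambda>u. LBINT y=0..u. f y) has_real_derivative f x) (at x)"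
      by (simp add: has_real_derivative_iff_has_vector_derivative)
    from DERIV_add[OF DERIV_const[of c] this] show ?thesis by simp
  qed
  then show ?thesis
    by (intro exI[of _ ?F]) (simp flip: zero_ereal_def)
qed

text \<open>
  A normalised antiderivative of \<open>bump\<close>. All smooth test functions and interpolations below are
  built from translates and dilates of this one function.
\<close>

lemma exists_smooth_step:
  obtains \<sigma> :: "real \<Rightarrow> real" where "C_infinity \<sigma>" and "mono \<sigma>"
    and "\<And>x. x \<le> 0 \<Longrightarrow> \<sigma> x = 0" and "\<And>x. 1 \<le> x \<Longrightarrow> \<sigma> x = 1"
proof -
  obtain F :: "real \<Rightarrow> real" where F: "\<And>x. (F has_real_derivative bump x) (at x)" and F0: "F 0 = 0"
    using exists_antiderivative[OF bump_continuous, of 0] by (elim exE conjE) (rule that, erule spec, assumption)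
  have mono: "F x \<le> F y" if "x \<le> y" for x y
    by (rule DERIV_nonneg_imp_nondecreasing[OF that]) (use F bump_nonneg in blast)
  have const: "F x = F y" if "\<And>z. x \<le> z \<Longrightarrow> z \<le> y \<Longrightarrow> bump z = 0" "x \<le> y" for x y
  proof (rule antisym[OF mono[OF that(2)]])
    show "F y \<le> F x"
      by (rule DERIV_nonpos_imp_nonincreasing[OF that(2)]) (use F that(1) in force)
  qed
  have "F 0 < F 1"
  proof (rule DERIV_pos_imp_increasing_open[OF zero_less_one])
    show "\<exists>y. (F has_real_derivative y) (at x) \<and> 0 < y" if "0 < x" "x < 1" for x
      using F bump_pos[OF that] by blast
  qed (use F in \<open>auto intro!: continuous_at_imp_continuous_on DERIV_isCont\<close>)
  then have F1: "0 < F 1" by (simp add: F0)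
  have "C_infinity F"
    by (rule C_infinity_antiderivative[OF F bump_smooth])
  then have smooth: "C_infinity (\<lambda>x. F x / F 1)"
    using C_k_mult[of _ F "\<lambda>_. 1 / F 1"] C_k_const[of _ "1 / F 1"] by (simp add: C_infinity_def)
  show thesis
  proof (rule that[OF smooth])
    show "mono (\<lambda>x. F x / F 1)"
      using mono F1 by (auto simp: mono_def divide_right_mono)
    show "F x / F 1 = 0" if "x \<le> 0" for x
      using const[of x 0] F0 that bump_zero by simp
    show "F x / F 1 = 1" if "1 \<le> x" for x
      using const[of 1 x] F1 that bump_zero by simp
  qed
qed

section \<open>Finite partitions and total variation\<close>

lemma consecutive_subset: "consecutive P \<subseteq> P \<times> P"
  by (auto simp: consecutive_def)

lemma finite_consecutive: "finite P \<Longrightarrow> finite (consecutive P)"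
  by (rule finite_subset[OF consecutive_subset]) auto

lemma consecutive_insert_max:
  assumes "finite A" "A \<noteq> {}" "\<And>a. a \<in> A \<Longrightarrow> a < x"
  shows "consecutive (insert x A) = insert (Max A, x) (consecutive A)" (is "?L = ?R")
proof
  show "?L \<subseteq> ?R"
  proof clarify
    fix a b assume ab: "(a, b) \<in> ?L" "(a, b) \<notin> consecutive A"
    then have "b = x" "a \<in> A"
      using assms(3) by (force simp: consecutive_def)+
    moreover have "\<not> a < Max A"
    proof
      assume "a < Max A"
      with ab assms \<open>b = x\<close> have "Max A \<in> insert x A \<inter> {a<..<b}" by auto
      with ab show False by (auto simp: consecutive_def)
    qed
    ultimately show "a = Max A \<and> b = x"
      using Max_ge[OF assms(1), of a] by auto
  qed
  show "?R \<subseteq> ?L"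
  proof -
    have "(Max A, x) \<in> ?L"
      using assms by (auto simp: consecutive_def dest: Max_ge[OF assms(1)])
    moreover have "(a, b) \<in> ?L" if "(a, b) \<in> consecutive A" for a b
      using that assms(3)[of b] by (auto simp: consecutive_def)
    ultimately show ?thesis by auto
  qed
qed

lemma sum_consecutive_telescope:
  fixes h :: "real \<Rightarrow> real"
  assumes "finite P" "P \<noteq> {}"
  shows "(\<Sum>(a, b)\<in>consecutive P. h b - h a) = h (Max P) - h (Min P)"
  using assms
proof (induction P rule: finite_linorder_max_induct)
  case (insert x A)
  show ?case
  proof (cases "A = {}")
    case True
    moreover have "consecutive {x} = {}" by (auto simp: consecutive_def)
    ultimately show ?thesis by simp
  next
    case False
    have "(Max A, x) \<notin> consecutive A"
      using insert.hyps by (auto simp: consecutive_def)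
    moreover have "Max A < x" using insert.hyps False by simp
    moreover have "Min A \<le> Max A" using insert.hyps False by simp
    ultimately show ?thesis
      using insert False by (simp add: consecutive_insert_max finite_consecutive)
  qed
qed simp

lemma consecutive_split:
  assumes "c \<in> P"
  shows "consecutive P = consecutive (P \<inter> {..c}) \<union> consecutive (P \<inter> {c..})"
    and "consecutive (P \<inter> {..c}) \<inter> consecutive (P \<inter> {c..}) = {}"
proof -
  show "consecutive P = consecutive (P \<inter> {..c}) \<union> consecutive (P \<inter> {c..})"
  proof
    show "consecutive P \<subseteq> consecutive (P \<inter> {..c}) \<union> consecutive (P \<inter> {c..})"
    proof clarify
      fix a b assume ab: "(a, b) \<in> consecutive P" "(a, b) \<notin> consecutive (P \<inter> {c..})"
      with assms have "b \<le> c \<or> c \<le> a"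
        unfolding consecutive_def by force
      with ab show "(a, b) \<in> consecutive (P \<inter> {..c})"
        unfolding consecutive_def by force
    qed
  qed (auto simp: consecutive_def; force)
qed (auto simp: consecutive_def)

definition partition_variation :: "(real \<Rightarrow> real) \<Rightarrow> real set \<Rightarrow> real" where
  "partition_variation g P = (\<Sum>(a, b)\<in>consecutive P. \<bar>g b - g a\<bar>)"

lemma partition_variation_split:
  assumes "finite P" "c \<in> P"
  shows "partition_variation g P =
    partition_variation g (P \<inter> {..c}) + partition_variation g (P \<inter> {c..})"
  unfolding partition_variation_def consecutive_split(1)[OF assms(2)]
  by (rule sum.union_disjoint) (auto simp: finite_consecutive assms consecutive_split(2)[OF assms(2)])

text \<open>
  The increment of \<open>g\<close> over an interval of the coarse partition telescopes over the intervals of the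
  finer one inside it, and nondegenerate intervals inside different members of \<open>consecutive P\<close> are
  different.
\<close>

lemma partition_variation_refine:
  assumes "finite Q" "P \<subseteq> Q"
  shows "partition_variation g P \<le> partition_variation g Q"
proof -
  have finP: "finite P" using assms finite_subset by blast
  define C where "C = (\<lambda>(u, v). consecutive (Q \<inter> {u..v}))"
  have finC: "finite (C i)" for i
    using assms by (cases i) (auto simp: C_def finite_consecutive)
  have "partition_variation g P \<le> (\<Sum>i\<in>consecutive P. \<Sum>(a, b)\<in>C i. \<bar>g b - g a\<bar>)"
    unfolding partition_variation_def
  proof (rule sum_mono, clarify)
    fix u v assume uv: "(u, v) \<in> consecutive P"
    then have uv': "u \<in> Q" "v \<in> Q" "u < v"
      using assms by (auto simp: consecutive_def)
    have "Max (Q \<inter> {u..v}) = v" "Min (Q \<inter> {u..v}) = u"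
      using uv' assms by (auto intro!: Max_eqI Min_eqI)
    then have "g v - g u = (\<Sum>(a, b)\<in>C (u, v). g b - g a)"
      unfolding C_def using sum_consecutive_telescope[of "Q \<inter> {u..v}" g] uv' assms by fastforce
    also have "\<bar>\<dots>\<bar> \<le> (\<Sum>(a, b)\<in>C (u, v). \<bar>g b - g a\<bar>)"
      using sum_abs[of "\<lambda>(a, b). g b - g a"] by (simp add: case_prod_unfold)
    finally show "\<bar>g v - g u\<bar> \<le> (\<Sum>(a, b)\<in>C (u, v). \<bar>g b - g a\<bar>)" .
  qed
  also have "\<dots> = (\<Sum>(a, b)\<in>\<Union>(C ` consecutive P). \<bar>g b - g a\<bar>)"
  proof (rule sum.UNION_disjoint[symmetric])
    show "\<forall>i\<in>consecutive P. \<forall>j\<in>consecutive P. i \<noteq> j \<longrightarrow> C i \<inter> C j = {}"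
    proof (intro ballI impI, rule ccontr)
      fix i j assume ij: "i \<in> consecutive P" "j \<in> consecutive P" "i \<noteq> j" "C i \<inter> C j \<noteq> {}"
      obtain u v u' v' where [simp]: "i = (u, v)" "j = (u', v')" by fastforce
      obtain a b where "u \<le> a" "a < b" "b \<le> v" "u' \<le> a" "b \<le> v'"
        using ij(4) by (auto simp: C_def consecutive_def)
      then have "u < v'" "u' < v" by linarith+
      moreover have "u' \<notin> {u<..<v}" "v' \<notin> {u<..<v}" "u \<notin> {u'<..<v'}" "v \<notin> {u'<..<v'}"
        using ij by (auto simp: consecutive_def)
      moreover have "u < v" "u' < v'" using ij by (auto simp: consecutive_def)
      ultimately show False using ij(3) by auto
    qed
  qed (use finP finC in \<open>auto simp: finite_consecutive\<close>)
  also have "\<dots> \<le> partition_variation g Q"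
    unfolding partition_variation_def
  proof (rule sum_mono2)
    show "\<Union>(C ` consecutive P) \<subseteq> consecutive Q"
      by (auto simp: C_def consecutive_def; force)
  qed (use assms in \<open>auto simp: finite_consecutive\<close>)
  finally show ?thesis .
qed

definition total_variation :: "(real \<Rightarrow> real) \<Rightarrow> real \<Rightarrow> real \<Rightarrow> real" where
  "total_variation g a b = Sup (variation_sums g a b)"

lemma variation_sums_eq:
  "variation_sums g a b = partition_variation g ` {P. finite P \<and> P \<subseteq> {a..b}}"
  by (auto simp: variation_sums_def partition_variation_def)

lemma partition_variation_le:
  assumes "bounded_variation g" "finite P" "P \<subseteq> {a..b}"
  shows "partition_variation g P \<le> total_variation g a b"
  unfolding total_variation_def
  by (rule cSup_upper) (use assms in \<open>auto simp: variation_sums_eq bounded_variation_def\<close>)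

lemma total_variation_le:
  assumes "\<And>P. finite P \<Longrightarrow> P \<subseteq> {a..b} \<Longrightarrow> partition_variation g P \<le> B"
  shows "total_variation g a b \<le> B"
  unfolding total_variation_def
  by (rule cSup_least) (use assms in \<open>auto simp: variation_sums_eq\<close>)

lemma total_variation_add:
  assumes bv: "bounded_variation g" and "a \<le> b" "b \<le> c"
  shows "total_variation g a c = total_variation g a b + total_variation g b c"
proof (rule antisym)
  show "total_variation g a c \<le> total_variation g a b + total_variation g b c"
  proof (rule total_variation_le)
    fix P assume P: "finite P" "P \<subseteq> {a..c}"
    have "partition_variation g P \<le> partition_variation g (insert b P)"
      by (rule partition_variation_refine) (use P in auto)
    also have "\<dots> = partition_variation g (insert b P \<inter> {..b}) + partition_variation g (insert b P \<inter> {b..})"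
      by (rule partition_variation_split) (use P in auto)
    also have "\<dots> \<le> total_variation g a b + total_variation g b c"
      by (intro add_mono partition_variation_le[OF bv]) (use P assms in auto)
    finally show "partition_variation g P \<le> total_variation g a b + total_variation g b c" .
  qed
  have PQ: "partition_variation g P + partition_variation g Q \<le> total_variation g a c"
    if P: "finite P" "P \<subseteq> {a..b}" and Q: "finite Q" "Q \<subseteq> {b..c}" for P Q
  proof -
    let ?R = "insert b (P \<union> Q)"
    have "partition_variation g P + partition_variation g Q
        \<le> partition_variation g (?R \<inter> {..b}) + partition_variation g (?R \<inter> {b..})"
      by (intro add_mono partition_variation_refine) (use P Q in auto)
    also have "\<dots> = partition_variation g ?R"
      by (rule partition_variation_split[symmetric]) (use P Q in auto)
    also have "\<dots> \<le> total_variation g a c"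
      by (rule partition_variation_le[OF bv]) (use P Q assms in auto)
    finally show ?thesis .
  qed
  have "total_variation g b c \<le> total_variation g a c - partition_variation g P"
    if "finite P" "P \<subseteq> {a..b}" for P
  proof (rule total_variation_le)
    fix Q assume "finite Q" "Q \<subseteq> {b..c}"
    with that show "partition_variation g Q \<le> total_variation g a c - partition_variation g P"
      using PQ[of P Q] by simp
  qed
  then have "total_variation g a b \<le> total_variation g a c - total_variation g b c"
    by (intro total_variation_le) (simp add: algebra_simps)
  then show "total_variation g a b + total_variation g b c \<le> total_variation g a c" by simp
qed

lemma abs_diff_le_total_variation:
  assumes "bounded_variation g" "a \<le> b"
  shows "\<bar>g b - g a\<bar> \<le> total_variation g a b"
proof (cases "a < b")
  case True
  then have "consecutive {a, b} = {(a, b)}" by (auto simp: consecutive_def)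
  then have "partition_variation g {a, b} = \<bar>g b - g a\<bar>"
    by (simp add: partition_variation_def)
  with partition_variation_le[OF assms(1), of "{a, b}" a b] assms(2) show ?thesis by simp
next
  case False
  with assms partition_variation_le[OF assms(1), of "{}" a b] show ?thesis
    by (simp add: partition_variation_def consecutive_def)
qed

lemma signed_variation_diff:
  assumes bv: "bounded_variation g" and "a \<le> b"
  shows "signed_variation g b - signed_variation g a = total_variation g a b"
proof -
  have V: "signed_variation g x = (if 0 \<le> x then total_variation g 0 x else - total_variation g x 0)" for x
    by (simp add: signed_variation_def total_variation_def)
  consider "0 \<le> a" | "a < 0" "0 \<le> b" | "b < 0" by linarith
  then show ?thesis
  proof cases
    case 1
    with assms total_variation_add[OF bv, of 0 a b] show ?thesis by (simp add: V)
  next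
    case 2
    with assms total_variation_add[OF bv, of a 0 b] show ?thesis by (simp add: V)
  next
    case 3
    with assms total_variation_add[OF bv, of a b 0] show ?thesis by (simp add: V)
  qed
qed

lemma mono_signed_variation:
  assumes "bounded_variation g"
  shows "mono (signed_variation g)" and "mono (\<lambda>x. signed_variation g x - g x)"
proof -
  have "\<bar>g y - g x\<bar> \<le> signed_variation g y - signed_variation g x" if "x \<le> y" for x y
    using signed_variation_diff[OF assms that] abs_diff_le_total_variation[OF assms that] by simp
  then show "mono (signed_variation g)" "mono (\<lambda>x. signed_variation g x - g x)"
    by (force intro!: monoI)+
qed

text \<open>
  Almost all of the variation on \<open>[x, x + 1]\<close> is attained on a finite partition. A point \<open>y\<close> inserted
  directly after \<open>x\<close> splits off a single increment, which is small by right continuity of \<open>g\<close>. The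
  rest of the partition lies in \<open>[y, x + 1]\<close>, so hardly any variation is left for \<open>[x, y]\<close>.
\<close>

lemma right_continuous_signed_variation:
  assumes bv: "bounded_variation g" and rc: "right_continuous g"
  shows "continuous (at_right x) (signed_variation g)"
proof -
  let ?V = "signed_variation g"
  have "\<exists>y>x. ?V y - ?V x < \<epsilon>" if "\<epsilon> > 0" for \<epsilon>
  proof -
    have "total_variation g x (x + 1) - \<epsilon> / 2 < Sup (variation_sums g x (x + 1))"
      using that by (simp add: total_variation_def)
    moreover have "variation_sums g x (x + 1) \<noteq> {}"
      by (auto simp: variation_sums_eq)
    ultimately obtain P where P: "finite P" "P \<subseteq> {x..x + 1}"
      and P_large: "total_variation g x (x + 1) - \<epsilon> / 2 < partition_variation g P"
      using less_cSupD[of "variation_sums g x (x + 1)"] unfolding variation_sums_eq by blast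
    have "(g \<longlongrightarrow> g x) (at_right x)"
      using rc by (simp add: right_continuous_def continuous_within)
    then have "eventually (\<lambda>y. \<bar>g y - g x\<bar> < \<epsilon> / 2) (at_right x)"
      using tendstoD[of g "g x" _ "\<epsilon> / 2"] that by (simp add: dist_real_def)
    then obtain d where d: "d > x" "\<And>y. x < y \<Longrightarrow> y < d \<Longrightarrow> \<bar>g y - g x\<bar> < \<epsilon> / 2"
      by (auto simp: eventually_at_right_field)
    \<comment> \<open>A point of the interval that lies below \<open>d\<close> and below every other partition point.\<close>
    define y where "y = Min (insert ((x + d) / 2) (insert (x + 1) (P - {x})))"
    have "y \<in> insert ((x + d) / 2) (insert (x + 1) (P - {x}))"
      unfolding y_def by (rule Min_in) (use P in auto)
    then have "x < y" using d P by auto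
    have y_min: "y \<le> z" if "z \<in> insert ((x + d) / 2) (insert (x + 1) (P - {x}))" for z
      unfolding y_def by (rule Min_le) (use P that in auto)
    have y_le: "y \<le> (x + d) / 2" "y \<le> x + 1" "\<And>z. z \<in> P \<Longrightarrow> z \<noteq> x \<Longrightarrow> y \<le> z"
      by (rule y_min; simp)+
    then have "y < d" using y_le(1) d(1) by (simp add: field_simps)
    let ?Q = "insert x (insert y P)"
    have "partition_variation g P \<le> partition_variation g ?Q"
      by (rule partition_variation_refine) (use P in auto)
    also have "\<dots> = partition_variation g (?Q \<inter> {..y}) + partition_variation g (?Q \<inter> {y..})"
      by (rule partition_variation_split) (use P in auto)
    also have "?Q \<inter> {..y} = {x, y}"
      using y_le \<open>x < y\<close> by (auto intro: antisym)
    also have "partition_variation g {x, y} = \<bar>g y - g x\<bar>"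
    proof -
      have "consecutive {x, y} = {(x, y)}" using \<open>x < y\<close> by (auto simp: consecutive_def)
      then show ?thesis by (simp add: partition_variation_def)
    qed
    also have "\<bar>g y - g x\<bar> + partition_variation g (?Q \<inter> {y..}) < \<epsilon> / 2 + total_variation g y (x + 1)"
      by (intro add_less_le_mono d(2) partition_variation_le[OF bv])
         (use \<open>x < y\<close> \<open>y < d\<close> P y_le in auto)
    finally have "total_variation g x y < \<epsilon>"
      using P_large total_variation_add[OF bv, of x y "x + 1"] \<open>x < y\<close> y_le by simp
    then show ?thesis
      using \<open>x < y\<close> signed_variation_diff[OF bv, of x y] by (intro exI[of _ y]) simp
  qed
  note close = this
  have "(?V \<longlongrightarrow> ?V x) (at_right x)"
  proof (rule tendstoI)
    fix \<epsilon> :: real assume "\<epsilon> > 0"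
    then obtain y where y: "y > x" "?V y - ?V x < \<epsilon>"
      using close by blast
    have "dist (?V z) (?V x) < \<epsilon>" if "x < z" "z < y" for z
      using monoD[OF mono_signed_variation(1)[OF bv], of x z]
        monoD[OF mono_signed_variation(1)[OF bv], of z y] that y by (simp add: dist_real_def)
    then show "eventually (\<lambda>z. dist (?V z) (?V x) < \<epsilon>) (at_right x)"
      unfolding eventually_at_right_field using y by blast
  qed
  then show ?thesis by (simp add: continuous_within)
qed

section \<open>The compensated sums of a smooth function\<close>

lemma LIMSEQ_by_approximation:
  fixes x :: "nat \<Rightarrow> real"
  assumes "\<And>\<epsilon>. \<epsilon> > 0 \<Longrightarrow> \<exists>x' y'. x' \<longlonglongrightarrow> y' \<and> \<bar>y - y'\<bar> \<le> \<epsilon> \<and> (\<forall>\<^sub>F n in sequentially. \<bar>x n - x' n\<bar> \<le> \<epsilon>)"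
  shows "x \<longlonglongrightarrow> y"
proof (rule tendstoI)
  fix \<epsilon> :: real assume "\<epsilon> > 0"
  then obtain x' y' where *: "x' \<longlonglongrightarrow> y'" "\<bar>y - y'\<bar> \<le> \<epsilon> / 4"
    "\<forall>\<^sub>F n in sequentially. \<bar>x n - x' n\<bar> \<le> \<epsilon> / 4"
    using assms[of "\<epsilon> / 4"] by auto
  have "\<forall>\<^sub>F n in sequentially. dist (x' n) y' < \<epsilon> / 4"
    using *(1) \<open>\<epsilon> > 0\<close> by (intro tendstoD) auto
  with *(3) show "\<forall>\<^sub>F n in sequentially. dist (x n) y < \<epsilon>"
    by eventually_elim (use *(2) in \<open>unfold dist_real_def, linarith\<close>)
qed

lemma continuous_bounded_Icc:
  fixes f :: "real \<Rightarrow> real"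
  assumes "continuous_on {a..b} f"
  obtains B where "B > 0" "\<And>x. x \<in> {a..b} \<Longrightarrow> \<bar>f x\<bar> \<le> B"
proof -
  have "bounded (f ` {a..b})"
    by (rule compact_imp_bounded[OF compact_continuous_image[OF assms compact_Icc]])
  then show thesis using that by (auto simp: bounded_pos)
qed

text \<open>
  The intervals that start at or before \<open>t\<close> partition \<open>[0, \<beta>]\<close>, so increments summed over them
  telescope to \<open>\<beta>\<close>. As \<open>t\<close> and \<open>\<beta>\<close> coincide or share a partition interval, the oscillation bounds the distance
  between the values of the path there, even if \<open>\<beta> - t\<close> does not tend to \<open>0\<close>.
\<close>

lemma consecutive_up_to:
  assumes P: "finite P" "0 \<in> P" "T \<in> P" "P \<subseteq> {0..T}" and t: "t \<in> {0..T}"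
  obtains \<beta> where "\<beta> \<in> P" "{(a, b) \<in> consecutive P. a \<le> t} = consecutive (P \<inter> {..\<beta>})"
    and "\<beta> = t \<or> (\<exists>\<alpha>. (\<alpha>, \<beta>) \<in> consecutive P \<and> \<alpha> \<le> t \<and> t \<le> \<beta>)"
proof (cases "t = T")
  case True
  have "{(a, b) \<in> consecutive P. a \<le> t} = consecutive P"
    using True P by (auto simp: consecutive_def)
  moreover have "P \<inter> {..T} = P" using P by auto
  ultimately show thesis using that[of T] P True by simp
next
  case False
  define \<beta> where "\<beta> = Min (P \<inter> {t<..})"
  define \<alpha> where "\<alpha> = Max (P \<inter> {..t})"
  have ne: "P \<inter> {t<..} \<noteq> {}" "P \<inter> {..t} \<noteq> {}"
    using False t P by (auto intro!: exI[of _ T] exI[of _ 0])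
  have \<beta>: "\<beta> \<in> P" "t < \<beta>" using Min_in[OF _ ne(1)] P by (auto simp: \<beta>_def)
  have \<alpha>: "\<alpha> \<in> P" "\<alpha> \<le> t" using Max_in[OF _ ne(2)] P by (auto simp: \<alpha>_def)
  have \<beta>_le: "\<beta> \<le> x" if "x \<in> P" "t < x" for x
    unfolding \<beta>_def using P that by (auto intro!: Min_le)
  have \<alpha>_ge: "x \<le> \<alpha>" if "x \<in> P" "x \<le> t" for x
    unfolding \<alpha>_def using P that by (auto intro!: Max_ge)
  have "(\<alpha>, \<beta>) \<in> consecutive P"
    using \<alpha> \<beta> \<alpha>_ge \<beta>_le by (fastforce simp: consecutive_def)
  moreover have "{(a, b) \<in> consecutive P. a \<le> t} = consecutive (P \<inter> {..\<beta>})"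
  proof (intro set_eqI, clarify)
    fix a b
    show "(a, b) \<in> {(a, b) \<in> consecutive P. a \<le> t} \<longleftrightarrow> (a, b) \<in> consecutive (P \<inter> {..\<beta>})"
    proof
      assume "(a, b) \<in> {(a, b) \<in> consecutive P. a \<le> t}"
      then have ab: "a \<in> P" "b \<in> P" "a < b" "P \<inter> {a<..<b} = {}" "a \<le> t"
        by (auto simp: consecutive_def)
      have "b \<le> \<beta>"
      proof (rule ccontr)
        assume "\<not> b \<le> \<beta>"
        then have "\<beta> \<in> P \<inter> {a<..<b}" using \<beta> ab by auto
        with ab show False by auto
      qed
      with ab show "(a, b) \<in> consecutive (P \<inter> {..\<beta>})" by (auto simp: consecutive_def)
    next
      assume "(a, b) \<in> consecutive (P \<inter> {..\<beta>})"
      then have ab: "a \<in> P" "b \<in> P" "a < b" "b \<le> \<beta>" "P \<inter> {..\<beta>} \<inter> {a<..<b} = {}"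
        by (auto simp: consecutive_def)
      then have "a \<le> t" using \<beta>_le[of a] by linarith
      moreover have "P \<inter> {a<..<b} = P \<inter> {..\<beta>} \<inter> {a<..<b}" using ab by auto
      ultimately show "(a, b) \<in> {(a, b) \<in> consecutive P. a \<le> t}"
        using ab by (simp add: consecutive_def)
    qed
  qed
  ultimately show thesis using that[OF \<beta>(1)] \<alpha> \<beta> by auto
qed

lemma abs_diff_le_osc:
  assumes "finite P" "(a, b) \<in> consecutive P" "continuous_on {a..b} S" "r \<in> {a..b}" "s \<in> {a..b}"
  shows "\<bar>S s - S r\<bar> \<le> osc S P"
proof -
  obtain B where B: "\<And>x. x \<in> {a..b} \<Longrightarrow> \<bar>S x\<bar> \<le> B"
    using continuous_bounded_Icc[OF assms(3)] by metis
  have "bdd_above ((\<lambda>(r, s). \<bar>S s - S r\<bar>) ` ({a..b} \<times> {a..b}))"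
  proof (rule bdd_aboveI2[of _ _ "2 * B"], clarify)
    fix r s assume "r \<in> {a..b}" "s \<in> {a..b}"
    with B[of r] B[of s] show "\<bar>S s - S r\<bar> \<le> 2 * B" by linarith
  qed
  then have "(\<lambda>(r, s). \<bar>S s - S r\<bar>) (r, s) \<le> (SUP (r, s)\<in>{a..b} \<times> {a..b}. \<bar>S s - S r\<bar>)"
    by (intro cSUP_upper) (use assms in auto)
  then have "\<bar>S s - S r\<bar> \<le> (SUP (r, s)\<in>{a..b} \<times> {a..b}. \<bar>S s - S r\<bar>)" by simp
  also have "\<dots> = (\<lambda>(a, b). SUP (r, s)\<in>{a..b} \<times> {a..b}. \<bar>S s - S r\<bar>) (a, b)" by simp
  also have "\<dots> \<le> osc S P"
    unfolding osc_def by (intro Max_ge imageI finite_imageI finite_consecutive assms)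
  finally show ?thesis .
qed

text \<open>
  Vague convergence allows only continuous test functions, so the indicator of \<open>[0, t]\<close> is replaced
  by a continuous cutoff. The error is at most the integral of a tent at \<open>t\<close>, which is small for
  narrow tents because the limit measure has no atom at \<open>t\<close>.
\<close>

lemma variation_sums_up_to_converge:
  assumes \<mu>: "is_variation_measure p \<pi> T S \<mu>" and t: "t \<in> {0..T}"
    and \<phi>: "continuous_on {0..T} \<phi>" and \<pi>: "nested_partitions T \<pi>"
  shows "(\<lambda>n. \<Sum>(a, b)\<in>{(a, b) \<in> consecutive (\<pi> n). a \<le> t}. \<bar>S b - S a\<bar> ^ p * \<phi> a)
    \<longlonglongrightarrow> (LINT u:{0..t}|\<mu>. \<phi> u)"
proof (rule LIMSEQ_by_approximation)
  fix \<epsilon> :: real assume "\<epsilon> > 0"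
  define W where "W n \<phi> = (\<Sum>(a, b)\<in>consecutive (\<pi> n). \<bar>S b - S a\<bar> ^ p * \<phi> a)" for n and \<phi> :: "real \<Rightarrow> real"
  have sets: "sets \<mu> = sets (restrict_space borel {0..T})"
    and null: "emeasure \<mu> {t} = 0"
    and int: "\<And>\<phi> :: real \<Rightarrow> real. continuous_on {0..T} \<phi> \<Longrightarrow> integrable \<mu> \<phi>"
    and lim: "\<And>\<phi>. continuous_on {0..T} \<phi> \<Longrightarrow> (\<lambda>n. W n \<phi>) \<longlonglongrightarrow> (LINT u|\<mu>. \<phi> u)"
    using \<mu> t unfolding is_variation_measure_def W_def by blast+
  have space: "space \<mu> = {0..T}"
    using sets_eq_imp_space_eq[OF sets] by (simp add: space_restrict_space)
  have sets_\<mu>: "A \<in> sets \<mu>" if "A \<in> sets borel" "A \<subseteq> {0..T}" for A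
    using that unfolding sets sets_restrict_space by (metis image_eqI inf.absorb_iff2)
  have \<pi>_sub: "a \<in> {0..T}" if "(a, b) \<in> consecutive (\<pi> n)" for a b n
    using that \<pi> unfolding nested_partitions_def consecutive_def by blast
  have fin: "finite (consecutive (\<pi> n))" for n
    using \<pi> by (auto simp: nested_partitions_def intro: finite_consecutive)
  obtain B where B: "B > 0" "\<And>x. x \<in> {0..T} \<Longrightarrow> \<bar>\<phi> x\<bar> \<le> B"
    using continuous_bounded_Icc[OF \<phi>] by metis
  define \<psi> where "\<psi> j u = max 0 (1 - real j * \<bar>u - t\<bar>)" for j u
  define cut where "cut j u = max 0 (min 1 (1 - real j * (u - t)))" for j u
  have cont: "continuous_on {0..T} (\<psi> j)" "continuous_on {0..T} (cut j)" for j
    unfolding \<psi>_def cut_def by (intro continuous_intros)+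
  have tent: "\<bar>indicator {..t} u - cut j u\<bar> \<le> \<psi> j u" for j u
  proof (cases "u \<le> t")
    case True
    then have "real j * (u - t) \<le> 0" by (intro mult_nonneg_nonpos) auto
    with True show ?thesis by (simp add: \<psi>_def cut_def)
  next
    case False
    then have "0 \<le> real j * (u - t)" by simp
    with False show ?thesis by (simp add: \<psi>_def cut_def)
  qed
  have "(\<lambda>j. LINT u|\<mu>. \<psi> j u) \<longlonglongrightarrow> (LINT u|\<mu>. indicator {t} u)"
  proof (rule integral_dominated_convergence[where w = "\<lambda>_. 1"])
    show "indicator {t} \<in> borel_measurable \<mu>"
      using t by (intro borel_measurable_indicator sets_\<mu>) auto
    show "\<psi> j \<in> borel_measurable \<mu>" for j
      using int[OF cont(1)] by auto
    show "integrable \<mu> (\<lambda>_. 1::real)" by (rule int) simp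
    show "AE x in \<mu>. norm (\<psi> j x) \<le> 1" for j
      by (auto simp: \<psi>_def)
    show "AE x in \<mu>. (\<lambda>j. \<psi> j x) \<longlonglongrightarrow> indicator {t} x"
    proof (rule AE_I2)
      fix x
      show "(\<lambda>j. \<psi> j x) \<longlonglongrightarrow> indicator {t} x"
      proof (cases "x = t")
        case False
        obtain N where N: "1 / \<bar>x - t\<bar> < real N" using reals_Archimedean2 by blast
        have "\<psi> j x = 0" if "j \<ge> N" for j
        proof -
          have "1 / \<bar>x - t\<bar> \<le> real j" using N that by linarith
          then have "1 \<le> real j * \<bar>x - t\<bar>" using False by (simp add: field_simps)
          then show ?thesis by (simp add: \<psi>_def)
        qed
        then have "\<forall>\<^sub>F j in sequentially. \<psi> j x = 0" by (auto simp: eventually_sequentially)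
        with False show ?thesis by (simp add: tendsto_eventually)
      qed (simp add: \<psi>_def)
    qed
  qed
  also have "(LINT u|\<mu>. indicator {t} u) = (0::real)"
    using null t by (simp add: measure_def space)
  finally have "\<forall>\<^sub>F j in sequentially. (LINT u|\<mu>. \<psi> j u) < \<epsilon> / (2 * B)"
    using B(1) \<open>\<epsilon> > 0\<close> by (intro order_tendstoD) auto
  then obtain j where j: "(LINT u|\<mu>. \<psi> j u) < \<epsilon> / (2 * B)"
    by (auto simp: eventually_sequentially)
  have "(\<lambda>n. W n (\<lambda>u. \<phi> u * cut j u)) \<longlonglongrightarrow> (LINT u|\<mu>. \<phi> u * cut j u)"
    by (intro lim continuous_on_mult \<phi> cont)
  moreover have "\<bar>(LINT u:{0..t}|\<mu>. \<phi> u) - (LINT u|\<mu>. \<phi> u * cut j u)\<bar> \<le> \<epsilon>"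
  proof -
    have i0: "{0..t} \<in> sets \<mu>" using t by (intro sets_\<mu>) auto
    have i1: "integrable \<mu> (\<lambda>u. indicator {0..t} u * \<phi> u)"
      using integrable_mult_indicator[OF i0 int[OF \<phi>]] by simp
    have i2: "integrable \<mu> (\<lambda>u. \<phi> u * cut j u)"
      by (intro int continuous_on_mult \<phi> cont)
    have "(LINT u:{0..t}|\<mu>. \<phi> u) - (LINT u|\<mu>. \<phi> u * cut j u)
        = (LINT u|\<mu>. indicator {0..t} u * \<phi> u - \<phi> u * cut j u)"
      using i1 i2 by (simp add: set_lebesgue_integral_def)
    also have "\<bar>\<dots>\<bar> \<le> (LINT u|\<mu>. B * \<psi> j u)"
    proof (rule order_trans[OF integral_abs_bound], rule integral_mono)
      fix u assume "u \<in> space \<mu>"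
      then have u: "u \<in> {0..T}" by (simp add: space)
      then have "indicator {0..t} u * \<phi> u - \<phi> u * cut j u = \<phi> u * (indicator {..t} u - cut j u)"
        by (auto simp: indicator_def algebra_simps)
      then show "\<bar>indicator {0..t} u * \<phi> u - \<phi> u * cut j u\<bar> \<le> B * \<psi> j u"
        using B(2)[OF u] tent[of u j] B(1) by (simp add: abs_mult mult_mono)
    qed (use i1 i2 int[OF cont(1)] in auto)
    also have "\<dots> \<le> \<epsilon>"
      using j B(1) \<open>\<epsilon> > 0\<close> by (simp add: field_simps)
    finally show ?thesis .
  qed
  moreover have "\<forall>\<^sub>F n in sequentially.
      \<bar>(\<Sum>(a, b)\<in>{(a, b) \<in> consecutive (\<pi> n). a \<le> t}. \<bar>S b - S a\<bar> ^ p * \<phi> a) - W n (\<lambda>u. \<phi> u * cut j u)\<bar> \<le> \<epsilon>"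
  proof -
    have "\<forall>\<^sub>F n in sequentially. W n (\<psi> j) < \<epsilon> / B"
      by (rule order_tendstoD(2)[OF lim[OF cont(1)]])
         (use j B(1) \<open>\<epsilon> > 0\<close> in \<open>simp add: field_simps\<close>)
    then show ?thesis
    proof eventually_elim
      case (elim n)
      have "(\<Sum>(a, b)\<in>{(a, b) \<in> consecutive (\<pi> n). a \<le> t}. \<bar>S b - S a\<bar> ^ p * \<phi> a)
          = (\<Sum>(a, b)\<in>consecutive (\<pi> n). \<bar>S b - S a\<bar> ^ p * (\<phi> a * indicator {..t} a))"
        by (rule sum.mono_neutral_cong_left) (use fin in \<open>auto simp: indicator_def split: if_splits\<close>)
      then have "(\<Sum>(a, b)\<in>{(a, b) \<in> consecutive (\<pi> n). a \<le> t}. \<bar>S b - S a\<bar> ^ p * \<phi> a) - W n (\<lambda>u. \<phi> u * cut j u)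
          = (\<Sum>(a, b)\<in>consecutive (\<pi> n). \<bar>S b - S a\<bar> ^ p * (\<phi> a * (indicator {..t} a - cut j a)))"
        unfolding W_def by (simp add: sum_subtractf[symmetric] case_prod_unfold algebra_simps)
      also have "\<bar>\<dots>\<bar> \<le> (\<Sum>(a, b)\<in>consecutive (\<pi> n). B * (\<bar>S b - S a\<bar> ^ p * \<psi> j a))"
      proof (rule order_trans[OF sum_abs], rule sum_mono, clarify)
        fix a b assume "(a, b) \<in> consecutive (\<pi> n)"
        from B(2)[OF \<pi>_sub[OF this]] tent[of a j] B(1)
        have "\<bar>\<phi> a * (indicator {..t} a - cut j a)\<bar> \<le> B * \<psi> j a"
          by (simp add: abs_mult mult_mono)
        then have "\<bar>S b - S a\<bar> ^ p * \<bar>\<phi> a * (indicator {..t} a - cut j a)\<bar> \<le> \<bar>S b - S a\<bar> ^ p * (B * \<psi> j a)"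
          by (intro mult_left_mono) auto
        then show "\<bar>\<bar>S b - S a\<bar> ^ p * (\<phi> a * (indicator {..t} a - cut j a))\<bar> \<le> B * (\<bar>S b - S a\<bar> ^ p * \<psi> j a)"
          by (simp add: abs_mult mult_ac)
      qed
      also have "\<dots> = B * W n (\<psi> j)"
        by (simp add: W_def sum_distrib_left case_prod_unfold)
      also have "\<dots> \<le> \<epsilon>" using elim B(1) by (simp add: field_simps)
      finally show ?case .
    qed
  qed
  ultimately show "\<exists>x' y'. x' \<longlonglongrightarrow> y' \<and> \<bar>(LINT u:{0..t}|\<mu>. \<phi> u) - y'\<bar> \<le> \<epsilon> \<and>
      (\<forall>\<^sub>F n in sequentially. \<bar>(\<Sum>(a, b)\<in>{(a, b) \<in> consecutive (\<pi> n). a \<le> t}. \<bar>S b - S a\<bar> ^ p * \<phi> a) - x' n\<bar> \<le> \<epsilon>)"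
    by blast
qed

text \<open>
  Taylor's formula with Lagrange remainder on each partition interval. The remainder is at most
  the modulus of continuity of the derivative of order \<open>p\<close>, evaluated at the oscillation, times the
  total mass of the discrete measures, which converges.
\<close>

lemma foellmer_sum_limit:
  assumes T: "T > 0" and \<pi>: "nested_partitions T \<pi>" and p: "even p" "p > 0"
    and S: "continuous_on {0..T} S" and osc: "(\<lambda>n. osc S (\<pi> n)) \<longlonglongrightarrow> 0"
    and \<mu>: "is_variation_measure p \<pi> T S \<mu>" and t: "t \<in> {0..T}" and F: "C_infinity F"
  shows "(\<lambda>n. foellmer_sum p \<pi> S F t n)
    \<longlonglongrightarrow> F (S t) - F (S 0) - (LINT u:{0..t}|\<mu>. (deriv ^^ p) F (S u)) / fact p"
proof -
  define D where "D k = (deriv ^^ k) F" for k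
  define A where "A n = {(a, b) \<in> consecutive (\<pi> n). a \<le> t}" for n
  define W where "W n = (\<Sum>(a, b)\<in>A n. \<bar>S b - S a\<bar> ^ p * D p (S a))" for n
  define R where "R n = (\<Sum>(a, b)\<in>A n. F (S b) - F (S a) -
    (\<Sum>k = 1..p - 1. D k (S a) / fact k * (S b - S a) ^ k) - D p (S a) / fact p * \<bar>S b - S a\<bar> ^ p)" for n
  have P: "finite (\<pi> n)" "0 \<in> \<pi> n" "T \<in> \<pi> n" "\<pi> n \<subseteq> {0..T}" for n
    using \<pi> by (auto simp: nested_partitions_def)
  have A_sub: "{a..b} \<subseteq> {0..T}" "a < b" "a \<in> {0..T}" "b \<in> {0..T}" if "(a, b) \<in> consecutive (\<pi> n)" for a b n
    using that P(4)[of n] by (auto simp: consecutive_def)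
  have A_osc: "\<bar>S s - S r\<bar> \<le> osc S (\<pi> n)"
    if "(a, b) \<in> consecutive (\<pi> n)" "r \<in> {a..b}" "s \<in> {a..b}" for a b n r s
    by (rule abs_diff_le_osc[OF P(1) that(1) _ that(2,3)])
       (rule continuous_on_subset[OF S A_sub(1)[OF that(1)]])
  have D_cont: "continuous_on X (D k)" for X k
    unfolding D_def by (rule C_infinity_continuous[OF F])
  have tele: "(\<lambda>n. \<Sum>(a, b)\<in>A n. F (S b) - F (S a)) \<longlonglongrightarrow> F (S t) - F (S 0)"
  proof -
    have "\<exists>\<beta>. \<bar>S \<beta> - S t\<bar> \<le> \<bar>osc S (\<pi> n)\<bar> \<and> (\<Sum>(a, b)\<in>A n. F (S b) - F (S a)) = F (S \<beta>) - F (S 0)" for n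
    proof -
      obtain \<beta> where \<beta>: "\<beta> \<in> \<pi> n" "A n = consecutive (\<pi> n \<inter> {..\<beta>})"
        and near: "\<beta> = t \<or> (\<exists>\<alpha>. (\<alpha>, \<beta>) \<in> consecutive (\<pi> n) \<and> \<alpha> \<le> t \<and> t \<le> \<beta>)"
        using consecutive_up_to[OF P t, of n thesis] unfolding A_def by blast
      have "Max (\<pi> n \<inter> {..\<beta>}) = \<beta>" "Min (\<pi> n \<inter> {..\<beta>}) = 0"
        using P[of n] \<beta>(1) by (auto intro!: Max_eqI Min_eqI)
      then have "(\<Sum>(a, b)\<in>A n. F (S b) - F (S a)) = F (S \<beta>) - F (S 0)"
        using sum_consecutive_telescope[of "\<pi> n \<inter> {..\<beta>}" "\<lambda>u. F (S u)"] P(1)[of n] \<beta> by auto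
      moreover have "\<bar>S \<beta> - S t\<bar> \<le> \<bar>osc S (\<pi> n)\<bar>"
        using near A_osc[of _ \<beta> n t \<beta>] by fastforce
      ultimately show ?thesis by blast
    qed
    then obtain \<beta> where \<beta>: "\<And>n. \<bar>S (\<beta> n) - S t\<bar> \<le> \<bar>osc S (\<pi> n)\<bar>"
      "\<And>n. (\<Sum>(a, b)\<in>A n. F (S b) - F (S a)) = F (S (\<beta> n)) - F (S 0)"
      by metis
    have "(\<lambda>n. S (\<beta> n) - S t) \<longlonglongrightarrow> 0"
      using \<beta>(1) osc by (intro Lim_null_comparison[OF _ tendsto_rabs_zero[OF osc]]) auto
    then have "(\<lambda>n. S (\<beta> n)) \<longlonglongrightarrow> S t" by (simp add: LIM_zero_iff)
    moreover have "isCont F (S t)"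
      using DERIV_isCont[OF C_infinity_has_derivative[OF F, of 0]] by simp
    ultimately have "(\<lambda>n. F (S (\<beta> n))) \<longlonglongrightarrow> F (S t)" by (metis isCont_tendsto_compose)
    then show ?thesis unfolding \<beta>(2) by (intro tendsto_diff) auto
  qed
  have W_lim: "W \<longlonglongrightarrow> (LINT u:{0..t}|\<mu>. D p (S u))"
    unfolding W_def[abs_def] A_def
    by (rule variation_sums_up_to_converge[OF \<mu> t _ \<pi>]) (rule continuous_on_compose2[OF D_cont S subset_UNIV])
  have R_lim: "R \<longlonglongrightarrow> 0"
  proof (rule LIMSEQ_by_approximation)
    fix \<epsilon> :: real assume "\<epsilon> > 0"
    define K where "K n = (\<Sum>(a, b)\<in>consecutive (\<pi> n). \<bar>S b - S a\<bar> ^ p)" for n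
    have "(\<lambda>n. \<Sum>(a, b)\<in>consecutive (\<pi> n). \<bar>S b - S a\<bar> ^ p * 1) \<longlonglongrightarrow> (LINT u|\<mu>. 1)"
    proof -
      have "\<forall>\<phi>. continuous_on {0..T} \<phi> \<longrightarrow>
          (\<lambda>n. \<Sum>(a, b)\<in>consecutive (\<pi> n). \<bar>S b - S a\<bar> ^ p * \<phi> a) \<longlonglongrightarrow> (LINT u|\<mu>. \<phi> u)"
        using \<mu> unfolding is_variation_measure_def by blast
      from spec[OF this, of "\<lambda>_. 1"] show ?thesis by simp
    qed
    then have "K \<longlonglongrightarrow> (LINT u|\<mu>. 1)" by (simp add: K_def[abs_def])
    then obtain B where B: "B > 0" "\<And>n. \<bar>K n\<bar> \<le> B"
      using convergent_imp_Bseq[of K] by (auto simp: convergent_def Bseq_def)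
    obtain M where M: "\<And>u. u \<in> {0..T} \<Longrightarrow> \<bar>S u\<bar> \<le> M"
      using continuous_bounded_Icc[OF S] by metis
    have "uniformly_continuous_on {-M..M} (D p)"
      by (rule compact_uniformly_continuous[OF D_cont]) simp
    then obtain d where d: "d > 0"
      "\<And>x y. x \<in> {-M..M} \<Longrightarrow> y \<in> {-M..M} \<Longrightarrow> \<bar>y - x\<bar> < d \<Longrightarrow> \<bar>D p y - D p x\<bar> < \<epsilon> / B"
      using uniformly_continuous_onE[of "{-M..M}" "D p" "\<epsilon> / B"] \<open>\<epsilon> > 0\<close> B(1)
      unfolding dist_real_def by auto
    have "\<forall>\<^sub>F n in sequentially. osc S (\<pi> n) < d"
      using osc d(1) by (rule order_tendstoD)
    then have "\<forall>\<^sub>F n in sequentially. \<bar>R n - 0\<bar> \<le> \<epsilon>"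
    proof eventually_elim
      case (elim n)
      have "\<bar>R n\<bar> \<le> (\<Sum>(a, b)\<in>A n. \<epsilon> / B * \<bar>S b - S a\<bar> ^ p)"
        unfolding R_def
      proof (rule order_trans[OF sum_abs], rule sum_mono, clarify)
        fix a b assume "(a, b) \<in> A n"
        then have ab: "(a, b) \<in> consecutive (\<pi> n)" by (simp add: A_def)
        let ?x = "S a" and ?y = "S b"
        show "\<bar>F ?y - F ?x - (\<Sum>k = 1..p - 1. D k ?x / fact k * (?y - ?x) ^ k) - D p ?x / fact p * \<bar>?y - ?x\<bar> ^ p\<bar>
          \<le> \<epsilon> / B * \<bar>?y - ?x\<bar> ^ p"
        proof (cases "?y = ?x")
          case True
          then show ?thesis using p by (simp add: zero_power)
        next
          case False
          obtain z where z: "if ?y < ?x then ?y < z \<and> z < ?x else ?x < z \<and> z < ?y"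
            and taylor: "F ?y = (\<Sum>k<p. D k ?x / fact k * (?y - ?x) ^ k) + D p z / fact p * (?y - ?x) ^ p"
            using Taylor[of p D F "min ?x ?y" "max ?x ?y" ?x ?y] False p
              C_infinity_has_derivative[OF F] unfolding D_def by auto
          have "{..<p} = insert 0 {1..p - 1}" using p by auto
          then have sum: "(\<Sum>k<p. D k ?x / fact k * (?y - ?x) ^ k)
              = F ?x + (\<Sum>k = 1..p - 1. D k ?x / fact k * (?y - ?x) ^ k)"
            by (simp add: D_def)
          have even: "(?y - ?x) ^ p = \<bar>?y - ?x\<bar> ^ p" using p(1) by (simp add: power_even_abs)
          have "\<bar>D p z - D p ?x\<bar> \<le> \<epsilon> / B"
          proof (rule less_imp_le, rule d(2))
            show "?x \<in> {-M..M}" "z \<in> {-M..M}"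
              using M[OF A_sub(3)[OF ab]] M[OF A_sub(4)[OF ab]] z by (auto split: if_splits)
            have "\<bar>?y - ?x\<bar> < d" using A_osc[OF ab, of a b] A_sub(2)[OF ab] elim by simp
            then show "\<bar>z - ?x\<bar> < d" using z by (auto split: if_splits)
          qed
          moreover have "1 \<le> (fact p :: real)" by (rule fact_ge_1)
          ultimately have *: "\<bar>D p z - D p ?x\<bar> / fact p \<le> \<epsilon> / B"
            using frac_le[of "\<epsilon> / B" "\<bar>D p z - D p ?x\<bar>" 1 "fact p"] by simp
          then have "\<bar>(D p z - D p ?x) / fact p * \<bar>?y - ?x\<bar> ^ p\<bar> \<le> \<epsilon> / B * \<bar>?y - ?x\<bar> ^ p"
            using mult_right_mono[OF *, of "\<bar>?y - ?x\<bar> ^ p"] by (simp add: abs_mult)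
          moreover have "F ?y - F ?x - (\<Sum>k = 1..p - 1. D k ?x / fact k * (?y - ?x) ^ k) - D p ?x / fact p * \<bar>?y - ?x\<bar> ^ p
              = (D p z - D p ?x) / fact p * \<bar>?y - ?x\<bar> ^ p"
            unfolding taylor sum even by (simp add: diff_divide_distrib algebra_simps)
          ultimately show ?thesis by simp
        qed
      qed
      also have "\<dots> \<le> (\<Sum>(a, b)\<in>consecutive (\<pi> n). \<epsilon> / B * \<bar>S b - S a\<bar> ^ p)"
        by (rule sum_mono2) (use P(1)[of n] B(1) \<open>\<epsilon> > 0\<close> in \<open>auto simp: A_def finite_consecutive\<close>)
      also have "\<dots> = \<epsilon> / B * K n" by (simp add: K_def sum_distrib_left case_prod_unfold)
      also have "\<dots> \<le> \<epsilon> / B * B"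
        using B(2)[of n] B(1) \<open>\<epsilon> > 0\<close> by (intro mult_left_mono) auto
      finally show ?case using B(1) by simp
    qed
    then show "\<exists>x' y'. x' \<longlonglongrightarrow> y' \<and> \<bar>0 - y'\<bar> \<le> \<epsilon> \<and> (\<forall>\<^sub>F n in sequentially. \<bar>R n - x' n\<bar> \<le> \<epsilon>)"
      using \<open>\<epsilon> > 0\<close> by (intro exI[of _ "\<lambda>_. 0"] exI[of _ 0]) auto
  qed
  have "foellmer_sum p \<pi> S F t n = (\<Sum>(a, b)\<in>A n. F (S b) - F (S a)) - R n - W n / fact p" for n
    unfolding foellmer_sum_def R_def W_def A_def[symmetric] D_def[symmetric]
    by (simp add: case_prod_unfold sum_subtractf sum_divide_distrib mult.commute)
  then have eq: "(\<lambda>n. foellmer_sum p \<pi> S F t n) = (\<lambda>n. (\<Sum>(a, b)\<in>A n. F (S b) - F (S a)) - R n - W n / fact p)"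
    by auto
  have "(\<lambda>n. foellmer_sum p \<pi> S F t n)
    \<longlonglongrightarrow> F (S t) - F (S 0) - 0 - (LINT u:{0..t}|\<mu>. D p (S u)) / fact p"
    unfolding eq by (intro tendsto_diff tendsto_divide tele R_lim W_lim tendsto_const) auto
  then show ?thesis by (simp add: D_def)
qed

text \<open>
  The occupation formula for sets says that the measure with Lebesgue density \<open>q l\<close> is the image
  under \<open>S\<close> of \<open>\<mu>\<close> restricted to \<open>[0, t]\<close>; so the two measures have the same integrals.
\<close>

lemma occupation_integral:
  fixes l h S :: "real \<Rightarrow> real" and T t :: real
  assumes sets: "sets \<mu> = sets (restrict_space borel {0..T})" and fin: "finite_measure \<mu>"
    and S: "continuous_on {0..T} S" and t: "t \<in> {0..T}"
    and l: "integrable lborel l" "\<And>x. 0 \<le> l x" and h: "h \<in> borel_measurable borel"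
    and occ: "\<And>A. A \<in> sets borel \<Longrightarrow>
      q * (LINT x:A|lborel. l x) = (LINT u:{0..t}|\<mu>. indicator A (S u))" and "0 \<le> q"
  shows "q * (LINT x|lborel. l x * h x) = (LINT u:{0..t}|\<mu>. h (S u))"
proof -
  interpret finite_measure \<mu> by (rule fin)
  have [measurable]: "l \<in> borel_measurable borel" using l(1) by auto
  note [measurable] = h
  have [measurable]: "S \<in> borel_measurable \<mu>"
    using borel_measurable_continuous_on_restrict[OF S] by (simp cong: measurable_cong_sets add: measurable_cong_sets[OF sets refl])
  have "{0..t} = {0..T} \<inter> {0..t}" using t by (simp add: min_def)
  then have [measurable]: "{0..t} \<in> sets \<mu>"
    unfolding sets sets_restrict_space by (rule image_eqI) simp
  define M1 where "M1 = density lborel (\<lambda>x. q * l x)"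
  define M2 where "M2 = distr (density \<mu> (\<lambda>u. indicator {0..t} u :: real)) borel S"
  have "M1 = M2"
  proof (rule measure_eqI)
    show "sets M1 = sets M2" by (simp add: M1_def M2_def)
    fix A assume "A \<in> sets M1"
    then have A[measurable]: "A \<in> sets borel" by (simp add: M1_def)
    have "integrable lborel (\<lambda>x. q * l x * indicator A x)"
      by (rule integrable_real_mult_indicator) (use l in auto)
    then have "emeasure M1 A = ennreal (LINT x|lborel. q * l x * indicator A x)"
      unfolding M1_def using l(2) \<open>0 \<le> q\<close>
      by (subst emeasure_density) (auto simp: nn_integral_eq_integral[symmetric] ennreal_mult' simp flip: ennreal_indicator)
    also have "(LINT x|lborel. q * l x * indicator A x) = q * (LINT x:A|lborel. l x)"
      unfolding set_lebesgue_integral_def by (subst integral_mult_right_zero[symmetric]) (simp add: mult_ac)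
    also have "\<dots> = (LINT u|\<mu>. indicator {0..t} u * indicator A (S u))"
      unfolding occ[OF A] by (simp add: set_lebesgue_integral_def)
    also have "ennreal \<dots> = (\<integral>\<^sup>+u. ennreal (indicator {0..t} u * indicator A (S u)) \<partial>\<mu>)"
    proof (rule nn_integral_eq_integral[symmetric])
      show "integrable \<mu> (\<lambda>u. indicator {0..t} u * indicator A (S u) :: real)"
      proof (rule integrable_const_bound[where B = 1])
        show "(\<lambda>u. indicator {0..t} u * indicator A (S u) :: real) \<in> borel_measurable \<mu>"
          by measurable
      qed (simp add: indicator_def)
    qed simp
    also have "\<dots> = (\<integral>\<^sup>+u. ennreal (indicator {0..t} u) * indicator (S -` A \<inter> space \<mu>) u \<partial>\<mu>)"
      by (rule nn_integral_cong) (auto simp: indicator_def)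
    also have "\<dots> = emeasure (density \<mu> (\<lambda>u. indicator {0..t} u :: real)) (S -` A \<inter> space \<mu>)"
      by (rule emeasure_density[symmetric]) measurable
    also have "\<dots> = emeasure M2 A"
      unfolding M2_def by (subst emeasure_distr) auto
    finally show "emeasure M1 A = emeasure M2 A" .
  qed
  have "q * (LINT x|lborel. l x * h x) = (LINT x|lborel. q * l x * h x)"
    by (subst integral_mult_right_zero[symmetric]) (simp add: mult_ac)
  also have "\<dots> = (LINT x|M1. h x)"
    unfolding M1_def by (subst integral_density) (use l(2) \<open>0 \<le> q\<close> in auto)
  also have "\<dots> = (LINT u|density \<mu> (\<lambda>u. indicator {0..t} u :: real). h (S u))"
    unfolding \<open>M1 = M2\<close> M2_def by (subst integral_distr) auto
  also have "\<dots> = (LINT u:{0..t}|\<mu>. h (S u))"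
    unfolding set_lebesgue_integral_def by (subst integral_density) auto
  finally show ?thesis .
qed

section \<open>Local bounds and convergence of derivatives\<close>

lemma higher_deriv_increment:
  assumes "C_infinity F"
  shows "(deriv ^^ k) (\<lambda>x. F (x + h) - F x) = (\<lambda>x. (deriv ^^ k) F (x + h) - (deriv ^^ k) F x)"
proof (induction k)
  case (Suc k)
  have "((\<lambda>x. (deriv ^^ k) F (x + h) - (deriv ^^ k) F x) has_real_derivative
      (deriv ^^ Suc k) F (x + h) - (deriv ^^ Suc k) F x) (at x)" for x
    using C_infinity_has_derivative[OF assms, of k "x + h"]
    by (intro DERIV_diff C_infinity_has_derivative[OF assms]) (simp add: DERIV_shift)
  then have "deriv (\<lambda>x. (deriv ^^ k) F (x + h) - (deriv ^^ k) F x) x =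
      (deriv ^^ Suc k) F (x + h) - (deriv ^^ Suc k) F x" for x
    by (rule DERIV_imp_deriv)
  then show ?case
    using Suc by auto
qed simp

lemma higher_deriv_mean_value:
  assumes "C_infinity F" "x < y"
  obtains z where "x < z" "z < y" "(deriv ^^ k) F y - (deriv ^^ k) F x = (y - x) * (deriv ^^ Suc k) F z"
  using MVT2[OF assms(2), of "(deriv ^^ k) F" "(deriv ^^ Suc k) F"] C_infinity_has_derivative[OF assms(1)]
  by blast

text \<open>
  A function with bounded oscillation is bounded as soon as it is bounded at one point. For the
  derivative of order \<open>k + 1\<close> such a point is supplied by the mean value theorem applied to
  the increment \<open>G i\<close> of \<open>F i\<close> over a fixed step \<open>h\<close>: its derivative of order \<open>k\<close> is \<open>h\<close> times an
  intermediate value. The functions \<open>G i\<close> satisfy the hypotheses of order \<open>k\<close> on half the interval.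
  A bound of order \<open>k + 1\<close> in turn bounds the oscillation of order \<open>k\<close>.
\<close>

lemma derivatives_uniformly_bounded:
  fixes F :: "'i \<Rightarrow> real \<Rightarrow> real"
  assumes "\<And>i. C_infinity (F i)" and "a < b"
    and "\<And>x. x \<in> {a..b} \<Longrightarrow> \<exists>B. \<forall>i. \<bar>F i x\<bar> \<le> B"
    and "\<And>i x y. x \<in> {a..b} \<Longrightarrow> y \<in> {a..b} \<Longrightarrow> \<bar>(deriv ^^ k) (F i) x - (deriv ^^ k) (F i) y\<bar> \<le> C"
  shows "\<exists>B. \<forall>j\<le>k. \<forall>i. \<forall>x\<in>{a..b}. \<bar>(deriv ^^ j) (F i) x\<bar> \<le> B"
  using assms
proof (induction k arbitrary: F b C)
  case 0
  obtain B where B: "\<And>i. \<bar>F i a\<bar> \<le> B" using 0(3)[of a] 0(2) by auto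
  have "\<bar>F i x\<bar> \<le> B + C" if "x \<in> {a..b}" for i x
    using 0(4)[of x a i] B[of i] that 0(2) by simp
  then show ?case by (intro exI[of _ "B + C"]) simp
next
  case (Suc k)
  note smooth = Suc.prems(1) and ab = Suc.prems(2) and osc = Suc.prems(4)
  define h where "h = (b - a) / 2"
  have h: "h > 0" "a + h + h = b" using ab by (auto simp: h_def field_simps)
  define G where "G i x = F i (x + h) - F i x" for i x
  have G_deriv: "(deriv ^^ k) (G i) x = (deriv ^^ k) (F i) (x + h) - (deriv ^^ k) (F i) x" for i x
    unfolding G_def using higher_deriv_increment[OF smooth] by (rule fun_cong)
  have G_mean: "\<exists>z\<in>{a..b}. (deriv ^^ k) (G i) x = h * (deriv ^^ Suc k) (F i) z" if "x \<in> {a..a + h}" for i x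
  proof -
    obtain z where "x < z" "z < x + h" "(deriv ^^ k) (F i) (x + h) - (deriv ^^ k) (F i) x = (x + h - x) * (deriv ^^ Suc k) (F i) z"
      using higher_deriv_mean_value[OF smooth, of x "x + h" k i] h by auto
    moreover have "z \<in> {a..b}" using that h \<open>x < z\<close> \<open>z < x + h\<close> by simp
    ultimately show ?thesis unfolding G_deriv by (intro bexI[of _ z]) simp_all
  qed
  have "\<exists>B. \<forall>j\<le>k. \<forall>i. \<forall>x\<in>{a..a + h}. \<bar>(deriv ^^ j) (G i) x\<bar> \<le> B"
  proof (rule Suc.IH)
    show "C_infinity (G i)" for i
      unfolding G_def using C_infinity_diff[OF C_infinity_affine[OF smooth, of i 1 h] smooth] by (simp add: add.commute)
    show "a < a + h" using h by simp
    show "\<exists>B. \<forall>i. \<bar>G i x\<bar> \<le> B" if "x \<in> {a..a + h}" for x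
    proof -
      obtain B1 where "\<forall>i. \<bar>F i x\<bar> \<le> B1" using Suc.prems(3)[of x] \<open>x \<in> _\<close> h by auto
      moreover obtain B2 where "\<forall>i. \<bar>F i (x + h)\<bar> \<le> B2"
        using Suc.prems(3)[of "x + h"] \<open>x \<in> _\<close> by (auto simp: h_def field_simps)
      ultimately have "\<forall>i. \<bar>G i x\<bar> \<le> B1 + B2" unfolding G_def by (metis abs_triangle_ineq4 add_mono order_trans add.commute)
      then show ?thesis ..
    qed
    show "\<bar>(deriv ^^ k) (G i) x - (deriv ^^ k) (G i) y\<bar> \<le> h * C"
      if "x \<in> {a..a + h}" "y \<in> {a..a + h}" for i x y
    proof -
      obtain z w where zw: "z \<in> {a..b}" "w \<in> {a..b}" "(deriv ^^ k) (G i) x = h * (deriv ^^ Suc k) (F i) z"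
        "(deriv ^^ k) (G i) y = h * (deriv ^^ Suc k) (F i) w"
        using G_mean[OF \<open>x \<in> _\<close>] G_mean[OF \<open>y \<in> _\<close>] by metis
      then have "\<bar>(deriv ^^ k) (G i) x - (deriv ^^ k) (G i) y\<bar> = h * \<bar>(deriv ^^ Suc k) (F i) z - (deriv ^^ Suc k) (F i) w\<bar>"
        using h by (simp add: abs_mult flip: right_diff_distrib)
      also have "\<dots> \<le> h * C" using osc[OF zw(1,2)] h by (intro mult_left_mono) auto
      finally show ?thesis .
    qed
  qed
  then obtain B where B: "\<And>i. \<bar>(deriv ^^ k) (G i) a\<bar> \<le> B" using h by force
  define K where "K = B / h + C"
  have K: "\<bar>(deriv ^^ Suc k) (F i) x\<bar> \<le> K" if "x \<in> {a..b}" for i x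
  proof -
    obtain z where z: "z \<in> {a..b}" "(deriv ^^ k) (G i) a = h * (deriv ^^ Suc k) (F i) z"
      using G_mean[of a i] h by auto
    then have "\<bar>(deriv ^^ Suc k) (F i) z\<bar> \<le> B / h"
      using B[of i] h by (simp add: abs_mult field_simps)
    with osc[OF that z(1), of i] show ?thesis unfolding K_def by linarith
  qed
  have lip: "\<bar>(deriv ^^ k) (F i) x - (deriv ^^ k) (F i) y\<bar> \<le> (b - a) * K"
    if "x \<in> {a..b}" "y \<in> {a..b}" "x < y" for i x y
  proof -
    obtain z where z: "x < z" "z < y" "(deriv ^^ k) (F i) y - (deriv ^^ k) (F i) x = (y - x) * (deriv ^^ Suc k) (F i) z"
      using higher_deriv_mean_value[OF smooth \<open>x < y\<close>] by metis
    have "\<bar>(deriv ^^ k) (F i) x - (deriv ^^ k) (F i) y\<bar> = (y - x) * \<bar>(deriv ^^ Suc k) (F i) z\<bar>"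
      using z(3) \<open>x < y\<close> by (subst abs_minus_commute) (simp add: abs_mult)
    also have "\<dots> \<le> (b - a) * K"
      using that z K[of z i] by (intro mult_mono) auto
    finally show ?thesis .
  qed
  have "0 \<le> K" using K[of a undefined] ab by (meson abs_ge_zero atLeastAtMost_iff order_trans less_imp_le order_refl)
  have "\<exists>B. \<forall>j\<le>k. \<forall>i. \<forall>x\<in>{a..b}. \<bar>(deriv ^^ j) (F i) x\<bar> \<le> B"
  proof (rule Suc.IH[OF smooth ab Suc.prems(3)])
    show "\<bar>(deriv ^^ k) (F i) x - (deriv ^^ k) (F i) y\<bar> \<le> (b - a) * K"
      if "x \<in> {a..b}" "y \<in> {a..b}" for i x y
    proof (cases x y rule: linorder_cases)
      case equal
      then show ?thesis using \<open>0 \<le> K\<close> ab by simp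
    qed (use lip[of x y i] lip[of y x i] that in \<open>auto simp: abs_minus_commute\<close>)
  qed auto
  then obtain B' where B': "\<And>j i x. j \<le> k \<Longrightarrow> x \<in> {a..b} \<Longrightarrow> \<bar>(deriv ^^ j) (F i) x\<bar> \<le> B'" by blast
  have "\<bar>(deriv ^^ j) (F i) x\<bar> \<le> max B' K" if "j \<le> Suc k" "x \<in> {a..b}" for j i x
  proof (cases "j = Suc k")
    case True
    with K[OF that(2), of i] show ?thesis by simp
  next
    case False
    with B'[OF _ that(2), of j i] that(1) show ?thesis by simp
  qed
  then show ?case by blast
qed

text \<open>
  The bound on the second derivatives makes the difference quotients with step \<open>h\<close> differ from the
  derivatives by at most \<open>h B\<close>, uniformly in \<open>i\<close>, so limits in \<open>i\<close> and in \<open>h\<close> may be exchanged.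
\<close>

lemma deriv_LIMSEQ:
  fixes G G' G'' :: "nat \<Rightarrow> real \<Rightarrow> real"
  assumes lim: "\<And>x. (\<lambda>i. G i x) \<longlonglongrightarrow> g x"
    and G: "\<And>i x. (G i has_real_derivative G' i x) (at x)"
    and G': "\<And>i x. (G' i has_real_derivative G'' i x) (at x)"
    and bnd: "\<And>i y. y \<in> {x..x + 1} \<Longrightarrow> \<bar>G'' i y\<bar> \<le> B"
    and g: "(g has_real_derivative d) (at x)"
  shows "(\<lambda>i. G' i x) \<longlonglongrightarrow> d"
proof (rule LIMSEQ_by_approximation)
  fix \<epsilon> :: real assume "\<epsilon> > 0"
  have B: "0 \<le> B" using bnd[of x 0] by simp
  have "((\<lambda>h. (g (x + h) - g x) / h) \<longlongrightarrow> d) (at 0)"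
    using g by (simp add: DERIV_def)
  then have "\<forall>\<^sub>F h in at 0. dist ((g (x + h) - g x) / h) d < \<epsilon>"
    using \<open>\<epsilon> > 0\<close> by (rule tendstoD)
  then obtain \<delta> where \<delta>: "\<delta> > 0" "\<And>h. h \<noteq> 0 \<Longrightarrow> \<bar>h\<bar> < \<delta> \<Longrightarrow> \<bar>(g (x + h) - g x) / h - d\<bar> < \<epsilon>"
    by (auto simp: eventually_at dist_real_def)
  define h where "h = min (min (\<delta> / 2) 1) (\<epsilon> / (B + 1))"
  have h: "0 < h" "h < \<delta>" "h \<le> 1" "h \<le> \<epsilon> / (B + 1)"
    using \<delta>(1) \<open>\<epsilon> > 0\<close> B unfolding h_def by (simp_all add: min_less_iff_disj)
  then have "h * (B + 1) \<le> \<epsilon>" using B by (simp add: field_simps)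
  then have hB: "h * B \<le> \<epsilon>" using h(1) by (simp add: algebra_simps)
  have near: "\<bar>G' i x - (G i (x + h) - G i x) / h\<bar> \<le> \<epsilon>" for i
  proof -
    obtain z where z: "x < z" "z < x + h" "G i (x + h) - G i x = h * G' i z"
      using MVT2[of x "x + h" "G i" "G' i"] G h(1) by auto
    obtain w where w: "x < w" "w < z" "G' i z - G' i x = (z - x) * G'' i w"
      using MVT2[of x z "G' i" "G'' i"] G' z(1) by auto
    have "\<bar>G' i x - G' i z\<bar> = (z - x) * \<bar>G'' i w\<bar>"
      using w(3) z(1) by (subst abs_minus_commute) (simp add: abs_mult)
    also have "\<dots> \<le> h * B"
      using z w h bnd[of w i] by (intro mult_mono) auto
    finally show ?thesis using z(3) h(1) hB by simp
  qed
  have "(\<lambda>i. (G i (x + h) - G i x) / h) \<longlonglongrightarrow> (g (x + h) - g x) / h"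
    using h(1) by (intro tendsto_divide tendsto_diff lim tendsto_const) auto
  moreover have "\<bar>d - (g (x + h) - g x) / h\<bar> \<le> \<epsilon>"
    using \<delta>(2)[of h] h by (simp add: abs_minus_commute)
  ultimately show "\<exists>x' y'. x' \<longlonglongrightarrow> y' \<and> \<bar>d - y'\<bar> \<le> \<epsilon> \<and> (\<forall>\<^sub>F i in sequentially. \<bar>G' i x - x' i\<bar> \<le> \<epsilon>)"
    using near by (intro exI[of _ "\<lambda>i. (G i (x + h) - G i x) / h"] exI[of _ "(g (x + h) - g x) / h"]) auto
qed

lemma derivatives_converge:
  assumes F: "\<And>i. C_infinity (F i)" and lim: "\<And>x. (\<lambda>i. F i x) \<longlonglongrightarrow> f x" and f: "C_k q f"
    and bnd: "\<And>a b. a < b \<Longrightarrow> \<exists>B. \<forall>j\<le>Suc q. \<forall>i. \<forall>x\<in>{a..b}. \<bar>(deriv ^^ j) (F i) x\<bar> \<le> B"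
  shows "j \<le> q \<Longrightarrow> (\<lambda>i. (deriv ^^ j) (F i) x) \<longlonglongrightarrow> (deriv ^^ j) f x"
proof (induction j arbitrary: x)
  case 0
  then show ?case using lim by simp
next
  case (Suc j)
  obtain B where B: "\<forall>j\<le>Suc q. \<forall>i. \<forall>y\<in>{x..x + 1}. \<bar>(deriv ^^ j) (F i) y\<bar> \<le> B"
    using bnd[of x "x + 1"] by auto
  show ?case
  proof (rule deriv_LIMSEQ)
    show "(\<lambda>i. (deriv ^^ j) (F i) y) \<longlonglongrightarrow> (deriv ^^ j) f y" for y
      using Suc by simp
    show "\<bar>(deriv ^^ Suc (Suc j)) (F i) y\<bar> \<le> B" if "y \<in> {x..x + 1}" for i y
      using B Suc.prems that by blast
    have "(deriv ^^ j) f differentiable (at x)"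
      using f Suc.prems by (simp add: C_k_def)
    then show "((deriv ^^ j) f has_real_derivative (deriv ^^ Suc j) f x) (at x)"
      by (simp add: DERIV_deriv_iff_real_differentiable)
  qed (rule C_infinity_has_derivative[OF F])+
qed

section \<open>Weak convergence and weak derivatives\<close>

lemma abs_integral_le:
  fixes f :: "real \<Rightarrow> real"
  assumes "f integrable_on {a..b}" "\<And>x. x \<in> {a..b} \<Longrightarrow> \<bar>f x\<bar> \<le> B" "a \<le> b"
  shows "\<bar>integral {a..b} f\<bar> \<le> B * (b - a)"
proof -
  have "0 \<le> B" using assms(2)[of a] assms(3) by simp
  from has_integral_bound_real[OF this finite.emptyI integrable_integral[OF assms(1)]] assms show ?thesis by simp
qed

text \<open>
  The estimate \<open>\<bar>integral {u..v} (\<lambda>x. \<psi> x * E i x)\<bar> \<le> \<epsilon> * (v - u)\<close> for almost all \<open>i\<close> passes from adjacent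
  intervals to their union. By bisection it is enough to have it on short intervals around each
  point, where \<open>\<psi>\<close> is nearly constant.
\<close>

lemma weak_convergence_of_integrals:
  fixes E :: "nat \<Rightarrow> real \<Rightarrow> real"
  assumes "a \<le> b" and \<psi>: "continuous_on {a..b} \<psi>"
    and E: "\<And>i. E i integrable_on {a..b}" and \<psi>E: "\<And>i. (\<lambda>x. \<psi> x * E i x) integrable_on {a..b}"
    and bnd: "\<And>i x. x \<in> {a..b} \<Longrightarrow> \<bar>E i x\<bar> \<le> B"
    and lim: "\<And>u v. a \<le> u \<Longrightarrow> u \<le> v \<Longrightarrow> v \<le> b \<Longrightarrow> (\<lambda>i. integral {u..v} (E i)) \<longlonglongrightarrow> 0"
  shows "(\<lambda>i. integral {a..b} (\<lambda>x. \<psi> x * E i x)) \<longlonglongrightarrow> 0"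
proof -
  have B: "0 \<le> B" using bnd[of a 0] \<open>a \<le> b\<close> by simp
  have sub: "E i integrable_on {u..v}" "(\<lambda>x. \<psi> x * E i x) integrable_on {u..v}"
    if "a \<le> u" "v \<le> b" for i u v
    using integrable_on_subinterval[OF E, of u v i] integrable_on_subinterval[OF \<psi>E, of u v i] that by auto
  have main: "\<forall>\<^sub>F i in sequentially. \<bar>integral {a..b} (\<lambda>x. \<psi> x * E i x)\<bar> \<le> \<epsilon> * (b - a)" if "\<epsilon> > 0" for \<epsilon>
  proof -
    define P where "P u v \<longleftrightarrow> (a \<le> u \<and> u \<le> v \<and> v \<le> b \<longrightarrow>
      (\<forall>\<^sub>F i in sequentially. \<bar>integral {u..v} (\<lambda>x. \<psi> x * E i x)\<bar> \<le> \<epsilon> * (v - u)))" for u v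
    from \<open>a \<le> b\<close> have "P a b"
    proof (induction rule: Bolzano)
      case (trans u v w)
      show ?case unfolding P_def
      proof
        assume uw: "a \<le> u \<and> u \<le> w \<and> w \<le> b"
        have "\<forall>\<^sub>F i in sequentially. \<bar>integral {u..v} (\<lambda>x. \<psi> x * E i x)\<bar> \<le> \<epsilon> * (v - u)"
          "\<forall>\<^sub>F i in sequentially. \<bar>integral {v..w} (\<lambda>x. \<psi> x * E i x)\<bar> \<le> \<epsilon> * (w - v)"
          using trans uw unfolding P_def by auto
        then show "\<forall>\<^sub>F i in sequentially. \<bar>integral {u..w} (\<lambda>x. \<psi> x * E i x)\<bar> \<le> \<epsilon> * (w - u)"
        proof eventually_elim
          case (elim i)
          have "integral {u..w} (\<lambda>x. \<psi> x * E i x) = integral {u..v} (\<lambda>x. \<psi> x * E i x) + integral {v..w} (\<lambda>x. \<psi> x * E i x)"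
            using Henstock_Kurzweil_Integration.integral_combine[OF _ _ sub(2), of u v w i] trans uw by simp
          moreover have "\<epsilon> * (w - u) = \<epsilon> * (v - u) + \<epsilon> * (w - v)" by (simp add: algebra_simps)
          ultimately show ?case using elim by linarith
        qed
      qed
    next
      case (local x)
      have "\<epsilon> / (2 * (B + 1)) > 0" using that B by simp
      then obtain d where d: "d > 0" "\<And>y. y \<in> {a..b} \<Longrightarrow> \<bar>y - x\<bar> < d \<Longrightarrow> \<bar>\<psi> y - \<psi> x\<bar> < \<epsilon> / (2 * (B + 1))"
        using \<psi> local unfolding continuous_on_iff dist_real_def by (metis atLeastAtMost_iff)
      have "P u v" if uv: "u \<le> x" "x \<le> v" "v - u < d" for u v
        unfolding P_def
      proof
        assume ab: "a \<le> u \<and> u \<le> v \<and> v \<le> b"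
        show "\<forall>\<^sub>F i in sequentially. \<bar>integral {u..v} (\<lambda>x. \<psi> x * E i x)\<bar> \<le> \<epsilon> * (v - u)"
        proof (cases "u = v")
          case False
          have "(\<lambda>i. \<psi> x * integral {u..v} (E i)) \<longlonglongrightarrow> \<psi> x * 0"
            by (intro tendsto_mult tendsto_const lim) (use ab in auto)
          then have "\<forall>\<^sub>F i in sequentially. dist (\<psi> x * integral {u..v} (E i)) (\<psi> x * 0) < \<epsilon> * (v - u) / 2"
            by (rule tendstoD) (use False ab \<open>\<epsilon> > 0\<close> in auto)
          then show ?thesis
          proof eventually_elim
            case (elim i)
            have eq: "integral {u..v} (\<lambda>y. \<psi> y * E i y) = integral {u..v} (\<lambda>y. \<psi> y * E i y - \<psi> x * E i y) + \<psi> x * integral {u..v} (E i)"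
              using sub[of u v i] ab by (subst Henstock_Kurzweil_Integration.integral_diff) (auto intro: integrable_on_mult_right)
            have "\<bar>integral {u..v} (\<lambda>y. \<psi> y * E i y - \<psi> x * E i y)\<bar> \<le> \<epsilon> / 2 * (v - u)"
            proof (rule abs_integral_le)
              show "(\<lambda>y. \<psi> y * E i y - \<psi> x * E i y) integrable_on {u..v}"
                using sub[of u v i] ab by (intro Henstock_Kurzweil_Integration.integrable_diff integrable_on_mult_right) auto
              show "\<bar>\<psi> y * E i y - \<psi> x * E i y\<bar> \<le> \<epsilon> / 2" if "y \<in> {u..v}" for y
              proof -
                have "\<bar>\<psi> y - \<psi> x\<bar> * \<bar>E i y\<bar> \<le> \<epsilon> / (2 * (B + 1)) * B"
                  using less_imp_le[OF d(2)[of y]] bnd[of y i] that uv ab B \<open>\<epsilon> > 0\<close> by (intro mult_mono) auto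
                also have "\<dots> \<le> \<epsilon> / 2" using B \<open>\<epsilon> > 0\<close> by (simp add: field_simps)
                finally show ?thesis by (simp add: abs_mult flip: left_diff_distrib)
              qed
            qed (use ab in auto)
            with elim show ?case unfolding eq dist_real_def by (simp add: field_simps) 
          qed
        qed simp
      qed
      with d(1) show ?case by auto
    qed
    then show ?thesis using \<open>a \<le> b\<close> by (simp add: P_def)
  qed
  show ?thesis
  proof (rule LIMSEQ_by_approximation)
    fix \<epsilon> :: real assume "\<epsilon> > 0"
    then have "\<forall>\<^sub>F i in sequentially. \<bar>integral {a..b} (\<lambda>x. \<psi> x * E i x)\<bar> \<le> \<epsilon> / (b - a + 1) * (b - a)"
      using \<open>a \<le> b\<close> by (intro main) auto
    moreover have "\<epsilon> / (b - a + 1) * (b - a) \<le> \<epsilon>" using \<open>a \<le> b\<close> \<open>\<epsilon> > 0\<close> by (simp add: field_simps)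
    ultimately have "\<forall>\<^sub>F i in sequentially. \<bar>integral {a..b} (\<lambda>x. \<psi> x * E i x) - 0\<bar> \<le> \<epsilon>"
      by (auto elim: eventually_mono)
    then show "\<exists>x' y'. x' \<longlonglongrightarrow> y' \<and> \<bar>0 - y'\<bar> \<le> \<epsilon> \<and>
        (\<forall>\<^sub>F i in sequentially. \<bar>integral {a..b} (\<lambda>x. \<psi> x * E i x) - x' i\<bar> \<le> \<epsilon>)"
      using \<open>\<epsilon> > 0\<close> by (intro exI[of _ "\<lambda>_. 0"] exI[of _ 0]) auto
  qed
qed

lemma has_integral_derivative:
  fixes F F' :: "real \<Rightarrow> real"
  assumes "\<And>x. (F has_real_derivative F' x) (at x)" "a \<le> b"
  shows "(F' has_integral (F b - F a)) {a..b}"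
  by (rule fundamental_theorem_of_calculus[OF assms(2)])
     (use assms(1) has_vector_derivative_at_within has_real_derivative_iff_has_vector_derivative in blast)

text \<open>
  The derivative of a monotone step from \<open>0\<close> to \<open>1\<close> on \<open>[c, c + \<delta>]\<close> is a probability density there.
\<close>

lemma smooth_step_samples_value:
  fixes s u H :: "real \<Rightarrow> real"
  assumes s: "\<And>x. (s has_real_derivative u x) (at x)" and u: "continuous_on UNIV u" and "mono s"
    and "\<delta> > 0" and s0: "\<And>x. x \<le> c \<Longrightarrow> s x = 0" and s1: "\<And>x. c + \<delta> \<le> x \<Longrightarrow> s x = 1"
    and H: "continuous_on UNIV H" and near: "\<And>x. x \<in> {c..c + \<delta>} \<Longrightarrow> \<bar>H x - H c\<bar> \<le> \<epsilon>"
  shows "integrable lborel (\<lambda>x. H x * u x)" and "\<bar>(LINT x|lborel. H x * u x) - H c\<bar> \<le> \<epsilon>"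
proof -
  have u_nonneg: "0 \<le> u x" for x
    using mono_on_imp_deriv_nonneg[of UNIV s "u x" x] s \<open>mono s\<close> by (simp add: mono_on_def mono_def)
  have u_zero: "u x = 0" if "x \<notin> {c..c + \<delta>}" for x
  proof -
    have "(s has_real_derivative 0) (at x)"
    proof (cases "x < c")
      case True
      show ?thesis
        by (rule has_field_derivative_transform_within_open[OF DERIV_const[of 0], where S = "{..<c}"])
           (use True s0 in auto)
    next
      case False
      show ?thesis
        by (rule has_field_derivative_transform_within_open[OF DERIV_const[of 1], where S = "{c + \<delta><..}"])
           (use False that s1 in auto)
    qed
    then show ?thesis using s DERIV_unique by blast
  qed
  have Hu: "set_integrable lborel {c..c + \<delta>} (\<lambda>x. H x * u x)"
    by (intro borel_integrable_atLeastAtMost' continuous_on_mult continuous_on_subset[OF H] continuous_on_subset[OF u]) auto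
  have eq: "(\<lambda>x. H x * u x) = (\<lambda>x. indicator {c..c + \<delta>} x *\<^sub>R (H x * u x))"
  proof
    show "H x * u x = indicator {c..c + \<delta>} x *\<^sub>R (H x * u x)" for x
      by (cases "x \<in> {c..c + \<delta>}") (simp_all add: u_zero)
  qed
  show "integrable lborel (\<lambda>x. H x * u x)"
    using Hu unfolding set_integrable_def by (subst eq)
  have "(LINT x|lborel. H x * u x) = integral {c..c + \<delta>} (\<lambda>x. H x * u x)"
    using set_borel_integral_eq_integral(2)[OF Hu] unfolding set_lebesgue_integral_def by (subst eq)
  moreover have Hu': "(\<lambda>x. H x * u x) integrable_on {c..c + \<delta>}"
    by (rule set_borel_integral_eq_integral(1)[OF Hu])
  moreover have u1: "(u has_integral 1) {c..c + \<delta>}"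
    using has_integral_derivative[OF s, of c "c + \<delta>"] s0[of c] s1[of "c + \<delta>"] \<open>\<delta> > 0\<close> by simp
  ultimately have "(LINT x|lborel. H x * u x) - H c = integral {c..c + \<delta>} (\<lambda>x. H x * u x - H c * u x)"
    using has_integral_mult_right[OF u1, of "H c"]
    by (subst Henstock_Kurzweil_Integration.integral_diff) (auto simp: integral_unique intro: has_integral_integrable)
  also have "norm \<dots> \<le> integral {c..c + \<delta>} (\<lambda>x. \<epsilon> * u x)"
  proof (rule integral_norm_bound_integral)
    show "(\<lambda>x. H x * u x - H c * u x) integrable_on {c..c + \<delta>}"
      using Hu' has_integral_mult_right[OF u1, of "H c"] by (intro Henstock_Kurzweil_Integration.integrable_diff) auto
    show "(\<lambda>x. \<epsilon> * u x) integrable_on {c..c + \<delta>}"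
      using has_integral_mult_right[OF u1, of \<epsilon>] by auto
    show "norm (H x * u x - H c * u x) \<le> \<epsilon> * u x" if "x \<in> {c..c + \<delta>}" for x
      using mult_right_mono[OF near[OF that] u_nonneg[of x]] u_nonneg[of x] by (simp add: abs_mult flip: left_diff_distrib)
  qed
  also have "\<dots> = \<epsilon>"
    using integral_unique[OF has_integral_mult_right[OF u1, of \<epsilon>]] by (simp only: mult_1_right)
  finally show "\<bar>(LINT x|lborel. H x * u x) - H c\<bar> \<le> \<epsilon>" by simp
qed

text \<open>
  The test functions are smooth plateaus that tend to the indicator of \<open>(a, b]\<close>. Their derivatives
  are two densities that concentrate at \<open>a\<close> and, with negative sign, at \<open>b\<close>.
\<close>

lemma weak_derivative_increment:
  assumes H: "continuous_on UNIV H" and weak: "is_weak_derivative H g" and "a < b"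
  shows "H b - H a = (LINT x:{a..b}|lborel. g x)"
proof -
  obtain \<sigma> :: "real \<Rightarrow> real" where \<sigma>: "C_infinity \<sigma>" "mono \<sigma>"
    and \<sigma>0: "\<And>x. x \<le> 0 \<Longrightarrow> \<sigma> x = 0" and \<sigma>1: "\<And>x. 1 \<le> x \<Longrightarrow> \<sigma> x = 1"
    using exists_smooth_step by blast
  define s where "s n c x = \<sigma> (real (Suc n) * x + (- real (Suc n) * c))" for n c x
  have s_eq: "s n c x = \<sigma> (real (Suc n) * (x - c))" for n c x
    by (simp add: s_def algebra_simps)
  have s_smooth: "C_infinity (s n c)" for n c
    unfolding s_def by (rule C_infinity_affine[OF \<sigma>(1)])
  have s_deriv: "(s n c has_real_derivative deriv (s n c) x) (at x)" for n c x
    using C_infinity_has_derivative[OF s_smooth, of 0] by simp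
  have s_mono: "mono (s n c)" for n c
    using \<sigma>(2) by (auto simp: s_eq mono_def intro!: mult_left_mono)
  have s0: "s n c x = 0" if "x \<le> c" for n c x
    unfolding s_eq by (rule \<sigma>0) (use that in \<open>auto intro: mult_nonneg_nonpos\<close>)
  have s1: "s n c x = 1" if "c + 1 / real (Suc n) \<le> x" for n c x
    unfolding s_eq by (rule \<sigma>1) (use that in \<open>simp add: field_simps\<close>)
  have s_range: "0 \<le> s n c x" "s n c x \<le> 1" for n c x
    using monoD[OF \<sigma>(2), of "min 0 (real (Suc n) * (x - c))" "real (Suc n) * (x - c)"]
      monoD[OF \<sigma>(2), of "real (Suc n) * (x - c)" "max 1 (real (Suc n) * (x - c))"]
    unfolding s_eq by (simp_all add: \<sigma>0 \<sigma>1 del: of_nat_Suc)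
  have u_cont: "continuous_on UNIV (deriv (s n c))" for n c
    using C_infinity_continuous[OF s_smooth, of _ 1] by simp
  have sample: "integrable lborel (\<lambda>x. H x * deriv (s n c) x)"
    "(\<And>x. x \<in> {c..c + 1 / real (Suc n)} \<Longrightarrow> \<bar>H x - H c\<bar> \<le> \<epsilon>) \<Longrightarrow> \<bar>(LINT x|lborel. H x * deriv (s n c) x) - H c\<bar> \<le> \<epsilon>"
    for n c \<epsilon>
  proof -
    have "continuous_on {c..c + 1 / real (Suc n)} (\<lambda>x. H x - H c)"
      by (intro continuous_on_diff continuous_on_subset[OF H]) auto
    then obtain B where "\<And>x. x \<in> {c..c + 1 / real (Suc n)} \<Longrightarrow> \<bar>H x - H c\<bar> \<le> B"
      using continuous_bounded_Icc by blast
    then show "integrable lborel (\<lambda>x. H x * deriv (s n c) x)"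
      by (intro smooth_step_samples_value(1)[OF s_deriv u_cont s_mono _ s0 s1 H, where \<delta> = "1 / real (Suc n)"]) auto
    show "\<bar>(LINT x|lborel. H x * deriv (s n c) x) - H c\<bar> \<le> \<epsilon>"
      if "\<And>x. x \<in> {c..c + 1 / real (Suc n)} \<Longrightarrow> \<bar>H x - H c\<bar> \<le> \<epsilon>"
      using that
      by (intro smooth_step_samples_value(2)[OF s_deriv u_cont s_mono _ s0 s1 H, where \<delta> = "1 / real (Suc n)"]) auto
  qed
  have sample_lim: "(\<lambda>n. LINT x|lborel. H x * deriv (s n c) x) \<longlonglongrightarrow> H c" for c
  proof (rule LIMSEQ_by_approximation)
    fix \<epsilon> :: real assume "\<epsilon> > 0"
    have "isCont H c" using H by (simp add: continuous_on_eq_continuous_at)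
    then obtain d where d: "d > 0" "\<And>x. \<bar>x - c\<bar> < d \<Longrightarrow> \<bar>H x - H c\<bar> < \<epsilon>"
      using \<open>\<epsilon> > 0\<close> unfolding continuous_at_eps_delta dist_real_def by blast
    have "\<forall>\<^sub>F n in sequentially. inverse (real (Suc n)) < d"
      using order_tendstoD(2)[OF LIMSEQ_inverse_real_of_nat d(1)] .
    then have "\<forall>\<^sub>F n in sequentially. \<bar>(LINT x|lborel. H x * deriv (s n c) x) - H c\<bar> \<le> \<epsilon>"
    proof eventually_elim
      case (elim n)
      show ?case
      proof (rule sample(2))
        fix x assume "x \<in> {c..c + 1 / real (Suc n)}"
        then have "\<bar>x - c\<bar> < d" using elim by (simp add: inverse_eq_divide)
        from d(2)[OF this] show "\<bar>H x - H c\<bar> \<le> \<epsilon>" by simp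
      qed
    qed
    then show "\<exists>x' y'. x' \<longlonglongrightarrow> y' \<and> \<bar>H c - y'\<bar> \<le> \<epsilon> \<and>
        (\<forall>\<^sub>F n in sequentially. \<bar>(LINT x|lborel. H x * deriv (s n c) x) - x' n\<bar> \<le> \<epsilon>)"
      using \<open>\<epsilon> > 0\<close> by (intro exI[of _ "\<lambda>_. H c"] exI[of _ "H c"]) auto
  qed
  define \<phi> where "\<phi> n x = s n a x - s n b x" for n x
  have \<phi>_zero: "\<phi> n x = 0" if "x \<notin> {a..b + 1}" for n x
  proof (cases "x < a")
    case True
    then show ?thesis using s0[of x a n] s0[of x b n] \<open>a < b\<close> by (simp add: \<phi>_def)
  next
    case False
    then have "b + 1 \<le> x" using that by simp
    moreover have "1 / real (Suc n) \<le> 1" by simp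
    ultimately have "a + 1 / real (Suc n) \<le> x" "b + 1 / real (Suc n) \<le> x" using \<open>a < b\<close> by linarith+
    then show ?thesis using s1[of a n x] s1[of b n x] by (simp add: \<phi>_def)
  qed
  have test: "(LINT x|lborel. H x * deriv (\<phi> n) x) = - (LINT x|lborel. g x * \<phi> n x)" for n
  proof -
    have "C_infinity (\<phi> n)"
      unfolding \<phi>_def by (intro C_infinity_diff s_smooth)
    moreover have "{x. \<phi> n x \<noteq> 0} \<subseteq> {a..b + 1}" using \<phi>_zero by blast
    then have "compact (closure {x. \<phi> n x \<noteq> 0})"
      using bounded_subset[OF bounded_closed_interval] by (simp add: compact_closure)
    ultimately show ?thesis using weak by (auto simp: is_weak_derivative_def)
  qed
  have "deriv (\<phi> n) x = deriv (s n a) x - deriv (s n b) x" for n x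
    unfolding \<phi>_def by (intro DERIV_imp_deriv DERIV_diff s_deriv)
  then have "(LINT x|lborel. H x * deriv (\<phi> n) x) =
      (LINT x|lborel. H x * deriv (s n a) x) - (LINT x|lborel. H x * deriv (s n b) x)" for n
    using sample(1) by (simp add: right_diff_distrib)
  then have lhs: "(\<lambda>n. LINT x|lborel. H x * deriv (\<phi> n) x) \<longlonglongrightarrow> H a - H b"
    by (simp add: tendsto_diff sample_lim)
  have g: "set_integrable lborel {a..b + 1} g"
    using weak by (auto simp: is_weak_derivative_def)
  then have g': "integrable lborel (\<lambda>x. indicator {a..b + 1} x * g x)"
    by (simp add: set_integrable_def)
  have "(\<lambda>n. LINT x|lborel. g x * \<phi> n x) \<longlonglongrightarrow> (LINT x|lborel. indicator {a<..b} x * (indicator {a..b + 1} x * g x))"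
  proof (rule integral_dominated_convergence)
    have gm: "(\<lambda>x. indicator {a..b + 1} x * g x) \<in> borel_measurable lborel" using g' by simp
    show "(\<lambda>x. indicator {a<..b} x * (indicator {a..b + 1} x * g x)) \<in> borel_measurable lborel"
      by (rule borel_measurable_times[OF _ gm]) simp
    have \<phi>m: "\<phi> n \<in> borel_measurable lborel" for n
    proof -
      have "continuous_on UNIV (\<phi> n)"
        unfolding \<phi>_def using C_infinity_continuous[OF s_smooth, of _ 0] by (intro continuous_on_diff) auto
      then show ?thesis by (simp add: borel_measurable_continuous_onI)
    qed
    have eq: "(\<lambda>x. g x * \<phi> n x) = (\<lambda>x. (indicator {a..b + 1} x * g x) * \<phi> n x)" for n
    proof
      show "g x * \<phi> n x = (indicator {a..b + 1} x * g x) * \<phi> n x" for x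
        by (cases "x \<in> {a..b + 1}") (simp_all add: \<phi>_zero)
    qed
    show "(\<lambda>x. g x * \<phi> n x) \<in> borel_measurable lborel" for n
      unfolding eq by (intro borel_measurable_times gm \<phi>m)
    show "integrable lborel (\<lambda>x. \<bar>indicator {a..b + 1} x * g x\<bar>)" by (rule integrable_abs[OF g'])
    show "AE x in lborel. norm (g x * \<phi> n x) \<le> \<bar>indicator {a..b + 1} x * g x\<bar>" for n
    proof (rule AE_I2)
      fix x
      have "\<bar>\<phi> n x\<bar> \<le> 1"
        using s_range[of n a x] s_range[of n b x] unfolding \<phi>_def by linarith
      then have "\<bar>indicator {a..b + 1} x * g x\<bar> * \<bar>\<phi> n x\<bar> \<le> \<bar>indicator {a..b + 1} x * g x\<bar>"
        by (simp add: mult_left_le)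
      then show "norm (g x * \<phi> n x) \<le> \<bar>indicator {a..b + 1} x * g x\<bar>"
        unfolding fun_cong[OF eq, of x n] real_norm_def by (simp only: abs_mult)
    qed
    show "AE x in lborel. (\<lambda>n. g x * \<phi> n x) \<longlonglongrightarrow> indicator {a<..b} x * (indicator {a..b + 1} x * g x)"
    proof (rule AE_I2)
      fix x
      have s_lim: "(\<lambda>n. s n c x) \<longlonglongrightarrow> indicator {c<..} x" for c
      proof (cases "c < x")
        case True
        have "\<forall>\<^sub>F n in sequentially. inverse (real (Suc n)) < x - c"
          using order_tendstoD(2)[OF LIMSEQ_inverse_real_of_nat] True by simp
        then have "\<forall>\<^sub>F n in sequentially. s n c x = 1"
          by eventually_elim (rule s1, simp add: inverse_eq_divide)
        with True show ?thesis by (simp add: tendsto_eventually)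
      qed (simp add: s0)
      have "(\<lambda>n. g x * \<phi> n x) \<longlonglongrightarrow> g x * (indicator {a<..} x - indicator {b<..} x)"
        unfolding \<phi>_def by (intro tendsto_intros s_lim)
      also have "g x * (indicator {a<..} x - indicator {b<..} x) = indicator {a<..b} x * (indicator {a..b + 1} x * g x)"
        using \<open>a < b\<close> by (auto simp: indicator_def)
      finally show "(\<lambda>n. g x * \<phi> n x) \<longlonglongrightarrow> indicator {a<..b} x * (indicator {a..b + 1} x * g x)" .
    qed
  qed
  moreover have "(LINT x|lborel. indicator {a<..b} x * (indicator {a..b + 1} x * g x)) = (LINT x:{a..b}|lborel. g x)"
    unfolding set_lebesgue_integral_def
  proof (rule integral_cong_AE)
    show "AE x in lborel. indicator {a<..b} x * (indicator {a..b + 1} x * g x) = indicator {a..b} x *\<^sub>R g x"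
      using AE_lborel_singleton[of a] by eventually_elim (auto simp: indicator_def)
    show "(\<lambda>x. indicator {a<..b} x * (indicator {a..b + 1} x * g x)) \<in> borel_measurable lborel"
      by (rule borel_measurable_times[OF _ borel_measurable_integrable[OF g']]) simp
    have "set_integrable lborel {a..b} g" using weak by (auto simp: is_weak_derivative_def)
    then show "(\<lambda>x. indicator {a..b} x *\<^sub>R g x) \<in> borel_measurable lborel" by (simp add: set_integrable_def)
  qed
  ultimately have "(\<lambda>n. - (LINT x|lborel. g x * \<phi> n x)) \<longlonglongrightarrow> - (LINT x:{a..b}|lborel. g x)"
    by (simp add: tendsto_minus)
  with lhs have "H a - H b = - (LINT x:{a..b}|lborel. g x)"
    unfolding test by (rule LIMSEQ_unique)
  then show ?thesis by simp
qed

section \<open>Integration by parts against a monotone function\<close>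

locale stieltjes_integrator =
  fixes V :: "real \<Rightarrow> real"
  assumes mono_V: "mono V" and right_continuous_V: "\<And>x. continuous (at_right x) V"
begin

abbreviation "dV \<equiv> interval_measure V"

lemma emeasure_Ioc: "a \<le> b \<Longrightarrow> emeasure dV {a<..b} = ennreal (V b - V a)"
  by (rule emeasure_interval_measure_Ioc) (use mono_V right_continuous_V in \<open>auto simp: mono_def\<close>)

lemma measure_Ioc: "a \<le> b \<Longrightarrow> measure dV {a<..b} = V b - V a"
  by (rule measure_interval_measure_Ioc) (use mono_V right_continuous_V in \<open>auto simp: mono_def\<close>)

lemma emeasure_Icc_finite: "emeasure dV {a..b} < \<infinity>"
proof (cases "a \<le> b")
  case True
  have "emeasure dV {a..b} \<le> emeasure dV {a - 1<..b}"
    by (intro emeasure_mono) auto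
  also have "\<dots> < \<infinity>" using True emeasure_Ioc[of "a - 1" b] by simp
  finally show ?thesis .
qed simp

lemma set_integrable_dV:
  fixes h :: "real \<Rightarrow> real"
  assumes "h \<in> borel_measurable borel" "\<And>x. x \<in> {a..b} \<Longrightarrow> \<bar>h x\<bar> \<le> B" "A \<in> sets borel" "A \<subseteq> {a..b}"
  shows "set_integrable dV A h"
proof (rule set_integrable_subset[of _ "{a..b}"])
  show "set_integrable dV {a..b} h"
    unfolding set_integrable_def
    by (rule integrableI_bounded_set_indicator[where B = B])
       (use assms(1,2) emeasure_Icc_finite in \<open>auto cong: measurable_cong_sets\<close>)
qed (use assms in auto)

lemma measure_atom:
  assumes "(V \<longlongrightarrow> v) (at_left m)"
  shows "measure dV {m} = V m - v"
proof (rule LIMSEQ_unique)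
  let ?A = "\<lambda>n. {m - inverse (real (Suc n))<..m}"
  have "(\<lambda>n. measure dV (?A n)) \<longlonglongrightarrow> measure dV (\<Inter>n. ?A n)"
  proof (rule Lim_measure_decseq)
    show "decseq ?A"
    proof (rule decseq_SucI)
      fix n
      have "inverse (real (Suc (Suc n))) \<le> inverse (real (Suc n))" by (simp add: field_simps)
      then show "?A (Suc n) \<subseteq> ?A n"
        by (intro subsetI) (unfold greaterThanAtMost_iff, linarith)
    qed
    show "emeasure dV (?A n) \<noteq> \<infinity>" for n by (subst emeasure_Ioc) auto
  qed auto
  also have "(\<Inter>n. ?A n) = {m}"
  proof
    show "(\<Inter>n. ?A n) \<subseteq> {m}"
    proof
      fix x assume x: "x \<in> (\<Inter>n. ?A n)"
      have "x \<le> m" using x by auto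
      moreover have "(\<lambda>n. m - inverse (real (Suc n))) \<longlonglongrightarrow> m - 0"
        by (intro tendsto_diff tendsto_const LIMSEQ_inverse_real_of_nat)
      then have "m - 0 \<le> x"
        by (rule LIMSEQ_le_const2) (use x in \<open>auto intro!: exI[of _ 0] less_imp_le\<close>)
      ultimately show "x \<in> {m}" by simp
    qed
  qed auto
  finally show "(\<lambda>n. measure dV (?A n)) \<longlonglongrightarrow> measure dV {m}" .
  have "filterlim (\<lambda>n. m - inverse (real (Suc n))) (at_left m) sequentially"
  proof (rule tendsto_imp_filterlim_at_left)
    have "(\<lambda>n. m - inverse (real (Suc n))) \<longlonglongrightarrow> m - 0"
      by (intro tendsto_diff tendsto_const LIMSEQ_inverse_real_of_nat)
    then show "(\<lambda>n. m - inverse (real (Suc n))) \<longlonglongrightarrow> m" by simp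
  qed simp
  from filterlim_compose[OF assms this]
  have "(\<lambda>n. V m - V (m - inverse (real (Suc n)))) \<longlonglongrightarrow> V m - v" by (intro tendsto_intros)
  then show "(\<lambda>n. measure dV (?A n)) \<longlonglongrightarrow> V m - v" by (simp add: measure_Ioc)
qed

lemma V_bounds: "x \<in> {a..b} \<Longrightarrow> \<bar>V x\<bar> \<le> \<bar>V a\<bar> + \<bar>V b\<bar>"
  using monoD[OF mono_V, of a x] monoD[OF mono_V, of x b] by auto

lemma set_integrable_mult_V:
  assumes "continuous_on UNIV \<psi>"
  shows "set_integrable lborel {a..b} (\<lambda>x. \<psi> x * V x)"
proof -
  obtain B where B: "B > 0" "\<And>x. x \<in> {a..b} \<Longrightarrow> \<bar>\<psi> x\<bar> \<le> B"
    using continuous_bounded_Icc[of a b \<psi>] continuous_on_subset[OF assms] by blast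
  show ?thesis
    unfolding set_integrable_def
  proof (rule integrableI_bounded_set_indicator[where B = "B * (\<bar>V a\<bar> + \<bar>V b\<bar>)"])
    show "(\<lambda>x. \<psi> x * V x) \<in> borel_measurable lborel"
      using borel_measurable_mono[OF mono_V] borel_measurable_continuous_onI[OF assms] by simp
    show "AE x in lborel. x \<in> {a..b} \<longrightarrow> norm (\<psi> x * V x) \<le> B * (\<bar>V a\<bar> + \<bar>V b\<bar>)"
      using B V_bounds by (auto simp: abs_mult intro!: AE_I2 mult_mono)
  qed (auto simp: emeasure_lborel_Icc_eq)
qed

lemma integrable_mult_V: "continuous_on UNIV \<psi> \<Longrightarrow> (\<lambda>x. \<psi> x * V x) integrable_on {a..b}"
  by (rule set_borel_integral_eq_integral(1)[OF set_integrable_mult_V])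

text \<open>
  The defect \<open>\<Phi>\<close> of the formula is additive over adjacent intervals and at most a constant times
  \<open>(v - u) * (V v - V u)\<close>, a product of two additive quantities. Short intervals thus satisfy
  \<open>\<bar>\<Phi> u v\<bar> \<le> \<epsilon> * (V v - V u)\<close>, and bisection extends this to \<open>[a, b]\<close>.
\<close>

lemma integral_by_parts_Ioc:
  assumes \<Lambda>: "\<And>x. (\<Lambda> has_real_derivative \<Lambda>' x) (at x)" and \<Lambda>': "continuous_on UNIV \<Lambda>'" and "a \<le> b"
  shows "(LINT x:{a<..b}|dV. \<Lambda> x) = \<Lambda> b * V b - \<Lambda> a * V a - integral {a..b} (\<lambda>x. \<Lambda>' x * V x)"
proof -
  obtain K where K: "K > 0" "\<And>x. x \<in> {a..b} \<Longrightarrow> \<bar>\<Lambda>' x\<bar> \<le> K"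
    using continuous_bounded_Icc[of a b \<Lambda>'] continuous_on_subset[OF \<Lambda>'] by blast
  have lip: "\<bar>\<Lambda> y - \<Lambda> x\<bar> \<le> K * (y - x)" if "a \<le> x" "x \<le> y" "y \<le> b" for x y
  proof -
    have "\<bar>integral {x..y} \<Lambda>'\<bar> \<le> K * (y - x)"
      by (rule abs_integral_le) (use K that has_integral_derivative[OF \<Lambda>] in \<open>auto intro: has_integral_integrable\<close>)
    then show ?thesis using has_integral_derivative[OF \<Lambda> that(2)] by (simp add: integral_unique)
  qed
  have \<Lambda>_cont: "continuous_on UNIV \<Lambda>"
    using \<Lambda> by (auto intro: continuous_at_imp_continuous_on DERIV_isCont)
  then have \<Lambda>_meas: "\<Lambda> \<in> borel_measurable borel" by (rule borel_measurable_continuous_onI)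
  have \<Lambda>_int: "set_integrable dV A \<Lambda>" if "A \<in> sets borel" "A \<subseteq> {u..v}" for A u v
  proof -
    obtain B where "\<And>x. x \<in> {u..v} \<Longrightarrow> \<bar>\<Lambda> x\<bar> \<le> B"
      using continuous_bounded_Icc[OF continuous_on_subset[OF \<Lambda>_cont subset_UNIV], of u v] by blast
    then show ?thesis by (rule set_integrable_dV[OF \<Lambda>_meas _ that])
  qed
  have \<Lambda>_int_Ioc: "set_integrable dV {u<..v} \<Lambda>" for u v
    by (rule \<Lambda>_int[of _ u v]) auto
  have c_int: "set_integrable dV {u<..v} (\<lambda>_. c)" for u v c :: real
    by (rule set_integrable_dV[where a = u and b = v and B = "\<bar>c\<bar>"]) auto
  have c_eq: "(LINT x:{u<..v}|dV. c) = c * (V v - V u)" if "u \<le> v" for u v c :: real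
    unfolding set_lebesgue_integral_def using measure_Ioc[OF that] emeasure_Ioc[OF that] by simp
  define \<Phi> where "\<Phi> u v = (LINT x:{u<..v}|dV. \<Lambda> x) -
    (\<Lambda> v * V v - \<Lambda> u * V u - integral {u..v} (\<lambda>x. \<Lambda>' x * V x))" for u v
  have \<Phi>_add: "\<Phi> u w = \<Phi> u v + \<Phi> v w" if "u \<le> v" "v \<le> w" for u v w
  proof -
    have "{u<..w} = {u<..v} \<union> {v<..w}" using that by auto
    then have "(LINT x:{u<..w}|dV. \<Lambda> x) = (LINT x:{u<..v}|dV. \<Lambda> x) + (LINT x:{v<..w}|dV. \<Lambda> x)"
      using set_integral_Un[of "{u<..v}" "{v<..w}" dV \<Lambda>] \<Lambda>_int_Ioc[of u v] \<Lambda>_int_Ioc[of v w]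
      by (simp add: Int_def)
    moreover have "integral {u..w} (\<lambda>x. \<Lambda>' x * V x) = integral {u..v} (\<lambda>x. \<Lambda>' x * V x) + integral {v..w} (\<lambda>x. \<Lambda>' x * V x)"
      using Henstock_Kurzweil_Integration.integral_combine[OF that integrable_mult_V[OF \<Lambda>']] by simp
    ultimately show ?thesis by (simp add: \<Phi>_def)
  qed
  have \<Phi>_small: "\<bar>\<Phi> u v\<bar> \<le> 2 * K * (v - u) * (V v - V u)" if "a \<le> u" "u \<le> v" "v \<le> b" for u v
  proof -
    have "(LINT x:{u<..v}|dV. \<Lambda> x - \<Lambda> v) = (LINT x:{u<..v}|dV. \<Lambda> x) - \<Lambda> v * (V v - V u)"
      using set_integral_diff(2)[OF \<Lambda>_int_Ioc[of u v] c_int[of u v "\<Lambda> v"]] c_eq[OF that(2), of "\<Lambda> v"]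
      by simp
    moreover have \<Lambda>'_V: "((\<lambda>x. \<Lambda>' x * V u) has_integral ((\<Lambda> v - \<Lambda> u) * V u)) {u..v}"
      by (rule has_integral_mult_left[OF has_integral_derivative[OF \<Lambda> that(2)]])
    then have "integral {u..v} (\<lambda>x. \<Lambda>' x * V x - \<Lambda>' x * V u) = integral {u..v} (\<lambda>x. \<Lambda>' x * V x) - (\<Lambda> v - \<Lambda> u) * V u"
      using Henstock_Kurzweil_Integration.integral_diff[OF integrable_mult_V[OF \<Lambda>', of u v] has_integral_integrable[OF \<Lambda>'_V]]
        integral_unique[OF \<Lambda>'_V] by (simp only:)
    ultimately have "\<Phi> u v = (LINT x:{u<..v}|dV. \<Lambda> x - \<Lambda> v) + integral {u..v} (\<lambda>x. \<Lambda>' x * V x - \<Lambda>' x * V u)"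
      by (simp add: \<Phi>_def algebra_simps)
    moreover have "\<bar>LINT x:{u<..v}|dV. \<Lambda> x - \<Lambda> v\<bar> \<le> (LINT x:{u<..v}|dV. K * (v - u))"
    proof -
      have "\<bar>LINT x:{u<..v}|dV. \<Lambda> x - \<Lambda> v\<bar> \<le> (LINT x|dV. \<bar>indicator {u<..v} x *\<^sub>R (\<Lambda> x - \<Lambda> v)\<bar>)"
        unfolding set_lebesgue_integral_def by (rule integral_abs_bound)
      also have "\<dots> \<le> (LINT x:{u<..v}|dV. K * (v - u))"
        unfolding set_lebesgue_integral_def
      proof (rule integral_mono)
        show "integrable dV (\<lambda>x. \<bar>indicator {u<..v} x *\<^sub>R (\<Lambda> x - \<Lambda> v)\<bar>)"
          using set_integral_diff(1)[OF \<Lambda>_int_Ioc[of u v] c_int[of u v "\<Lambda> v"]]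
          unfolding set_integrable_def by (rule integrable_abs)
        show "integrable dV (\<lambda>x. indicator {u<..v} x *\<^sub>R (K * (v - u)))"
          using c_int unfolding set_integrable_def .
        show "\<bar>indicator {u<..v} x *\<^sub>R (\<Lambda> x - \<Lambda> v)\<bar> \<le> indicator {u<..v} x *\<^sub>R (K * (v - u))" for x
        proof (cases "x \<in> {u<..v}")
          case True
          then have "\<bar>\<Lambda> v - \<Lambda> x\<bar> \<le> K * (v - x)" using that by (intro lip) auto
          also have "\<dots> \<le> K * (v - u)" using True K(1) by (intro mult_left_mono) auto
          finally show ?thesis using True by (simp add: abs_minus_commute)
        qed simp
      qed
      finally show ?thesis .
    qed
    moreover have "\<bar>integral {u..v} (\<lambda>x. \<Lambda>' x * V x - \<Lambda>' x * V u)\<bar> \<le> K * (V v - V u) * (v - u)"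
    proof (rule abs_integral_le)
      show "(\<lambda>x. \<Lambda>' x * V x - \<Lambda>' x * V u) integrable_on {u..v}"
        by (intro Henstock_Kurzweil_Integration.integrable_diff integrable_mult_V[OF \<Lambda>'] has_integral_integrable[OF \<Lambda>'_V])
      fix x assume x: "x \<in> {u..v}"
      have "\<bar>\<Lambda>' x\<bar> * \<bar>V x - V u\<bar> \<le> K * (V v - V u)"
        using K that x monoD[OF mono_V, of u x] monoD[OF mono_V, of x v] by (intro mult_mono) auto
      then show "\<bar>\<Lambda>' x * V x - \<Lambda>' x * V u\<bar> \<le> K * (V v - V u)"
        by (simp add: abs_mult flip: right_diff_distrib)
    qed (use that in auto)
    ultimately show ?thesis
      unfolding c_eq[OF that(2)] by (simp add: algebra_simps)
  qed
  have main: "\<bar>\<Phi> a b\<bar> \<le> \<epsilon> * (V b - V a)" if "\<epsilon> > 0" for \<epsilon>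
  proof -
    define P where "P u v \<longleftrightarrow> (a \<le> u \<and> u \<le> v \<and> v \<le> b \<longrightarrow> \<bar>\<Phi> u v\<bar> \<le> \<epsilon> * (V v - V u))" for u v
    from \<open>a \<le> b\<close> have "P a b"
    proof (induction rule: Bolzano)
      case (trans u v w)
      show ?case unfolding P_def
      proof
        assume uw: "a \<le> u \<and> u \<le> w \<and> w \<le> b"
        then have "\<bar>\<Phi> u v\<bar> \<le> \<epsilon> * (V v - V u)" "\<bar>\<Phi> v w\<bar> \<le> \<epsilon> * (V w - V v)"
          using trans unfolding P_def by auto
        moreover have "\<epsilon> * (V w - V u) = \<epsilon> * (V v - V u) + \<epsilon> * (V w - V v)" by (simp add: algebra_simps)
        ultimately show "\<bar>\<Phi> u w\<bar> \<le> \<epsilon> * (V w - V u)"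
          using \<Phi>_add[of u v w] trans by linarith
      qed
    next
      case (local x)
      have "P u v" if uv: "u \<le> x" "x \<le> v" "v - u < \<epsilon> / (2 * K)" for u v
        unfolding P_def
      proof
        assume ab: "a \<le> u \<and> u \<le> v \<and> v \<le> b"
        have "2 * K * (v - u) \<le> \<epsilon>" using uv(3) K(1) by (simp add: field_simps)
        then have "2 * K * (v - u) * (V v - V u) \<le> \<epsilon> * (V v - V u)"
          using ab monoD[OF mono_V, of u v] by (intro mult_right_mono) auto
        with \<Phi>_small[of u v] ab show "\<bar>\<Phi> u v\<bar> \<le> \<epsilon> * (V v - V u)" by linarith
      qed
      moreover have "\<epsilon> / (2 * K) > 0" using \<open>\<epsilon> > 0\<close> K(1) by simp
      ultimately show ?case by blast
    qed
    then show ?thesis using \<open>a \<le> b\<close> by (simp add: P_def)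
  qed
  have "\<bar>\<Phi> a b\<bar> \<le> 0"
  proof (rule field_le_epsilon)
    fix \<epsilon> :: real assume "\<epsilon> > 0"
    have nonneg: "0 \<le> V b - V a" using monoD[OF mono_V \<open>a \<le> b\<close>] by simp
    have "\<bar>\<Phi> a b\<bar> \<le> \<epsilon> / (V b - V a + 1) * (V b - V a)" using \<open>\<epsilon> > 0\<close> nonneg by (intro main) auto
    also have "\<dots> \<le> \<epsilon>" using nonneg \<open>\<epsilon> > 0\<close> by (simp add: field_simps)
    finally show "\<bar>\<Phi> a b\<bar> \<le> 0 + \<epsilon>" by simp
  qed
  then show ?thesis by (simp add: \<Phi>_def)
qed

text \<open>
  Including the left end point adds the atom \<open>V a - v\<close>, which replaces \<open>V a\<close> by the left limit \<open>v\<close>.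
\<close>

lemma integral_by_parts_Icc:
  assumes \<Lambda>: "\<And>x. (\<Lambda> has_real_derivative \<Lambda>' x) (at x)" and \<Lambda>': "continuous_on UNIV \<Lambda>'" and "a \<le> b"
    and v: "(V \<longlongrightarrow> v) (at_left a)"
  shows "(LINT x:{a..b}|dV. \<Lambda> x) = \<Lambda> b * V b - \<Lambda> a * v - integral {a..b} (\<lambda>x. \<Lambda>' x * V x)"
proof -
  have \<Lambda>_cont: "continuous_on UNIV \<Lambda>"
    using \<Lambda> by (auto intro: continuous_at_imp_continuous_on DERIV_isCont)
  then have \<Lambda>_meas: "\<Lambda> \<in> borel_measurable borel" by (rule borel_measurable_continuous_onI)
  have \<Lambda>_int: "set_integrable dV A \<Lambda>" if "A \<in> sets borel" "A \<subseteq> {a..b}" for A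
  proof -
    obtain B where "\<And>x. x \<in> {a..b} \<Longrightarrow> \<bar>\<Lambda> x\<bar> \<le> B"
      using continuous_bounded_Icc[OF continuous_on_subset[OF \<Lambda>_cont subset_UNIV], of a b] by blast
    then show ?thesis by (rule set_integrable_dV[OF \<Lambda>_meas _ that])
  qed
  have "{a..b} = {a} \<union> {a<..b}" using \<open>a \<le> b\<close> by auto
  then have "(LINT x:{a..b}|dV. \<Lambda> x) = (LINT x:{a}|dV. \<Lambda> x) + (LINT x:{a<..b}|dV. \<Lambda> x)"
    using set_integral_Un[of "{a}" "{a<..b}" dV \<Lambda>] \<Lambda>_int[of "{a}"] \<Lambda>_int[of "{a<..b}"] \<open>a \<le> b\<close> by auto
  also have "(LINT x:{a}|dV. \<Lambda> x) = (LINT x|dV. indicator {a} x * \<Lambda> a)"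
    unfolding set_lebesgue_integral_def by (rule Bochner_Integration.integral_cong) (auto simp: indicator_def)
  also have "\<dots> = (V a - v) * \<Lambda> a"
    using measure_atom[OF v] by simp
  finally show ?thesis
    using integral_by_parts_Ioc[OF \<Lambda> \<Lambda>' \<open>a \<le> b\<close>] by (simp add: algebra_simps)
qed

lemma abs_integral_le_Icc:
  assumes h: "set_integrable dV {a..b} h" and bnd: "\<And>x. x \<in> {a..b} \<Longrightarrow> \<bar>h x\<bar> \<le> \<delta>"
    and "a \<le> b" and v: "(V \<longlongrightarrow> v) (at_left a)"
  shows "\<bar>LINT x:{a..b}|dV. h x\<bar> \<le> \<delta> * (V b - v)"
proof -
  have "\<bar>LINT x:{a..b}|dV. h x\<bar> \<le> (LINT x|dV. \<bar>indicator {a..b} x *\<^sub>R h x\<bar>)"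
    unfolding set_lebesgue_integral_def by (rule integral_abs_bound)
  also have "\<dots> \<le> (LINT x:{a..b}|dV. \<delta>)"
    unfolding set_lebesgue_integral_def
  proof (rule integral_mono)
    show "integrable dV (\<lambda>x. \<bar>indicator {a..b} x *\<^sub>R h x\<bar>)"
      using h unfolding set_integrable_def by (rule integrable_abs)
    have "set_integrable dV {a..b} (\<lambda>_. \<delta>)"
      by (rule set_integrable_dV[of _ a b "\<bar>\<delta>\<bar>"]) auto
    then show "integrable dV (\<lambda>x. indicator {a..b} x *\<^sub>R \<delta>)" by (simp add: set_integrable_def)
    show "\<bar>indicator {a..b} x *\<^sub>R h x\<bar> \<le> indicator {a..b} x *\<^sub>R \<delta>" for x
      using bnd by (cases "x \<in> {a..b}") auto
  qed
  also have "\<dots> = \<delta> * (V b - v)"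
    using integral_by_parts_Icc[OF DERIV_const[of \<delta>] continuous_on_const \<open>a \<le> b\<close> v] by (simp add: algebra_simps)
  finally show ?thesis .
qed

lemma left_limit_exists: "\<exists>v. (V \<longlongrightarrow> v) (at_left x)"
  using Lim_left_bound[of UNIV x V "V x"] mono_V by (auto simp: mono_def)

end

section \<open>Convergence of the integrals against the local time\<close>

text \<open>
  The exact values at the ends make the boundary terms of an integration by parts vanish where \<open>l\<close>
  does; there nothing is known about the limits of the other factor.
\<close>

lemma polynomial_approximation_exact_ends:
  fixes l :: "real \<Rightarrow> real"
  assumes l: "continuous_on {m..M} l" and "m < M" and "\<epsilon> > 0"
  obtains \<Lambda> \<Lambda>' where "\<And>x. (\<Lambda> has_real_derivative \<Lambda>' x) (at x)" "continuous_on UNIV \<Lambda>'"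
    "\<Lambda> m = l m" "\<Lambda> M = l M" "\<And>x. x \<in> {m..M} \<Longrightarrow> \<bar>l x - \<Lambda> x\<bar> \<le> \<epsilon>"
proof -
  obtain q where q: "real_polynomial_function q" "\<And>x. x \<in> {m..M} \<Longrightarrow> \<bar>l x - q x\<bar> < \<epsilon> / 2"
    using Stone_Weierstrass_real_polynomial_function[OF compact_Icc l, of "\<epsilon> / 2"] \<open>\<epsilon> > 0\<close> by auto
  obtain q' where q': "real_polynomial_function q'" "\<And>x. (q has_real_derivative q' x) (at x)"
    using has_real_derivative_polynomial_function[OF q(1)] by blast
  define \<alpha> where "\<alpha> = l m - q m"
  define \<beta> where "\<beta> = l M - q M"
  define \<theta> where "\<theta> x = (x - m) / (M - m)" for x
  have ends: "\<bar>\<alpha>\<bar> \<le> \<epsilon> / 2" "\<bar>\<beta>\<bar> \<le> \<epsilon> / 2"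
    using q(2)[of m] q(2)[of M] \<open>m < M\<close> by (auto simp: \<alpha>_def \<beta>_def)
  show thesis
  proof (rule that[of "\<lambda>x. q x + (\<alpha> + \<theta> x * (\<beta> - \<alpha>))" "\<lambda>x. q' x + (\<beta> - \<alpha>) / (M - m)"])
    show "((\<lambda>x. q x + (\<alpha> + \<theta> x * (\<beta> - \<alpha>))) has_real_derivative q' x + (\<beta> - \<alpha>) / (M - m)) (at x)" for x
      unfolding \<theta>_def using q'(2) \<open>m < M\<close> by (auto intro!: derivative_eq_intros)
    show "continuous_on UNIV (\<lambda>x. q' x + (\<beta> - \<alpha>) / (M - m))"
      using continuous_real_polymonial_function[OF q'(1)]
      by (intro continuous_intros continuous_at_imp_continuous_on) auto
    show "q m + (\<alpha> + \<theta> m * (\<beta> - \<alpha>)) = l m" "q M + (\<alpha> + \<theta> M * (\<beta> - \<alpha>)) = l M"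
      using \<open>m < M\<close> by (auto simp: \<theta>_def \<alpha>_def \<beta>_def)
    fix x assume x: "x \<in> {m..M}"
    then have \<theta>: "0 \<le> \<theta> x" "\<theta> x \<le> 1" using \<open>m < M\<close> by (auto simp: \<theta>_def)
    have "\<alpha> + \<theta> x * (\<beta> - \<alpha>) = (1 - \<theta> x) * \<alpha> + \<theta> x * \<beta>" by (simp add: algebra_simps)
    also have "\<bar>\<dots>\<bar> \<le> (1 - \<theta> x) * (\<epsilon> / 2) + \<theta> x * (\<epsilon> / 2)"
    proof (rule order_trans[OF abs_triangle_ineq add_mono])
      show "\<bar>(1 - \<theta> x) * \<alpha>\<bar> \<le> (1 - \<theta> x) * (\<epsilon> / 2)"
        using mult_left_mono[OF ends(1), of "1 - \<theta> x"] \<theta> by (simp add: abs_mult)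
      show "\<bar>\<theta> x * \<beta>\<bar> \<le> \<theta> x * (\<epsilon> / 2)"
        using mult_left_mono[OF ends(2), of "\<theta> x"] \<theta> by (simp add: abs_mult)
    qed
    also have "\<dots> = \<epsilon> / 2" by (simp add: field_simps)
    finally show "\<bar>l x - (q x + (\<alpha> + \<theta> x * (\<beta> - \<alpha>)))\<bar> \<le> \<epsilon>"
      using q(2)[OF x] by linarith
  qed
qed

text \<open>
  On the polynomials \<open>\<Lambda>\<close> that approximate \<open>l\<close>, both sides are transformed by integration by parts into
  boundary terms and an integral of \<open>\<Lambda>'\<close> against \<open>G i\<close> or \<open>g\<close>, and these converge. The error made by
  replacing \<open>l\<close> by \<open>\<Lambda>\<close> is uniform in \<open>i\<close> because the variation of \<open>G i\<close> on \<open>[m, M]\<close> is at most \<open>C\<close>.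
\<close>

lemma stieltjes_integral_limit:
  fixes l g :: "real \<Rightarrow> real" and G G' :: "nat \<Rightarrow> real \<Rightarrow> real"
  assumes bv: "bounded_variation g" and rc: "right_continuous g" and "m < M"
    and l: "continuous_on {m..M} l" and l0: "\<And>x. x \<notin> {m..M} \<Longrightarrow> l x = 0"
    and G: "\<And>i x. (G i has_real_derivative G' i x) (at x)" and G': "\<And>i. continuous_on UNIV (G' i)"
    and C: "\<And>i. integral {m..M} (\<lambda>x. \<bar>G' i x\<bar>) \<le> C" and B: "\<And>i x. x \<in> {m..M} \<Longrightarrow> \<bar>G i x\<bar> \<le> B"
    and lim: "\<And>u v. m \<le> u \<Longrightarrow> u \<le> v \<Longrightarrow> v \<le> M \<Longrightarrow> (\<lambda>i. integral {u..v} (G i)) \<longlonglongrightarrow> integral {u..v} g"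
    and end_m: "l m \<noteq> 0 \<Longrightarrow> (\<lambda>i. G i m) \<longlonglongrightarrow> Lim (at_left m) g"
    and end_M: "l M \<noteq> 0 \<Longrightarrow> (\<lambda>i. G i M) \<longlonglongrightarrow> g M"
  shows "(\<lambda>i. LINT x|lborel. l x * G' i x) \<longlonglongrightarrow> stieltjes_integral l g"
proof -
  define V where "V = signed_variation g"
  define W where "W = (\<lambda>x. signed_variation g x - g x)"
  have g_eq: "g x = V x - W x" for x by (simp add: V_def W_def)
  have V_rc: "continuous (at_right x) V" for x
    unfolding V_def by (rule right_continuous_signed_variation[OF bv rc])
  interpret V: stieltjes_integrator V
    using mono_signed_variation(1)[OF bv] V_rc by unfold_locales (simp_all add: V_def)
  interpret W: stieltjes_integrator W
  proof
    show "mono W" unfolding W_def by (rule mono_signed_variation(2)[OF bv])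
    show "continuous (at_right x) W" for x
      using rc V_rc[of x] unfolding W_def V_def right_continuous_def by (intro continuous_diff) auto
  qed
  obtain v where v: "(V \<longlongrightarrow> v) (at_left m)" using V.left_limit_exists by blast
  obtain w where w: "(W \<longlongrightarrow> w) (at_left m)" using W.left_limit_exists by blast
  have "(g \<longlongrightarrow> v - w) (at_left m)"
    using tendsto_diff[OF v w] by (simp add: g_eq[symmetric])
  then have Lim_g: "Lim (at_left m) g = v - w" by (intro tendsto_Lim) simp_all
  have g_int: "(\<lambda>x. \<psi> x * g x) integrable_on {a..b}" if "continuous_on UNIV \<psi>" for \<psi> a b
    using Henstock_Kurzweil_Integration.integrable_diff[OF V.integrable_mult_V[OF that] W.integrable_mult_V[OF that], of a b]
    by (simp add: g_eq right_diff_distrib)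
  have g_int1: "g integrable_on {a..b}" for a b
    using g_int[of "\<lambda>_. 1" a b] by simp
  have G_cont: "continuous_on UNIV (G i)" for i
    using G by (auto intro: continuous_at_imp_continuous_on DERIV_isCont)
  have G_int: "(\<lambda>x. \<psi> x * G i x) integrable_on {a..b}" if "continuous_on UNIV \<psi>" for \<psi> i a b
    by (intro integrable_continuous_real continuous_on_mult continuous_on_subset[OF that] continuous_on_subset[OF G_cont]) auto
  have g_bnd: "\<bar>g x\<bar> \<le> \<bar>V m\<bar> + \<bar>V M\<bar> + (\<bar>W m\<bar> + \<bar>W M\<bar>)" if "x \<in> {m..M}" for x
    using V.V_bounds[OF that] W.V_bounds[OF that] unfolding g_eq by linarith
  have weak: "(\<lambda>i. integral {m..M} (\<lambda>x. \<psi> x * G i x)) \<longlonglongrightarrow> integral {m..M} (\<lambda>x. \<psi> x * g x)"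
    if \<psi>: "continuous_on UNIV \<psi>" for \<psi>
  proof -
    have "(\<lambda>i. integral {m..M} (\<lambda>x. \<psi> x * (G i x - g x))) \<longlonglongrightarrow> 0"
    proof (rule weak_convergence_of_integrals)
      show "continuous_on {m..M} \<psi>" using \<psi> continuous_on_subset by blast
      show "(\<lambda>x. G i x - g x) integrable_on {m..M}" for i
        using G_int[of "\<lambda>_. 1" i m M] g_int1 by (intro Henstock_Kurzweil_Integration.integrable_diff) auto
      show "(\<lambda>x. \<psi> x * (G i x - g x)) integrable_on {m..M}" for i
        unfolding right_diff_distrib by (intro Henstock_Kurzweil_Integration.integrable_diff G_int g_int \<psi>)
      show "\<bar>G i x - g x\<bar> \<le> B + (\<bar>V m\<bar> + \<bar>V M\<bar> + (\<bar>W m\<bar> + \<bar>W M\<bar>))" if "x \<in> {m..M}" for i x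
        using B[OF that, of i] g_bnd[OF that] by linarith
      show "(\<lambda>i. integral {u..v} (\<lambda>x. G i x - g x)) \<longlonglongrightarrow> 0" if "m \<le> u" "u \<le> v" "v \<le> M" for u v
      proof -
        have "integral {u..v} (\<lambda>x. G i x - g x) = integral {u..v} (G i) - integral {u..v} g" for i
          using G_int[of "\<lambda>_. 1" i u v] g_int1 by (intro Henstock_Kurzweil_Integration.integral_diff) auto
        then show ?thesis using lim[OF that] by (simp add: LIM_zero)
      qed
    qed (use \<open>m < M\<close> in auto)
    moreover have "integral {m..M} (\<lambda>x. \<psi> x * (G i x - g x)) = integral {m..M} (\<lambda>x. \<psi> x * G i x) - integral {m..M} (\<lambda>x. \<psi> x * g x)" for i
      unfolding right_diff_distrib by (intro Henstock_Kurzweil_Integration.integral_diff G_int g_int \<psi>)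
    ultimately show ?thesis by (simp add: LIM_zero_iff)
  qed
  have l_eq: "l = (\<lambda>x. indicator {m..M} x *\<^sub>R l x)"
    using l0 by (auto simp: indicator_def fun_eq_iff)
  have l_meas: "l \<in> borel_measurable borel"
    by (subst l_eq) (rule borel_measurable_continuous_on_indicator[OF _ l], simp)
  obtain Bl where Bl: "\<And>x. x \<in> {m..M} \<Longrightarrow> \<bar>l x\<bar> \<le> Bl"
    using continuous_bounded_Icc[OF l] by blast
  have st_eq: "stieltjes_integral l g = (LINT x:{m..M}|V.dV. l x) - (LINT x:{m..M}|W.dV. l x)"
    unfolding stieltjes_integral_def set_lebesgue_integral_def W_def[symmetric] l_eq[symmetric]
    unfolding V_def[symmetric] ..
  have l_cont: "continuous_on {m..M} (\<lambda>x. l x * G' i x)" for i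
    by (intro continuous_on_mult l continuous_on_subset[OF G']) auto
  have LINT_eq: "(LINT x|lborel. l x * G' i x) = integral {m..M} (\<lambda>x. l x * G' i x)" for i
  proof -
    have "(\<lambda>x. l x * G' i x) = (\<lambda>x. indicator {m..M} x *\<^sub>R (l x * G' i x))"
      by (subst l_eq) (simp add: mult.assoc)
    then have "(LINT x|lborel. l x * G' i x) = (LINT x:{m..M}|lborel. l x * G' i x)"
      unfolding set_lebesgue_integral_def by (rule arg_cong)
    also have "\<dots> = integral {m..M} (\<lambda>x. l x * G' i x)"
      by (rule set_borel_integral_eq_integral(2)[OF borel_integrable_atLeastAtMost'[OF l_cont]])
    finally show ?thesis .
  qed
  have G'_abs: "(\<lambda>x. \<bar>G' i x\<bar>) integrable_on {m..M}" for i
    by (intro integrable_continuous_real continuous_on_rabs continuous_on_subset[OF G']) auto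
  have C_nonneg: "0 \<le> C"
    using C[of 0] integral_nonneg[OF G'_abs[of 0]] by force
  have V_mass: "0 \<le> V M - v" "0 \<le> W M - w"
  proof -
    have "\<forall>\<^sub>F x in at_left m. V x \<le> V M" "\<forall>\<^sub>F x in at_left m. W x \<le> W M"
      unfolding eventually_at_left_field using monoD[OF V.mono_V] monoD[OF W.mono_V] \<open>m < M\<close>
      by (auto intro!: exI[of _ "m - 1"])
    then show "0 \<le> V M - v" "0 \<le> W M - w"
      using tendsto_upperbound[OF v] tendsto_upperbound[OF w] by force+
  qed
  show ?thesis
  proof (rule LIMSEQ_by_approximation)
    fix \<epsilon> :: real assume "\<epsilon> > 0"
    \<comment> \<open>The tolerance \<open>\<delta>\<close> serves both for the variation of \<open>G i\<close> and for the masses that \<open>dV\<close> and \<open>dW\<close>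
      give to \<open>[m, M]\<close>.\<close>
    define K where "K = C + (V M - v) + (W M - w) + 1"
    define \<delta> where "\<delta> = \<epsilon> / K"
    have K: "K > 0" using C_nonneg V_mass by (simp add: K_def)
    then have \<delta>: "\<delta> > 0" using \<open>\<epsilon> > 0\<close> by (simp add: \<delta>_def)
    have \<delta>_le: "\<delta> * a \<le> \<epsilon>" if "a \<le> K" for a
      using mult_left_mono[OF that, of \<delta>] \<delta> K by (simp add: \<delta>_def)
    obtain \<Lambda> \<Lambda>' where \<Lambda>: "\<And>x. (\<Lambda> has_real_derivative \<Lambda>' x) (at x)" "continuous_on UNIV \<Lambda>'"
      and ends: "\<Lambda> m = l m" "\<Lambda> M = l M" and close: "\<And>x. x \<in> {m..M} \<Longrightarrow> \<bar>l x - \<Lambda> x\<bar> \<le> \<delta>"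
      using polynomial_approximation_exact_ends[OF l \<open>m < M\<close> \<delta>] by blast
    have \<Lambda>_cont: "continuous_on UNIV \<Lambda>"
      using \<Lambda>(1) by (auto intro: continuous_at_imp_continuous_on DERIV_isCont)
    have \<Lambda>_meas: "\<Lambda> \<in> borel_measurable borel" by (rule borel_measurable_continuous_onI[OF \<Lambda>_cont])
    have \<Lambda>_bnd: "\<bar>\<Lambda> x\<bar> \<le> Bl + \<delta>" if "x \<in> {m..M}" for x
      using Bl[OF that] close[OF that] by linarith
    have \<Lambda>G'_int: "(\<lambda>x. \<Lambda> x * G' i x) integrable_on {m..M}" for i
      by (intro integrable_continuous_real continuous_on_mult continuous_on_subset[OF \<Lambda>_cont] continuous_on_subset[OF G']) auto
    have parts: "integral {m..M} (\<lambda>x. \<Lambda> x * G' i x) = \<Lambda> M * G i M - \<Lambda> m * G i m - integral {m..M} (\<lambda>x. \<Lambda>' x * G i x)" for i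
    proof -
      have "((\<lambda>x. \<Lambda>' x * G i x + G' i x * \<Lambda> x) has_integral (\<Lambda> M * G i M - \<Lambda> m * G i m)) {m..M}"
        by (rule has_integral_derivative[OF DERIV_mult[OF \<Lambda>(1) G]]) (use \<open>m < M\<close> in simp)
      then have "integral {m..M} (\<lambda>x. \<Lambda>' x * G i x + \<Lambda> x * G' i x) = \<Lambda> M * G i M - \<Lambda> m * G i m"
        by (simp add: integral_unique mult.commute)
      then show ?thesis
        using Henstock_Kurzweil_Integration.integral_add[OF G_int[OF \<Lambda>(2)] \<Lambda>G'_int, of i i] by simp
    qed
    have "(\<lambda>i. \<Lambda> M * G i M) \<longlonglongrightarrow> \<Lambda> M * g M"
      using tendsto_mult_left[OF end_M, of "\<Lambda> M"] ends(2) by (cases "l M = 0") auto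
    moreover have "(\<lambda>i. \<Lambda> m * G i m) \<longlonglongrightarrow> \<Lambda> m * (v - w)"
      using tendsto_mult_left[OF end_m, of "\<Lambda> m"] ends(1) Lim_g by (cases "l m = 0") auto
    ultimately have x'_lim: "(\<lambda>i. integral {m..M} (\<lambda>x. \<Lambda> x * G' i x)) \<longlonglongrightarrow>
        \<Lambda> M * g M - \<Lambda> m * (v - w) - integral {m..M} (\<lambda>x. \<Lambda>' x * g x)"
      unfolding parts by (intro tendsto_diff weak \<Lambda>(2))
    have y'_eq: "\<Lambda> M * g M - \<Lambda> m * (v - w) - integral {m..M} (\<lambda>x. \<Lambda>' x * g x)
        = (LINT x:{m..M}|V.dV. \<Lambda> x) - (LINT x:{m..M}|W.dV. \<Lambda> x)"
    proof -
      have "integral {m..M} (\<lambda>x. \<Lambda>' x * g x) = integral {m..M} (\<lambda>x. \<Lambda>' x * V x) - integral {m..M} (\<lambda>x. \<Lambda>' x * W x)"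
        unfolding g_eq right_diff_distrib
        by (intro Henstock_Kurzweil_Integration.integral_diff V.integrable_mult_V W.integrable_mult_V \<Lambda>(2))
      then show ?thesis
        using V.integral_by_parts_Icc[OF \<Lambda> _ v, of M] W.integral_by_parts_Icc[OF \<Lambda> _ w, of M] \<open>m < M\<close>
        by (simp add: g_eq algebra_simps)
    qed
    have "\<bar>stieltjes_integral l g - ((LINT x:{m..M}|V.dV. \<Lambda> x) - (LINT x:{m..M}|W.dV. \<Lambda> x))\<bar> \<le> \<epsilon>"
    proof -
      note V_ints = V.set_integrable_dV[OF l_meas Bl, of m M] V.set_integrable_dV[OF \<Lambda>_meas \<Lambda>_bnd, of m M]
      note W_ints = W.set_integrable_dV[OF l_meas Bl, of m M] W.set_integrable_dV[OF \<Lambda>_meas \<Lambda>_bnd, of m M]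
      have "\<bar>(LINT x:{m..M}|V.dV. l x) - (LINT x:{m..M}|V.dV. \<Lambda> x)\<bar> \<le> \<delta> * (V M - v)"
        using V.abs_integral_le_Icc[OF set_integral_diff(1)[OF V_ints] close _ v] set_integral_diff(2)[OF V_ints] \<open>m < M\<close> by simp
      moreover have "\<bar>(LINT x:{m..M}|W.dV. l x) - (LINT x:{m..M}|W.dV. \<Lambda> x)\<bar> \<le> \<delta> * (W M - w)"
        using W.abs_integral_le_Icc[OF set_integral_diff(1)[OF W_ints] close _ w] set_integral_diff(2)[OF W_ints] \<open>m < M\<close> by simp
      moreover have "\<delta> * (V M - v) + \<delta> * (W M - w) \<le> \<epsilon>"
        unfolding distrib_left[symmetric] by (rule \<delta>_le) (use C_nonneg in \<open>simp add: K_def\<close>)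
      ultimately show ?thesis unfolding st_eq by linarith
    qed
    moreover have "\<bar>(LINT x|lborel. l x * G' i x) - integral {m..M} (\<lambda>x. \<Lambda> x * G' i x)\<bar> \<le> \<epsilon>" for i
    proof -
      have lG': "(\<lambda>x. l x * G' i x) integrable_on {m..M}" by (rule integrable_continuous_real[OF l_cont])
      have "(LINT x|lborel. l x * G' i x) - integral {m..M} (\<lambda>x. \<Lambda> x * G' i x) = integral {m..M} (\<lambda>x. l x * G' i x - \<Lambda> x * G' i x)"
        unfolding LINT_eq by (rule Henstock_Kurzweil_Integration.integral_diff[symmetric, OF lG' \<Lambda>G'_int])
      also have "norm \<dots> \<le> integral {m..M} (\<lambda>x. \<delta> * \<bar>G' i x\<bar>)"
      proof (rule integral_norm_bound_integral)
        show "norm (l x * G' i x - \<Lambda> x * G' i x) \<le> \<delta> * \<bar>G' i x\<bar>" if "x \<in> {m..M}" for x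
          using mult_right_mono[OF close[OF that], of "\<bar>G' i x\<bar>"] by (simp add: abs_mult flip: left_diff_distrib)
        show "(\<lambda>x. \<delta> * \<bar>G' i x\<bar>) integrable_on {m..M}"
          by (intro integrable_on_mult_right G'_abs)
      qed (intro Henstock_Kurzweil_Integration.integrable_diff lG' \<Lambda>G'_int)
      also have "\<dots> = \<delta> * integral {m..M} (\<lambda>x. \<bar>G' i x\<bar>)" by simp
      also have "\<dots> \<le> \<epsilon>"
        by (rule \<delta>_le) (use C[of i] V_mass in \<open>simp add: K_def\<close>)
      finally show ?thesis by simp
    qed
    ultimately show "\<exists>x' y'. x' \<longlonglongrightarrow> y' \<and> \<bar>stieltjes_integral l g - y'\<bar> \<le> \<epsilon> \<and>
        (\<forall>\<^sub>F i in sequentially. \<bar>(LINT x|lborel. l x * G' i x) - x' i\<bar> \<le> \<epsilon>)"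
      using x'_lim unfolding y'_eq by (intro exI conjI) (assumption | rule always_eventually | simp)+
  qed
qed

text \<open>
  The conditions on a tame sequence provide the variation bound and the end point limits needed
  in \<open>stieltjes_integral_limit\<close> for the derivatives of order \<open>Suc r\<close>. Convergence of their
  integrals over intervals is convergence of increments of the derivatives of order \<open>r\<close>.
\<close>

lemma tame_integrals_converge:
  assumes f: "C_k r f" and weak: "is_weak_derivative ((deriv ^^ r) f) g"
    and rc: "right_continuous g" and bv: "bounded_variation g" and "m < M"
    and l: "continuous_on {m..M} l" and l0: "\<And>x. x \<notin> {m..M} \<Longrightarrow> l x = 0"
    and F: "F \<in> tame_sequences (Suc (Suc r)) l m M g" and approx: "smooth_approximation f F"
  shows "(\<lambda>i. LINT x|lborel. l x * (deriv ^^ Suc (Suc r)) (F i) x) \<longlonglongrightarrow> stieltjes_integral l g"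
proof -
  have smooth: "C_infinity (F i)" and lim: "(\<lambda>i. F i x) \<longlonglongrightarrow> f x" for i x
    using approx by (auto simp: smooth_approximation_def)
  note F_deriv = C_infinity_has_derivative[OF smooth]
  have H: "continuous_on UNIV ((deriv ^^ r) f)" using f by (simp add: C_k_def)
  have cont: "continuous_on A (\<lambda>x. \<bar>(deriv ^^ k) (F i) x\<bar>)" for A k i
    by (intro continuous_on_rabs C_infinity_continuous[OF smooth])
  have total: "\<exists>C. \<forall>i. integral {a..b} (\<lambda>x. \<bar>(deriv ^^ Suc (Suc r)) (F i) x\<bar>) \<le> C" for a b
  proof -
    have "(LINT x:{a..b}|lborel. \<bar>(deriv ^^ Suc (Suc r)) (F i) x\<bar>) = integral {a..b} (\<lambda>x. \<bar>(deriv ^^ Suc (Suc r)) (F i) x\<bar>)" for i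
      by (rule set_borel_integral_eq_integral(2)[OF borel_integrable_atLeastAtMost'[OF cont]])
    moreover have "\<exists>C. \<forall>i. (LINT x:{a..b}|lborel. \<bar>(deriv ^^ Suc (Suc r)) (F i) x\<bar>) \<le> C"
      using F unfolding tame_sequences_def by blast
    ultimately show ?thesis by (simp only:)
  qed
  have bounded: "\<exists>B. \<forall>j\<le>Suc r. \<forall>i. \<forall>x\<in>{a..b}. \<bar>(deriv ^^ j) (F i) x\<bar> \<le> B" if "a < b" for a b
  proof -
    obtain C where C: "\<And>i. integral {a..b} (\<lambda>x. \<bar>(deriv ^^ Suc (Suc r)) (F i) x\<bar>) \<le> C" using total by blast
    have inc: "\<bar>(deriv ^^ Suc r) (F i) y - (deriv ^^ Suc r) (F i) x\<bar> \<le> C" if "a \<le> x" "x \<le> y" "y \<le> b" for i x y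
    proof -
      have int: "((deriv ^^ Suc (Suc r)) (F i) has_integral ((deriv ^^ Suc r) (F i) y - (deriv ^^ Suc r) (F i) x)) {x..y}"
        by (rule has_integral_derivative[OF F_deriv that(2)])
      have "norm (integral {x..y} ((deriv ^^ Suc (Suc r)) (F i))) \<le> integral {x..y} (\<lambda>x. \<bar>(deriv ^^ Suc (Suc r)) (F i) x\<bar>)"
        by (rule integral_norm_bound_integral[OF has_integral_integrable[OF int] integrable_continuous_real[OF cont]]) simp
      also have "\<dots> \<le> integral {a..b} (\<lambda>x. \<bar>(deriv ^^ Suc (Suc r)) (F i) x\<bar>)"
        by (rule integral_subset_le[OF _ integrable_continuous_real[OF cont] integrable_continuous_real[OF cont]])
           (use that in auto)
      also have "\<dots> \<le> C" by (rule C)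
      finally show ?thesis using integral_unique[OF int] by simp
    qed
    show ?thesis
    proof (rule derivatives_uniformly_bounded[OF smooth \<open>a < b\<close>])
      show "\<exists>B. \<forall>i. \<bar>F i x\<bar> \<le> B" for x
        using convergent_imp_Bseq[of "\<lambda>i. F i x"] lim[of x] by (auto simp: convergent_def Bseq_def)
      show "\<bar>(deriv ^^ Suc r) (F i) x - (deriv ^^ Suc r) (F i) y\<bar> \<le> C" if "x \<in> {a..b}" "y \<in> {a..b}" for i x y
        using inc[of x y i] inc[of y x i] that by (cases "x \<le> y") (auto simp: abs_minus_commute)
    qed
  qed
  have lower: "(\<lambda>i. (deriv ^^ r) (F i) x) \<longlonglongrightarrow> (deriv ^^ r) f x" for x
    by (rule derivatives_converge[OF smooth lim f bounded]) simp_all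
  obtain C where C: "\<And>i. integral {m..M} (\<lambda>x. \<bar>(deriv ^^ Suc (Suc r)) (F i) x\<bar>) \<le> C" using total by blast
  obtain B where B: "\<forall>j\<le>Suc r. \<forall>i. \<forall>x\<in>{m..M}. \<bar>(deriv ^^ j) (F i) x\<bar> \<le> B" using bounded[OF \<open>m < M\<close>] by blast
  show ?thesis
  proof (rule stieltjes_integral_limit[OF bv rc \<open>m < M\<close> l l0 F_deriv C_infinity_continuous[OF smooth] C])
    show "\<bar>(deriv ^^ Suc r) (F i) x\<bar> \<le> B" if "x \<in> {m..M}" for i x
      using B that by blast
    show "(\<lambda>i. integral {u..v} ((deriv ^^ Suc r) (F i))) \<longlonglongrightarrow> integral {u..v} g" if "m \<le> u" "u \<le> v" "v \<le> M" for u v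
    proof (cases "u = v")
      case False
      with that have "u < v" by simp
      have "set_integrable lborel {u..v} g" using weak by (simp add: is_weak_derivative_def)
      then have "integral {u..v} g = (deriv ^^ r) f v - (deriv ^^ r) f u"
        using weak_derivative_increment[OF H weak \<open>u < v\<close>] set_borel_integral_eq_integral(2) by fastforce
      moreover have "integral {u..v} ((deriv ^^ Suc r) (F i)) = (deriv ^^ r) (F i) v - (deriv ^^ r) (F i) u" for i
        by (rule integral_unique[OF has_integral_derivative[OF F_deriv that(2)]])
      ultimately show ?thesis by (simp only: tendsto_diff lower)
    qed simp
    show "(\<lambda>i. (deriv ^^ Suc r) (F i) m) \<longlonglongrightarrow> Lim (at_left m) g" if "l m \<noteq> 0"
      using F that by (simp add: tame_sequences_def)
    show "(\<lambda>i. (deriv ^^ Suc r) (F i) M) \<longlonglongrightarrow> g M" if "l M \<noteq> 0"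
      using F that by (simp add: tame_sequences_def)
  qed
qed

section \<open>Smooth approximations with bounded variation\<close>

lemma smooth_monotone_interpolation:
  fixes \<gamma> :: "nat \<Rightarrow> real"
  assumes \<gamma>: "mono \<gamma>" and "h > 0"
  obtains v where "C_infinity v" "mono v" "\<And>k. k \<le> n \<Longrightarrow> v (a + real k * h) = \<gamma> k"
    "\<And>x. x \<le> a \<Longrightarrow> v x = \<gamma> 0" "\<And>x. a + real n * h \<le> x \<Longrightarrow> v x = \<gamma> n"
proof -
  obtain \<sigma> :: "real \<Rightarrow> real" where \<sigma>: "C_infinity \<sigma>" "mono \<sigma>"
    and \<sigma>0: "\<And>x. x \<le> 0 \<Longrightarrow> \<sigma> x = 0" and \<sigma>1: "\<And>x. 1 \<le> x \<Longrightarrow> \<sigma> x = 1"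
    using exists_smooth_step by blast
  define s where "s k x = \<sigma> ((1 / h) * x + (- a / h - real k))" for k x
  have s_eq: "s k x = \<sigma> ((x - a) / h - real k)" for k x
    using \<open>h > 0\<close> by (simp add: s_def field_simps)
  define v where "v x = \<gamma> 0 + (\<Sum>k<n. (\<gamma> (Suc k) - \<gamma> k) * s k x)" for x
  have v_top: "v x = \<gamma> j" if "\<And>k. k < j \<Longrightarrow> s k x = 1" "\<And>k. j \<le> k \<Longrightarrow> k < n \<Longrightarrow> s k x = 0" "j \<le> n" for j x
  proof -
    have "(\<Sum>k<n. (\<gamma> (Suc k) - \<gamma> k) * s k x) = (\<Sum>k<j. \<gamma> (Suc k) - \<gamma> k)"
      by (rule sum.mono_neutral_cong_right) (use that in auto)
    then show ?thesis by (simp add: v_def sum_lessThan_telescope)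
  qed
  show thesis
  proof (rule that[of v])
    show "C_infinity v"
      unfolding C_infinity_def v_def s_def
      using \<sigma>(1) by (intro allI C_k_add C_k_sum C_k_mult C_k_const C_k_affine) (auto simp: C_infinity_def)
    show "mono v"
    proof (rule monoI)
      fix x y :: real assume "x \<le> y"
      then have "s k x \<le> s k y" for k
        unfolding s_eq using \<open>h > 0\<close> by (intro monoD[OF \<sigma>(2)]) (simp add: divide_right_mono)
      moreover have "0 \<le> \<gamma> (Suc k) - \<gamma> k" for k using monoD[OF \<gamma>, of k "Suc k"] by simp
      ultimately show "v x \<le> v y"
        unfolding v_def by (intro add_left_mono sum_mono mult_left_mono)
    qed
    show "v (a + real k * h) = \<gamma> k" if "k \<le> n" for k
    proof (rule v_top[OF _ _ that])
      show "s j (a + real k * h) = 1" if "j < k" for j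
        unfolding s_eq by (rule \<sigma>1) (use that \<open>h > 0\<close> in simp)
      show "s j (a + real k * h) = 0" if "k \<le> j" for j
        unfolding s_eq by (rule \<sigma>0) (use that \<open>h > 0\<close> in simp)
    qed
    show "v x = \<gamma> 0" if "x \<le> a" for x
    proof (rule v_top)
      have "(x - a) / h \<le> 0" using that \<open>h > 0\<close> by (simp add: divide_nonpos_pos)
      then show "s j x = 0" for j
        unfolding s_eq by (intro \<sigma>0) simp
    qed auto
    show "v x = \<gamma> n" if "a + real n * h \<le> x" for x
    proof (rule v_top)
      have "real n \<le> (x - a) / h" using that \<open>h > 0\<close> by (simp add: field_simps)
      then show "s j x = 1" if "j < n" for j
        unfolding s_eq by (intro \<sigma>1) (use that in simp)
    qed auto
  qed
qed

text \<open>
  The function \<open>v i\<close> interpolates samples of \<open>V\<close> on a grid of mesh \<open>1 / (i + 1)\<close>. Taking the samples to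
  the left of the argument below \<open>c\<close> and to the right of it above \<open>c\<close> decides which one-sided limit the
  approximations pick up at a jump of \<open>V\<close>. The two bounds without restriction on \<open>x\<close> are the uniform
  local bounds; the grid covers only \<open>[-(i + 1), i + 1]\<close>, beyond which \<open>v i\<close> is constant.
\<close>

lemma smooth_monotone_approximation:
  fixes V :: "real \<Rightarrow> real"
  assumes V: "mono V"
  obtains v :: "nat \<Rightarrow> real \<Rightarrow> real" where
    "\<And>i. C_infinity (v i)" "\<And>i. mono (v i)"
    "\<And>i x. V (min x 0 - 3) \<le> v i x" "\<And>i x. v i x \<le> V (max x 0 + 3)"
    "\<And>i x. \<bar>x\<bar> < real (Suc i) \<Longrightarrow> V (x - 3 / real (Suc i)) \<le> v i x"
    "\<And>i x. \<bar>x\<bar> < real (Suc i) \<Longrightarrow> v i x \<le> V (x + 3 / real (Suc i))"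
    "\<And>i x. \<bar>x\<bar> < real (Suc i) \<Longrightarrow> x + 1 / real (Suc i) < c \<Longrightarrow> v i x \<le> V (x - 1 / real (Suc i))"
    "\<And>i x. \<bar>x\<bar> < real (Suc i) \<Longrightarrow> c \<le> x - 1 / real (Suc i) \<Longrightarrow> V x \<le> v i x"
proof -
  have "\<exists>v. C_infinity v \<and> mono v \<and> (\<forall>x. V (min x 0 - 3) \<le> v x \<and> v x \<le> V (max x 0 + 3)) \<and>
    (\<forall>x. \<bar>x\<bar> < real (Suc i) \<longrightarrow> V (x - 3 / real (Suc i)) \<le> v x \<and> v x \<le> V (x + 3 / real (Suc i)) \<and>
      (x + 1 / real (Suc i) < c \<longrightarrow> v x \<le> V (x - 1 / real (Suc i))) \<and>
      (c \<le> x - 1 / real (Suc i) \<longrightarrow> V x \<le> v x))" for i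
  proof -
    define R where "R = real (Suc i)"
    define h where "h = 1 / R"
    define N where "N = 2 * Suc i * Suc i"
    have R: "R \<ge> 1" by (simp add: R_def)
    then have h: "0 < h" "h \<le> 1" by (auto simp: h_def)
    have N: "- R + real N * h = R" by (simp add: N_def h_def R_def field_simps)
    define xx where "xx k = - R + real k * h" for k
    have xx_Suc: "xx (Suc k) = xx k + h" for k by (simp add: xx_def algebra_simps)
    have xx_mono: "xx j \<le> xx k" if "j \<le> k" for j k using that h by (simp add: xx_def mult_right_mono)
    \<comment> \<open>The interpolation at \<open>x\<close> lies between the samples at the two adjacent grid points. Two steps to the
      left bring the upper one strictly to the left of \<open>x\<close>; one step to the right brings the lower one
      to the right of \<open>x\<close>. The sampling points increase with \<open>k\<close>, also across \<open>c\<close>.\<close>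
    define \<gamma> where "\<gamma> k = (if xx k < c then V (xx k - 2 * h) else V (xx k + h))" for k
    have \<gamma>_lower: "V (xx k - 2 * h) \<le> \<gamma> k" and \<gamma>_upper: "\<gamma> k \<le> V (xx k + h)" for k
      using monoD[OF V, of "xx k - 2 * h" "xx k + h"] h by (auto simp: \<gamma>_def)
    have "mono \<gamma>"
    proof (rule monoI)
      fix j k :: nat assume "j \<le> k"
      from xx_mono[OF this] show "\<gamma> j \<le> \<gamma> k"
        unfolding \<gamma>_def using h by (auto intro!: monoD[OF V])
    qed
    obtain v where v: "C_infinity v" "mono v" "\<And>k. k \<le> N \<Longrightarrow> v (xx k) = \<gamma> k"
      "\<And>x. x \<le> - R \<Longrightarrow> v x = \<gamma> 0" "\<And>x. R \<le> x \<Longrightarrow> v x = \<gamma> N"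
      using smooth_monotone_interpolation[OF \<open>mono \<gamma>\<close> h(1), of N "- R"] unfolding xx_def[symmetric] N[folded xx_def]
      by blast
    have inner: "V (x - 3 * h) \<le> v x \<and> v x \<le> V (x + 3 * h) \<and> (x + h < c \<longrightarrow> v x \<le> V (x - h)) \<and> (c \<le> x - h \<longrightarrow> V x \<le> v x)"
      if "\<bar>x\<bar> < R" for x
    proof -
      define j where "j = nat \<lfloor>(x + R) / h\<rfloor>"
      have "0 \<le> (x + R) / h" using that h by simp
      then have "real j \<le> (x + R) / h" "(x + R) / h < real j + 1"
        unfolding j_def by linarith+
      then have j: "xx j \<le> x" "x < xx (Suc j)" using h by (auto simp: xx_def field_simps)
      have "xx j < xx N" using j(1) that N by (simp add: xx_def)
      then have "j < N" using xx_mono[of N j] by (meson leD leI)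
      then have "v (xx j) = \<gamma> j" "v (xx (Suc j)) = \<gamma> (Suc j)" by (auto intro!: v(3))
      then have lower: "\<gamma> j \<le> v x" and upper: "v x \<le> \<gamma> (Suc j)"
        using monoD[OF v(2), of "xx j" x] monoD[OF v(2), of x "xx (Suc j)"] j by auto
      have "V (x - 3 * h) \<le> V (xx j - 2 * h)" using j xx_Suc[of j] by (intro monoD[OF V]) linarith
      moreover have "V (xx (Suc j) + h) \<le> V (x + 3 * h)" using j xx_Suc[of j] h by (intro monoD[OF V]) linarith
      moreover have "v x \<le> V (x - h)" if "x + h < c"
      proof -
        have "xx (Suc j) < c" using that j xx_Suc[of j] by linarith
        then have "\<gamma> (Suc j) = V (xx (Suc j) - 2 * h)" by (simp add: \<gamma>_def)
        also have "\<dots> \<le> V (x - h)" using j xx_Suc[of j] by (intro monoD[OF V]) linarith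
        finally show ?thesis using upper by linarith
      qed
      moreover have "V x \<le> v x" if "c \<le> x - h"
      proof -
        have "\<not> xx j < c" using that j xx_Suc[of j] by linarith
        then have "\<gamma> j = V (xx j + h)" by (simp add: \<gamma>_def)
        moreover have "V x \<le> V (xx j + h)" using j xx_Suc[of j] by (intro monoD[OF V]) linarith
        ultimately show ?thesis using lower by linarith
      qed
      ultimately show ?thesis using lower upper \<gamma>_lower[of j] \<gamma>_upper[of "Suc j"] by auto
    qed
    have "V (min x 0 - 3) \<le> v x \<and> v x \<le> V (max x 0 + 3)" for x
    proof -
      consider "\<bar>x\<bar> < R" | "x \<le> - R" | "R \<le> x" by linarith
      then show ?thesis
      proof cases
        case 1
        have "V (min x 0 - 3) \<le> V (x - 3 * h)" "V (x + 3 * h) \<le> V (max x 0 + 3)"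
          using h by (auto intro!: monoD[OF V])
        with inner[OF 1] show ?thesis by linarith
      next
        case 2
        have "V (min x 0 - 3) \<le> V (xx 0 - 2 * h)" "V (xx 0 + h) \<le> V (max x 0 + 3)"
          using h R 2 by (auto intro!: monoD[OF V] simp: xx_def)
        with \<gamma>_lower[of 0] \<gamma>_upper[of 0] v(4)[OF 2] show ?thesis by linarith
      next
        case 3
        have "V (min x 0 - 3) \<le> V (xx N - 2 * h)" "V (xx N + h) \<le> V (max x 0 + 3)"
          using h R 3 N by (auto intro!: monoD[OF V] simp: xx_def)
        with \<gamma>_lower[of N] \<gamma>_upper[of N] v(5)[OF 3] show ?thesis by linarith
      qed
    qed
    moreover have h_eq: "3 / R = 3 * h" "1 / R = h" by (simp_all add: h_def)
    ultimately show ?thesis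
      unfolding R_def[symmetric] h_eq using v(1,2) inner by (intro exI[of _ v]) blast
  qed
  then obtain v where "\<And>i. C_infinity (v i) \<and> mono (v i) \<and> (\<forall>x. V (min x 0 - 3) \<le> v i x \<and> v i x \<le> V (max x 0 + 3)) \<and>
    (\<forall>x. \<bar>x\<bar> < real (Suc i) \<longrightarrow> V (x - 3 / real (Suc i)) \<le> v i x \<and> v i x \<le> V (x + 3 / real (Suc i)) \<and>
      (x + 1 / real (Suc i) < c \<longrightarrow> v i x \<le> V (x - 1 / real (Suc i))) \<and>
      (c \<le> x - 1 / real (Suc i) \<longrightarrow> V x \<le> v i x))"
    by metis
  then show thesis by (intro that[of v]) blast+
qed

lemma add_divide_Suc_LIMSEQ:
  "(\<lambda>i. x + C / real (Suc i)) \<longlonglongrightarrow> x"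
proof -
  have "(\<lambda>i. x + C * inverse (real (Suc i))) \<longlonglongrightarrow> x + C * 0"
    by (intro tendsto_intros LIMSEQ_inverse_real_of_nat)
  then show ?thesis by (simp add: divide_inverse)
qed

text \<open>
  The threshold between samples on the left and on the right is the midpoint of \<open>m\<close> and \<open>M\<close>; so \<open>m\<close>
  sees the left limit of \<open>V\<close>, and \<open>M\<close> sees its value.
\<close>

lemma smooth_monotone_approximation_limits:
  fixes V :: "real \<Rightarrow> real"
  assumes V: "mono V" and rc: "continuous (at_right M) V" and vm: "(V \<longlongrightarrow> vm) (at_left m)" and "m < M"
  obtains v :: "nat \<Rightarrow> real \<Rightarrow> real" where
    "\<And>i. C_infinity (v i)" "\<And>i. mono (v i)"
    "\<And>i x. V (min x 0 - 3) \<le> v i x" "\<And>i x. v i x \<le> V (max x 0 + 3)"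
    "\<And>x. isCont V x \<Longrightarrow> (\<lambda>i. v i x) \<longlonglongrightarrow> V x"
    "(\<lambda>i. v i m) \<longlonglongrightarrow> vm" "(\<lambda>i. v i M) \<longlonglongrightarrow> V M"
proof -
  define c where "c = (m + M) / 2"
  have c: "m < c" "c < M" using \<open>m < M\<close> by (auto simp: c_def)
  obtain v where v: "\<And>i. C_infinity (v i)" "\<And>i. mono (v i)"
    "\<And>i x. V (min x 0 - 3) \<le> v i x" "\<And>i x. v i x \<le> V (max x 0 + 3)"
    and low: "\<And>i x. \<bar>x\<bar> < real (Suc i) \<Longrightarrow> V (x - 3 / real (Suc i)) \<le> v i x"
    and up: "\<And>i x. \<bar>x\<bar> < real (Suc i) \<Longrightarrow> v i x \<le> V (x + 3 / real (Suc i))"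
    and left: "\<And>i x. \<bar>x\<bar> < real (Suc i) \<Longrightarrow> x + 1 / real (Suc i) < c \<Longrightarrow> v i x \<le> V (x - 1 / real (Suc i))"
    and right: "\<And>i x. \<bar>x\<bar> < real (Suc i) \<Longrightarrow> c \<le> x - 1 / real (Suc i) \<Longrightarrow> V x \<le> v i x"
    using smooth_monotone_approximation[OF V, of c] by blast
  have ev: "\<forall>\<^sub>F i in sequentially. \<bar>x\<bar> < real (Suc i)" for x
  proof -
    obtain n where "\<bar>x\<bar> < real n" using reals_Archimedean2 by blast
    then show ?thesis unfolding eventually_sequentially by (intro exI[of _ n]) auto
  qed
  note shift = add_divide_Suc_LIMSEQ
  have shift': "(\<lambda>i. x - C / real (Suc i)) \<longlonglongrightarrow> x" for x C
    using shift[of x "- C"] by simp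
  show thesis
  proof (rule that[OF v])
    fix x assume "isCont V x"
    from isCont_tendsto_compose[OF this shift'] isCont_tendsto_compose[OF this shift]
    have "(\<lambda>i. V (x - 3 / real (Suc i))) \<longlonglongrightarrow> V x" "(\<lambda>i. V (x + 3 / real (Suc i))) \<longlonglongrightarrow> V x"
      by blast+
    then show "(\<lambda>i. v i x) \<longlonglongrightarrow> V x"
      by (rule real_tendsto_sandwich[rotated 2]) (use ev[of x] in \<open>auto elim!: eventually_mono intro: low up simp del: of_nat_Suc\<close>)
  next
    have fl: "filterlim (\<lambda>i. m - C / real (Suc i)) (at_left m) sequentially" if "C > 0" for C
      by (rule tendsto_imp_filterlim_at_left[OF shift']) (use that in auto)
    have "(\<lambda>i. V (m - 3 / real (Suc i))) \<longlonglongrightarrow> vm" "(\<lambda>i. V (m - 1 / real (Suc i))) \<longlonglongrightarrow> vm"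
      by (rule filterlim_compose[OF vm fl]; simp)+
    moreover have "\<forall>\<^sub>F i in sequentially. V (m - 3 / real (Suc i)) \<le> v i m"
      using ev[of m] by eventually_elim (rule low)
    moreover have "\<forall>\<^sub>F i in sequentially. m + 1 / real (Suc i) < c"
      using order_tendstoD(2)[OF shift c(1)] .
    then have "\<forall>\<^sub>F i in sequentially. v i m \<le> V (m - 1 / real (Suc i))"
      using ev[of m] by eventually_elim (rule left)
    ultimately show "(\<lambda>i. v i m) \<longlonglongrightarrow> vm"
      by (intro real_tendsto_sandwich[of "\<lambda>i. V (m - 3 / real (Suc i))" "\<lambda>i. v i m" sequentially "\<lambda>i. V (m - 1 / real (Suc i))"])
  next
    have "filterlim (\<lambda>i. M + 3 / real (Suc i)) (at_right M) sequentially"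
      by (rule tendsto_imp_filterlim_at_right[OF shift]) auto
    moreover have "(V \<longlongrightarrow> V M) (at_right M)" using rc by (simp add: continuous_within)
    ultimately have "(\<lambda>i. V (M + 3 / real (Suc i))) \<longlonglongrightarrow> V M" by (rule filterlim_compose[rotated])
    moreover have "\<forall>\<^sub>F i in sequentially. v i M \<le> V (M + 3 / real (Suc i))"
      using ev[of M] by eventually_elim (rule up)
    moreover have "\<forall>\<^sub>F i in sequentially. c < M - 1 / real (Suc i)"
      using order_tendstoD(1)[OF shift' c(2)] .
    then have "\<forall>\<^sub>F i in sequentially. V M \<le> v i M"
      using ev[of M] by eventually_elim (rule right, simp_all)
    ultimately show "(\<lambda>i. v i M) \<longlonglongrightarrow> V M"
      by (intro real_tendsto_sandwich[of "\<lambda>i. V M" "\<lambda>i. v i M" sequentially "\<lambda>i. V (M + 3 / real (Suc i))"]) auto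
  qed
qed

lemma exists_iterated_antiderivative:
  "C_infinity G \<Longrightarrow> \<exists>F. C_infinity F \<and> (deriv ^^ q) F = G \<and> (\<forall>j<q. (deriv ^^ j) F 0 = a j)"
proof (induction q arbitrary: a)
  case (Suc q)
  obtain F' where F': "C_infinity F'" "(deriv ^^ q) F' = G" "\<And>j. j < q \<Longrightarrow> (deriv ^^ j) F' 0 = a (Suc j)"
    using Suc.IH[OF Suc.prems, of "\<lambda>j. a (Suc j)"] by blast
  obtain F where F: "\<And>x. (F has_real_derivative F' x) (at x)" "F 0 = a 0"
    using exists_antiderivative[of F' "a 0"] C_infinity_continuous[OF F'(1), of UNIV 0] by auto
  have deriv_F: "deriv F = F'" using F(1) by (auto intro: DERIV_imp_deriv)
  have step: "(deriv ^^ Suc j) F = (deriv ^^ j) F'" for j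
    by (simp add: funpow_Suc_right deriv_F del: funpow.simps)
  have "(deriv ^^ j) F 0 = a j" if "j < Suc q" for j
  proof (cases j)
    case (Suc k)
    with that F'(3)[of k] show ?thesis by (simp only: step)
  qed (simp add: F)
  then show ?case
    using C_infinity_antiderivative[OF F(1) F'(1)] step[of q] F'(2) by blast
qed auto

lemma antiderivative_LIMSEQ:
  fixes A A' :: "nat \<Rightarrow> real \<Rightarrow> real"
  assumes A: "\<And>i x. (A i has_real_derivative A' i x) (at x)" and A0: "\<And>i. A i 0 = \<alpha> 0"
    and lim: "\<And>u v. u < v \<Longrightarrow> (\<lambda>i. integral {u..v} (A' i)) \<longlonglongrightarrow> \<alpha> v - \<alpha> u"
  shows "(\<lambda>i. A i x) \<longlonglongrightarrow> \<alpha> x"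
proof -
  have inc: "integral {u..v} (A' i) = A i v - A i u" if "u \<le> v" for u v i
    using has_integral_derivative[OF A that] by (rule integral_unique)
  consider "x < 0" | "x = 0" | "x > 0" by linarith
  then show ?thesis
  proof cases
    case 1
    have "(\<lambda>i. A i 0 - integral {x..0} (A' i)) \<longlonglongrightarrow> \<alpha> 0 - (\<alpha> 0 - \<alpha> x)"
      unfolding A0 by (intro tendsto_diff tendsto_const lim 1)
    then show ?thesis using 1 by (simp add: inc)
  next
    case 2
    then show ?thesis by (simp add: A0)
  next
    case 3
    have "(\<lambda>i. A i 0 + integral {0..x} (A' i)) \<longlonglongrightarrow> \<alpha> 0 + (\<alpha> x - \<alpha> 0)"
      unfolding A0 by (intro tendsto_add tendsto_const lim 3)
    then show ?thesis using 3 by (simp add: inc)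
  qed
qed

lemma antiderivative_bounded:
  fixes A A' :: "real \<Rightarrow> real"
  assumes "\<And>x. (A has_real_derivative A' x) (at x)" "\<And>x. \<bar>x\<bar> \<le> R \<Longrightarrow> \<bar>A' x\<bar> \<le> B" "\<bar>x\<bar> \<le> R"
  shows "\<bar>A x\<bar> \<le> \<bar>A 0\<bar> + B * R"
proof -
  have "norm (A x - A 0) \<le> B * norm (x - 0)"
  proof (rule field_differentiable_bound[of "{-R..R}"])
    show "(A has_real_derivative A' z) (at z within {-R..R})" for z
      by (rule has_field_derivative_at_within[OF assms(1)])
  qed (use assms in auto)
  also have "\<dots> \<le> B * R"
    using assms(2)[of x] assms(3) by (intro mult_left_mono) auto
  finally show ?thesis by simp
qed

text \<open>
  The derivatives \<open>G i\<close> of order \<open>Suc r\<close> are differences of monotone smooth approximations of the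
  two monotone parts of \<open>g\<close>, so their variation is at most the sum of two increments. Repeated
  integration from \<open>0\<close>, with the initial values of \<open>f\<close>, gives \<open>F i\<close>; convergence descends from order
  \<open>Suc j\<close> to order \<open>j\<close> by dominated convergence of the integrals.
\<close>

lemma exists_tame_approximation:
  assumes f: "C_k r f" and weak: "is_weak_derivative ((deriv ^^ r) f) g"
    and rc: "right_continuous g" and bv: "bounded_variation g" and "m < M"
  obtains F :: "nat \<Rightarrow> real \<Rightarrow> real" where "smooth_approximation f F"
    "\<And>a b. \<exists>C. \<forall>i. (LINT x:{a..b}|lborel. \<bar>(deriv ^^ Suc (Suc r)) (F i) x\<bar>) \<le> C"
    "(\<lambda>i. (deriv ^^ Suc r) (F i) m) \<longlonglongrightarrow> Lim (at_left m) g"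
    "(\<lambda>i. (deriv ^^ Suc r) (F i) M) \<longlonglongrightarrow> g M"
proof -
  define V where "V = signed_variation g"
  define W where "W = (\<lambda>x. signed_variation g x - g x)"
  have g_eq: "g x = V x - W x" for x by (simp add: V_def W_def)
  have mono: "mono V" "mono W" unfolding V_def W_def by (rule mono_signed_variation[OF bv])+
  have V_rc: "continuous (at_right x) V" for x
    unfolding V_def by (rule right_continuous_signed_variation[OF bv rc])
  have W_rc: "continuous (at_right x) W" for x
    using rc V_rc[of x] unfolding W_def V_def right_continuous_def by (intro continuous_diff) auto
  interpret V: stieltjes_integrator V by unfold_locales (use mono V_rc in auto)
  interpret W: stieltjes_integrator W by unfold_locales (use mono W_rc in auto)
  obtain v where v: "(V \<longlongrightarrow> v) (at_left m)" using V.left_limit_exists by blast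
  obtain w where w: "(W \<longlongrightarrow> w) (at_left m)" using W.left_limit_exists by blast
  have "(g \<longlongrightarrow> v - w) (at_left m)"
    using tendsto_diff[OF v w] by (simp add: g_eq[symmetric])
  then have Lim_g: "Lim (at_left m) g = v - w" by (intro tendsto_Lim) simp_all
  obtain Vs where Vs: "\<And>i. C_infinity (Vs i)" "\<And>i. mono (Vs i)"
    "\<And>i x. V (min x 0 - 3) \<le> Vs i x" "\<And>i x. Vs i x \<le> V (max x 0 + 3)"
    "\<And>x. isCont V x \<Longrightarrow> (\<lambda>i. Vs i x) \<longlonglongrightarrow> V x"
    "(\<lambda>i. Vs i m) \<longlonglongrightarrow> v" "(\<lambda>i. Vs i M) \<longlonglongrightarrow> V M"
    using smooth_monotone_approximation_limits[OF mono(1) V_rc v \<open>m < M\<close>] by blast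
  obtain Ws where Ws: "\<And>i. C_infinity (Ws i)" "\<And>i. mono (Ws i)"
    "\<And>i x. W (min x 0 - 3) \<le> Ws i x" "\<And>i x. Ws i x \<le> W (max x 0 + 3)"
    "\<And>x. isCont W x \<Longrightarrow> (\<lambda>i. Ws i x) \<longlonglongrightarrow> W x"
    "(\<lambda>i. Ws i m) \<longlonglongrightarrow> w" "(\<lambda>i. Ws i M) \<longlonglongrightarrow> W M"
    using smooth_monotone_approximation_limits[OF mono(2) W_rc w \<open>m < M\<close>] by blast
  define G where "G i x = Vs i x - Ws i x" for i x
  define Bd where "Bd R = \<bar>V (- R - 3)\<bar> + \<bar>V (R + 3)\<bar> + (\<bar>W (- R - 3)\<bar> + \<bar>W (R + 3)\<bar>)" for R
  have G_bnd: "\<bar>G i x\<bar> \<le> Bd R" if "\<bar>x\<bar> \<le> R" for i x R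
  proof -
    have "V (- R - 3) \<le> V (min x 0 - 3)" "V (max x 0 + 3) \<le> V (R + 3)"
      "W (- R - 3) \<le> W (min x 0 - 3)" "W (max x 0 + 3) \<le> W (R + 3)"
      using that by (auto intro!: monoD[OF mono(1)] monoD[OF mono(2)])
    then show ?thesis
      using Vs(3)[of x i] Vs(4)[of i x] Ws(3)[of x i] Ws(4)[of i x] unfolding G_def Bd_def by linarith
  qed
  have G_smooth: "C_infinity (G i)" for i
    unfolding G_def by (intro C_infinity_diff Vs Ws)
  have "\<exists>F. C_infinity F \<and> (deriv ^^ Suc r) F = G i \<and> (\<forall>j<Suc r. (deriv ^^ j) F 0 = (deriv ^^ j) f 0)" for i
    by (rule exists_iterated_antiderivative[OF G_smooth])
  then obtain F where F: "\<And>i. C_infinity (F i)" "\<And>i. (deriv ^^ Suc r) (F i) = G i"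
    "\<And>i j. j < Suc r \<Longrightarrow> (deriv ^^ j) (F i) 0 = (deriv ^^ j) f 0"
    by metis
  note F_deriv = C_infinity_has_derivative[OF F(1)]
  have H: "continuous_on UNIV ((deriv ^^ r) f)" using f by (simp add: C_k_def)
  have converge: "(\<forall>x. (\<lambda>i. (deriv ^^ j) (F i) x) \<longlonglongrightarrow> (deriv ^^ j) f x) \<and>
      (\<forall>R. \<exists>B. \<forall>i x. \<bar>x\<bar> \<le> R \<longrightarrow> \<bar>(deriv ^^ j) (F i) x\<bar> \<le> B)" if "j \<le> r" for j
    using that
  proof (induction rule: inc_induct)
    case base
    have "(\<lambda>i. (deriv ^^ r) (F i) x) \<longlonglongrightarrow> (deriv ^^ r) f x" for x
    proof (rule antiderivative_LIMSEQ[OF F_deriv])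
      show "(deriv ^^ r) (F i) 0 = (deriv ^^ r) f 0" for i by (rule F(3)) simp
      fix u v' :: real assume "u < v'"
      define R where "R = max \<bar>u\<bar> \<bar>v'\<bar>"
      have "(\<lambda>i. LINT x|lborel. indicator {u..v'} x *\<^sub>R G i x) \<longlonglongrightarrow> (LINT x|lborel. indicator {u..v'} x *\<^sub>R g x)"
      proof (rule integral_dominated_convergence)
        have "g = (\<lambda>x. V x - W x)" using g_eq by auto
        then have "g \<in> borel_measurable borel"
          using borel_measurable_diff[OF borel_measurable_mono[OF mono(1)] borel_measurable_mono[OF mono(2)]] by simp
        then show "(\<lambda>x. indicator {u..v'} x *\<^sub>R g x) \<in> borel_measurable lborel" by simp
        show "(\<lambda>x. indicator {u..v'} x *\<^sub>R G i x) \<in> borel_measurable lborel" for i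
          using borel_measurable_continuous_onI[OF C_infinity_continuous[OF G_smooth, of _ 0]] by simp
        show "integrable lborel (\<lambda>x. indicator {u..v'} x *\<^sub>R Bd R)"
          using borel_integrable_atLeastAtMost'[of u v' "\<lambda>_. Bd R"] by (simp add: set_integrable_def)
        show "AE x in lborel. norm (indicator {u..v'} x *\<^sub>R G i x) \<le> indicator {u..v'} x *\<^sub>R Bd R" for i
          using G_bnd[of _ R i] by (intro AE_I2) (auto simp: indicator_def R_def)
        \<comment> \<open>The approximations may fail to converge only at the jumps of the monotone parts.\<close>
        have "AE x in lborel. x \<notin> {x. \<not> isCont V x} \<union> {x. \<not> isCont W x}"
          by (intro AE_not_in countable_imp_null_set_lborel countable_Un mono_ctble_discont mono)
        then show "AE x in lborel. (\<lambda>i. indicator {u..v'} x *\<^sub>R G i x) \<longlonglongrightarrow> indicator {u..v'} x *\<^sub>R g x"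
        proof eventually_elim
          case (elim x)
          then show ?case unfolding G_def g_eq by (intro tendsto_intros Vs(5) Ws(5)) auto
        qed
      qed
      moreover have "(LINT x|lborel. indicator {u..v'} x *\<^sub>R G i x) = integral {u..v'} (G i)" for i
        using set_borel_integral_eq_integral(2)[OF borel_integrable_atLeastAtMost'[of u v' "G i"]]
          C_infinity_continuous[OF G_smooth, of _ 0] by (simp add: set_lebesgue_integral_def)
      moreover have "(LINT x|lborel. indicator {u..v'} x *\<^sub>R g x) = (deriv ^^ r) f v' - (deriv ^^ r) f u"
        using weak_derivative_increment[OF H weak \<open>u < v'\<close>] by (simp add: set_lebesgue_integral_def)
      ultimately show "(\<lambda>i. integral {u..v'} ((deriv ^^ Suc r) (F i))) \<longlonglongrightarrow> (deriv ^^ r) f v' - (deriv ^^ r) f u"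
        unfolding F(2) by simp
    qed
    moreover have "\<bar>(deriv ^^ r) (F i) x\<bar> \<le> \<bar>(deriv ^^ r) f 0\<bar> + Bd R * R" if "\<bar>x\<bar> \<le> R" for R i x
      using antiderivative_bounded[OF F_deriv[of r i], of R "Bd R" x] G_bnd that F(3)[of r i] unfolding F(2) by simp
    ultimately show ?case by blast
  next
    case (step j)
    then have IH: "\<And>x. (\<lambda>i. (deriv ^^ Suc j) (F i) x) \<longlonglongrightarrow> (deriv ^^ Suc j) f x"
      "\<And>R. \<exists>B. \<forall>i x. \<bar>x\<bar> \<le> R \<longrightarrow> \<bar>(deriv ^^ Suc j) (F i) x\<bar> \<le> B" by blast+
    have f_deriv: "((deriv ^^ j) f has_real_derivative (deriv ^^ Suc j) f x) (at x)" for x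
      using f step(2) by (simp add: C_k_def DERIV_deriv_iff_real_differentiable)
    have "(\<lambda>i. (deriv ^^ j) (F i) x) \<longlonglongrightarrow> (deriv ^^ j) f x" for x
    proof (rule antiderivative_LIMSEQ[OF F_deriv])
      show "(deriv ^^ j) (F i) 0 = (deriv ^^ j) f 0" for i by (rule F(3)) (use step in simp)
      fix u v' :: real assume "u < v'"
      obtain B where B: "\<And>i x. \<bar>x\<bar> \<le> max \<bar>u\<bar> \<bar>v'\<bar> \<Longrightarrow> \<bar>(deriv ^^ Suc j) (F i) x\<bar> \<le> B"
        using IH(2) by blast
      have "(\<lambda>i. integral {u..v'} ((deriv ^^ Suc j) (F i))) \<longlonglongrightarrow> integral {u..v'} ((deriv ^^ Suc j) f)"
      proof (rule dominated_convergence(2)[where h = "\<lambda>_. B"])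
        show "(deriv ^^ Suc j) (F i) integrable_on {u..v'}" for i
          by (rule integrable_continuous_real[OF C_infinity_continuous[OF F(1)]])
        show "norm ((deriv ^^ Suc j) (F i) x) \<le> B" if "x \<in> {u..v'}" for i x
        proof -
          have "\<bar>x\<bar> \<le> max \<bar>u\<bar> \<bar>v'\<bar>" using that by (simp add: le_max_iff_disj) linarith
          from B[OF this] show ?thesis by simp
        qed
      qed (use IH(1) in auto)
      also have "integral {u..v'} ((deriv ^^ Suc j) f) = (deriv ^^ j) f v' - (deriv ^^ j) f u"
        using has_integral_derivative[OF f_deriv, of u v'] \<open>u < v'\<close> by (simp add: integral_unique)
      finally show "(\<lambda>i. integral {u..v'} ((deriv ^^ Suc j) (F i))) \<longlonglongrightarrow> (deriv ^^ j) f v' - (deriv ^^ j) f u" .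
    qed
    moreover have "\<exists>B. \<forall>i x. \<bar>x\<bar> \<le> R \<longrightarrow> \<bar>(deriv ^^ j) (F i) x\<bar> \<le> B" for R
    proof -
      obtain B where "\<forall>i x. \<bar>x\<bar> \<le> R \<longrightarrow> \<bar>(deriv ^^ Suc j) (F i) x\<bar> \<le> B" using IH(2) by blast
      then have "\<bar>(deriv ^^ j) (F i) x\<bar> \<le> \<bar>(deriv ^^ j) (F i) 0\<bar> + B * R" if "\<bar>x\<bar> \<le> R" for i x
        using antiderivative_bounded[OF F_deriv[of j i], of R B x] that by blast
      then show ?thesis using F(3)[of j] step(2) by auto
    qed
    ultimately show ?case by blast
  qed
  show thesis
  proof (rule that[of F])
    show "smooth_approximation f F"
      using converge[of 0] F(1) by (simp add: smooth_approximation_def)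
    show "(\<lambda>i. (deriv ^^ Suc r) (F i) m) \<longlonglongrightarrow> Lim (at_left m) g"
      unfolding F(2) Lim_g G_def by (intro tendsto_diff Vs Ws)
    show "(\<lambda>i. (deriv ^^ Suc r) (F i) M) \<longlonglongrightarrow> g M"
      unfolding F(2) g_eq G_def by (intro tendsto_diff Vs Ws)
    fix a b :: real
    show "\<exists>C. \<forall>i. (LINT x:{a..b}|lborel. \<bar>(deriv ^^ Suc (Suc r)) (F i) x\<bar>) \<le> C"
    proof (cases "a \<le> b")
      case True
      define C where "C = V (max b 0 + 3) - V (min a 0 - 3) + (W (max b 0 + 3) - W (min a 0 - 3))"
      have "(LINT x:{a..b}|lborel. \<bar>(deriv ^^ Suc (Suc r)) (F i) x\<bar>) \<le> C" for i
      proof -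
        have dV: "(Vs i has_real_derivative deriv (Vs i) x) (at x)" and dW: "(Ws i has_real_derivative deriv (Ws i) x) (at x)" for x
          using C_infinity_has_derivative[OF Vs(1), of 0 i] C_infinity_has_derivative[OF Ws(1), of 0 i] by auto
        have "(deriv ^^ Suc (Suc r)) (F i) x = deriv (Vs i) x - deriv (Ws i) x" for x
        proof -
          have "(deriv ^^ Suc (Suc r)) (F i) x = deriv (G i) x" using F(2)[of i] by simp
          also have "\<dots> = deriv (Vs i) x - deriv (Ws i) x"
            unfolding G_def by (intro DERIV_imp_deriv DERIV_diff dV dW)
          finally show ?thesis .
        qed
        moreover have "0 \<le> deriv (Vs i) x" "0 \<le> deriv (Ws i) x" for x
          using mono_on_imp_deriv_nonneg[OF _ dV, of UNIV] mono_on_imp_deriv_nonneg[OF _ dW, of UNIV] Vs(2)[of i] Ws(2)[of i]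
          by (simp_all add: mono_on_def mono_def)
        ultimately have le: "\<bar>(deriv ^^ Suc (Suc r)) (F i) x\<bar> \<le> deriv (Vs i) x + deriv (Ws i) x" for x
          by (metis abs_of_nonneg abs_triangle_ineq4)
        have int: "((\<lambda>x. deriv (Vs i) x + deriv (Ws i) x) has_integral (Vs i b + Ws i b - (Vs i a + Ws i a))) {a..b}"
          by (rule has_integral_derivative[OF DERIV_add[OF dV dW] True])
        have cont: "continuous_on {a..b} (\<lambda>x. \<bar>(deriv ^^ Suc (Suc r)) (F i) x\<bar>)"
          by (intro continuous_on_rabs C_infinity_continuous[OF F(1)])
        have "(LINT x:{a..b}|lborel. \<bar>(deriv ^^ Suc (Suc r)) (F i) x\<bar>) = integral {a..b} (\<lambda>x. \<bar>(deriv ^^ Suc (Suc r)) (F i) x\<bar>)"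
          by (rule set_borel_integral_eq_integral(2)[OF borel_integrable_atLeastAtMost'[OF cont]])
        also have "\<dots> \<le> integral {a..b} (\<lambda>x. deriv (Vs i) x + deriv (Ws i) x)"
          by (rule integral_le[OF integrable_continuous_real[OF cont] has_integral_integrable[OF int] le])
        also have "\<dots> \<le> C"
          using integral_unique[OF int] Vs(3)[of a i] Vs(4)[of i b] Ws(3)[of a i] Ws(4)[of i b] unfolding C_def by linarith
        finally show ?thesis .
      qed
      then show ?thesis by blast
    qed (auto simp: set_lebesgue_integral_def)
  qed
qed

section \<open>The change of variable formula\<close>

lemma has_iterated_limit_unique:
  assumes "has_iterated_limit s J" "has_iterated_limit s K"
  shows "J = K"
proof -
  obtain c where c: "\<And>i. s i \<longlonglongrightarrow> c i" "c \<longlonglongrightarrow> J" using assms(1) by (auto simp: has_iterated_limit_def)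
  obtain d where d: "\<And>i. s i \<longlonglongrightarrow> d i" "d \<longlonglongrightarrow> K" using assms(2) by (auto simp: has_iterated_limit_def)
  have "c = d" using LIMSEQ_unique[OF c(1) d(1)] by auto
  with c(2) d(2) show ?thesis using LIMSEQ_unique by blast
qed

lemma local_time_continuous:
  assumes "is_local_time p \<pi> T S L" "t \<in> {0..T}"
  shows "continuous_on {path_min T S..path_max T S} (L t)"
proof -
  let ?X = "{path_min T S..path_max T S}"
  have "continuous_on ({0..T} \<times> ?X) (\<lambda>(t, x). L t x)"
    using assms(1) by (simp add: is_local_time_def)
  then have "continuous_on ?X (\<lambda>x. (\<lambda>(t, x). L t x) (t, x))"
    by (rule continuous_on_compose2) (use assms(2) in \<open>auto intro!: continuous_intros\<close>)
  then show ?thesis by simp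
qed

text \<open>
  The inner limit is the formula for the smooth function \<open>F i\<close>, in terms of the local time by the
  occupation formula; admissibility is convergence of its last term.
\<close>

lemma foellmer_iterated_limit:
  assumes "T > 0" "nested_partitions T \<pi>" "even p" "p > 0" and S: "S \<in> V_class p \<pi> T"
    and L: "is_local_time p \<pi> T S L" and t: "t \<in> {0..T}" and adm: "admissible p (L t) f F I"
  shows "has_iterated_limit (\<lambda>i n. foellmer_sum p \<pi> S (F i) t n) (f (S t) - f (S 0) - 1 / fact (p - 1) * I)"
proof -
  define \<mu> where "\<mu> = variation_measure p \<pi> T S"
  have \<mu>: "is_variation_measure p \<pi> T S \<mu>"
    using S unfolding V_class_def \<mu>_def variation_measure_def by (auto intro: someI)
  have S_cont: "continuous_on {0..T} S" and osc: "(\<lambda>n. osc S (\<pi> n)) \<longlonglongrightarrow> 0"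
    using S by (auto simp: V_class_def)
  have sets: "sets \<mu> = sets (restrict_space borel {0..T})" using \<mu> by (simp add: is_variation_measure_def)
  have "integrable \<mu> (\<lambda>_. 1::real)"
    using \<mu> continuous_on_const unfolding is_variation_measure_def by blast
  then have fin: "finite_measure \<mu>" by (intro finite_measureI) (simp add: integrable_iff_bounded less_top)
  let ?m = "path_min T S" and ?M = "path_max T S"
  have l_cont: "continuous_on {?m..?M} (L t)" by (rule local_time_continuous[OF L t])
  have l_int: "integrable lborel (L t)"
  proof -
    have "L t = (\<lambda>x. indicator {?m..?M} x *\<^sub>R L t x)"
      using L t by (auto simp: is_local_time_def indicator_def fun_eq_iff)
    then show ?thesis using borel_integrable_atLeastAtMost'[OF l_cont] unfolding set_integrable_def by simp
  qed
  have smooth: "C_infinity (F i)" and lim: "(\<lambda>i. F i x) \<longlonglongrightarrow> f x" for i x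
    using adm by (auto simp: admissible_def smooth_approximation_def)
  let ?J = "\<lambda>i. LINT x|lborel. L t x * (deriv ^^ p) (F i) x"
  have "(\<lambda>n. foellmer_sum p \<pi> S (F i) t n) \<longlonglongrightarrow> F i (S t) - F i (S 0) - 1 / fact (p - 1) * ?J i" for i
  proof -
    have "real p * ?J i = (LINT u:{0..t}|\<mu>. (deriv ^^ p) (F i) (S u))"
    proof (rule occupation_integral[OF sets fin S_cont t l_int])
      show "(deriv ^^ p) (F i) \<in> borel_measurable borel"
        by (rule borel_measurable_continuous_onI[OF C_infinity_continuous[OF smooth]])
      show "0 \<le> L t x" for x using L t by (simp add: is_local_time_def)
      show "real p * (LINT x:A|lborel. L t x) = (LINT u:{0..t}|\<mu>. indicator A (S u))" if "A \<in> sets borel" for A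
        using L t that by (simp add: is_local_time_def \<mu>_def)
    qed simp
    moreover have "(fact p :: real) = real p * fact (p - 1)" using \<open>p > 0\<close> by (simp add: fact_reduce)
    ultimately have "(LINT u:{0..t}|\<mu>. (deriv ^^ p) (F i) (S u)) / fact p = 1 / fact (p - 1) * ?J i"
      using \<open>p > 0\<close> by (simp add: field_simps)
    with foellmer_sum_limit[OF assms(1-4) S_cont osc \<mu> t smooth, of i] show ?thesis by simp
  qed
  moreover have "(\<lambda>i. F i (S t) - F i (S 0) - 1 / fact (p - 1) * ?J i) \<longlonglongrightarrow> f (S t) - f (S 0) - 1 / fact (p - 1) * I"
    using adm unfolding admissible_def by (intro tendsto_diff tendsto_mult tendsto_const lim) auto
  ultimately show ?thesis unfolding has_iterated_limit_def by (intro exI conjI allI)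
qed

theorem theorem6p5:
  fixes T t :: real and \<pi> :: "nat \<Rightarrow> real set" and p :: nat
    and f g S :: "real \<Rightarrow> real" and L :: "real \<Rightarrow> real \<Rightarrow> real"
  assumes "T > 0"
    and "nested_partitions T \<pi>"
    and "even p" and "p > 0"
    and "C_k (p - 2) f"
    and "absolutely_continuous_real ((deriv ^^ (p - 2)) f)"
    and "is_weak_derivative ((deriv ^^ (p - 2)) f) g"
    and "right_continuous g"
    and "bounded_variation g"
    and "S \<in> Lc_class p \<pi> T"
    and "is_local_time p \<pi> T S L"
    and "t \<in> {0..T}"
  shows "(\<exists>J. has_modified_foellmer_integral p \<pi> S (L t)
                (tame_sequences p (L t) (path_min T S) (path_max T S) g) f t J \<and>
              f (S t) - f (S 0) = J + 1 / fact (p - 1) * stieltjes_integral (L t) g) \<and>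
         (\<forall>J. has_modified_foellmer_integral p \<pi> S (L t) UNIV f t J \<longrightarrow>
              f (S t) - f (S 0) = J + 1 / fact (p - 1) * stieltjes_integral (L t) g)"
proof -
  let ?l = "L t" and ?m = "path_min T S" and ?M = "path_max T S"
  let ?tame = "tame_sequences p ?l ?m ?M g" and ?I = "stieltjes_integral ?l g"
  define r where "r = p - 2"
  have p: "p = Suc (Suc r)" using \<open>even p\<close> \<open>p > 0\<close> by (auto simp: r_def elim!: evenE)
  have f: "C_k r f" and weak: "is_weak_derivative ((deriv ^^ r) f) g"
    using assms(5,7) by (simp_all add: r_def)
  note rc = \<open>right_continuous g\<close> and bv = \<open>bounded_variation g\<close>
  have S: "S \<in> V_class p \<pi> T" using \<open>S \<in> Lc_class p \<pi> T\<close> by (simp add: Lc_class_def)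
  have m_le_M: "?m \<le> ?M"
  proof -
    have "bounded (S ` {0..T})"
      using S by (intro compact_imp_bounded compact_continuous_image) (auto simp: V_class_def)
    then show ?thesis
      unfolding path_min_def path_max_def using \<open>T > 0\<close>
      by (intro cInf_le_cSup bounded_imp_bdd_above bounded_imp_bdd_below) auto
  qed
  have l_cont: "continuous_on {?m..?M} ?l" by (rule local_time_continuous[OF assms(11,12)])
  have l0: "?l x = 0" if "x \<notin> {?m..?M} \<or> ?m = ?M" for x
    using assms(11,12) that unfolding is_local_time_def by blast
  have tame_limit: "admissible p ?l f F ?I" if "F \<in> ?tame" "smooth_approximation f F" for F
  proof (cases "?m = ?M")
    case True
    then have "?l = (\<lambda>_. 0)" using l0 by auto
    then show ?thesis using that(2) by (simp add: admissible_def stieltjes_integral_def)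
  next
    case False
    with m_le_M have "?m < ?M" by simp
    from tame_integrals_converge[OF f weak rc bv this l_cont l0 that[unfolded p]] that(2)
    show ?thesis by (simp add: admissible_def p)
  qed
  obtain F where F: "F \<in> ?tame" "smooth_approximation f F"
  proof -
    \<comment> \<open>For a constant path the local time vanishes and the end point conditions are void, so any
      point to the right of \<open>m\<close> can take the place of \<open>M\<close>.\<close>
    define M' where "M' = (if ?m = ?M then ?m + 1 else ?M)"
    have "?m < M'" using m_le_M by (auto simp: M'_def)
    obtain F where F: "smooth_approximation f F"
      "\<And>a b. \<exists>C. \<forall>i. (LINT x:{a..b}|lborel. \<bar>(deriv ^^ p) (F i) x\<bar>) \<le> C"
      "(\<lambda>i. (deriv ^^ (p - 1)) (F i) ?m) \<longlonglongrightarrow> Lim (at_left ?m) g"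
      "(\<lambda>i. (deriv ^^ (p - 1)) (F i) M') \<longlonglongrightarrow> g M'"
      using exists_tame_approximation[OF f weak rc bv \<open>?m < M'\<close>] unfolding p diff_Suc_1 by metis
    have "(\<lambda>i. (deriv ^^ (p - 1)) (F i) ?M) \<longlonglongrightarrow> g ?M" if "?l ?M \<noteq> 0"
    proof -
      have "?m \<noteq> ?M" using that l0 by blast
      then have "M' = ?M" by (simp add: M'_def)
      with F(4) show ?thesis by simp
    qed
    with F have "F \<in> ?tame" unfolding tame_sequences_def by blast
    with F(1) show thesis using that by blast
  qed
  have limit: "has_iterated_limit (\<lambda>i n. foellmer_sum p \<pi> S (G i) t n) (f (S t) - f (S 0) - 1 / fact (p - 1) * I)"
    if "admissible p ?l f G I" for G I
    by (rule foellmer_iterated_limit[OF assms(1-4) S assms(11,12) that])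
  have unique: "I = ?I" if "G \<in> ?tame" "admissible p ?l f G I" for G I
    using tame_limit[OF that(1)] that(2) LIMSEQ_unique unfolding admissible_def by blast
  have "has_modified_foellmer_integral p \<pi> S ?l ?tame f t (f (S t) - f (S 0) - 1 / fact (p - 1) * ?I)"
    unfolding has_modified_foellmer_integral_def
    using F tame_limit[OF F] unique limit by (metis (no_types, lifting))
  moreover have "f (S t) - f (S 0) = J + 1 / fact (p - 1) * ?I"
    if "has_modified_foellmer_integral p \<pi> S ?l UNIV f t J" for J
  proof -
    have "has_iterated_limit (\<lambda>i n. foellmer_sum p \<pi> S (F i) t n) J"
      using that tame_limit[OF F] unfolding has_modified_foellmer_integral_def by blast
    then have "J = f (S t) - f (S 0) - 1 / fact (p - 1) * ?I"
      by (rule has_iterated_limit_unique[OF _ limit[OF tame_limit[OF F]]])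
    then show ?thesis by simp
  qed
  ultimately show ?thesis by fastforce
qed

end
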